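(* Let $(\mathbf{P},m,\Delta)$ be a twisted bialgebra with unit $1_{\mathbf{P}}$ and counit $\varepsilon_\Delta$, and let $\delta$ be a contraction-extraction coproduct on the species $\mathbf{P}$. Assume that for all finite sets $X,Y$ and every $\sim\in\mathcal{E}[X\sqcup Y]$, putting $\sim_X=\sim\cap X^2$ and $\sim_Y=\sim\cap Y^2$: \[\delta_\sim\circ m_{X,Y}=\begin{cases}(m_{X/\sim_X,Y/\sim_Y}\otimes m_{X,Y})\circ(\mathrm{Id}\otimes c\otimes\mathrm{Id})\circ(\delta_{\sim_X}\otimes\delta_{\sim_Y})&\text{if }\sim=\sim_X\sqcup\sim_Y,\\0&\text{otherwise,}\end{cases}\] \[(\Delta_{X/\sim_X,Y/\sim_Y}\otimes\mathrm{Id})\circ\delta_\sim=m_{1,3,24}\circ(\delta_{\sim_X}\otimes\delta_{\sim_Y})\circ\Delta_{X,Y}\quad\text{if }\sim=\sim_X\sqcup\sim_Y,\] and, denoting by $\sim_\emptyset$ the unique equivalence on $\emptyset$, \[\delta_{\sim_\emptyset}(1_{\mathbf{P}})=1_{\mathbf{P}}\otimes1_{\mathbf{P}},\qquad(\varepsilon_\Delta\otimes\mathrm{Id})\circ\delta_{\sim_\emptyset}(x)=\varepsilon_\Delta(x)1_{\mathbf{P}}\quad\text{for all }x\in\mathbf{P}[\emptyset].\] Let $\mathbf{P}'=\mathbf{P}\circ\mathbf{Com}$ with its product $m'$, coproduct $\Delta'$ and the coproduct $\delta'$ associated to $\delta$ (all described in the context). Then $(\mathbf{P}',m',\Delta',\delta')$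 is a double twisted bialgebra.
   Context: $\mathbb{K}$ is a field. A species $\mathbf{P}$ is a functor from the category of finite sets with bijections to $\mathbb{K}$-vector spaces, written $X\mapsto\mathbf{P}[X]$, $\sigma\mapsto\mathbf{P}[\sigma]$. $\sqcup$ is disjoint union, $c$ denotes the flip $x\otimes y\mapsto y\otimes x$. Twisted algebra $(\mathbf{P},m)$: linear maps $m_{X,Y}:\mathbf{P}[X]\otimes\mathbf{P}[Y]\to\mathbf{P}[X\sqcup Y]$, natural in bijections of $X$ and $Y$, with $m_{X\sqcup Y,Z}\circ(m_{X,Y}\otimes\mathrm{Id})=m_{X,Y\sqcup Z}\circ(\mathrm{Id}\otimes m_{Y,Z})$, and a unit $1_{\mathbf{P}}\in\mathbf{P}[\emptyset]$ with $m_{\emptyset,X}(1_{\mathbf{P}}\otimes x)=x=m_{X,\emptyset}(x\otimes1_{\mathbf{P}})$. Twisted coalgebra $(\mathbf{P},\Delta)$: linear maps $\Delta_{X,Y}:\mathbf{P}[X\sqcup Y]\to\mathbf{P}[X]\otimes\mathbf{P}[Y]$, natural in bijections, with $(\Delta_{X,Y}\otimes\mathrm{Id})\circ\Delta_{X\sqcup Y,Z}=(\mathrm{Id}\otimes\Delta_{Y,Z})\circ\Delta_{X,Y\sqcup Z}$, and a counit $\varepsilon_\Delta:\mathbf{P}[\emptyset]\to\mathbb{K}$ with $(\varepsilon_\Delta\otimes\mathrm{Id})\circ\Delta_{\emptyset,X}=\mathrm{Id}=(\mathrm{Id}\otimes\varepsilon_\Delta)\circ\Delta_{X,\emptyset}$.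 Twisted bialgebra $(\mathbf{P},m,\Delta)$: both, such that whenever $I\sqcup J=I'\sqcup J'$, $\Delta_{I,J}\circ m_{I',J'}=(m_{I'\cap I,J'\cap I}\otimes m_{I'\cap J,J'\cap J})\circ(\mathrm{Id}\otimes c\otimes\mathrm{Id})\circ(\Delta_{I'\cap I,I'\cap J}\otimes\Delta_{J'\cap I,J'\cap J})$, $\Delta_{\emptyset,\emptyset}(1_{\mathbf{P}})=1_{\mathbf{P}}\otimes1_{\mathbf{P}}$, and $\varepsilon_\Delta$ is multiplicative and unital on $\mathbf{P}[\emptyset]$. Equivalences. $\mathcal{E}[X]$ is the set of equivalence relations on $X$, ordered by: $\sim\leq\sim'$ iff ($x\sim'y\Rightarrow x\sim y$), i.e. classes of $\sim$ are unions of classes of $\sim'$. For $\sim'\in\mathcal{E}[X]$, one identifies $\mathcal{E}[X/\sim']$ with $\{\sim\in\mathcal{E}[X]:\sim\leq\sim'\}$ and the corresponding iterated quotient $(X/\sim')/\sim$ with $X/\sim$. For a bijection $\sigma:X\to Y$, $\sim_\sigma$ is the transported equivalence on $Y$ and $\sigma/\sim:X/\sim\to Y/\sim_\sigma$ the induced bijection. For $\sim_X\in\mathcal{E}[X]$, $\sim_Y\in\mathcal{E}[Y]$, $\sim_X\sqcup\sim_Y$ is the equivalence on $X\sqcup Y$ whose classes are those of $\sim_X$ and those of $\sim_Y$, and $(X\sqcup Y)/(\sim_X\sqcup\sim_Y)=X/\sim_X\sqcup Y/\sim_Y$. Contraction-extraction coproduct $\delta$ on a species $\mathbf{P}$: linear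 maps $\delta_\sim:\mathbf{P}[X]\to\mathbf{P}[X/\sim]\otimes\mathbf{P}[X]$ for every finite set $X$ and $\sim\in\mathcal{E}[X]$, such that: (i) for every bijection $\sigma:X\to Y$, $\delta_{\sim_\sigma}\circ\mathbf{P}[\sigma]=(\mathbf{P}[\sigma/\sim]\otimes\mathbf{P}[\sigma])\circ\delta_\sim$; (ii) if $\sim\leq\sim'$ in $\mathcal{E}[X]$, $(\delta_\sim\otimes\mathrm{Id})\circ\delta_{\sim'}=(\mathrm{Id}\otimes\delta_{\sim'})\circ\delta_\sim$ (on the left, $\delta_\sim$ is applied to $\mathbf{P}[X/\sim']$, viewing $\sim$ as an element of $\mathcal{E}[X/\sim']$); if $\sim\leq\sim'$ does not hold, $(\mathrm{Id}\otimes\delta_{\sim'})\circ\delta_\sim=0$; (iii) there are linear maps $\epsilon_\delta[X]:\mathbf{P}[X]\to\mathbb{K}$, invariant under bijections, such that $(\mathrm{Id}\otimes\epsilon_\delta[X])\circ\delta_\sim$ is $\mathrm{Id}_{\mathbf{P}[X]}$ if $\sim$ is the equality of $X$ and $0$ otherwise, and $\sum_{\sim\in\mathcal{E}[X]}(\epsilon_\delta[X/\sim]\otimes\mathrm{Id})\circ\delta_\sim=\mathrm{Id}_{\mathbf{P}[X]}$. The map $m_{1,3,24}$ sends $a\otimes b\otimes a'\otimes b'$ to $a\otimes a'\otimes m(b\otimes b')$; in the claim it goes from $\mathbf{P}[X/\sim_X]\otimes\mathbf{P}[X]\otimes\mathbf{P}[Y/\sim_Y]\otimes\mathbf{P}[Y]$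 to $\mathbf{P}[X/\sim_X]\otimes\mathbf{P}[Y/\sim_Y]\otimes\mathbf{P}[X\sqcup Y]$. The species $\mathbf{P}'=\mathbf{P}\circ\mathbf{Com}$: $\mathbf{P}'[X]=\bigoplus_{\sim\in\mathcal{E}[X]}\mathbf{P}[X/\sim]$, with $\mathbf{P}'[\sigma]$ equal to $\mathbf{P}[\sigma/\sim]$ on $\mathbf{P}[X/\sim]$. Its structures: $m'_{X,Y}$ restricted to $\mathbf{P}[X/\sim_X]\otimes\mathbf{P}[Y/\sim_Y]$ is $m_{X/\sim_X,Y/\sim_Y}$, with values in $\mathbf{P}[(X\sqcup Y)/(\sim_X\sqcup\sim_Y)]$; unit $1_{\mathbf{P}}\in\mathbf{P}[\emptyset]=\mathbf{P}'[\emptyset]$; $\Delta'_{X,Y}$ restricted to $\mathbf{P}[(X\sqcup Y)/\sim]$ is $\Delta_{X/\sim_X,Y/\sim_Y}$ if $\sim=\sim_X\sqcup\sim_Y$ (where $\sim_X=\sim\cap X^2$, $\sim_Y=\sim\cap Y^2$) and $0$ otherwise; counit $\varepsilon_\Delta$; $\delta'_X:\mathbf{P}'[X]\to\mathbf{P}'[X]\otimes\mathbf{P}'[X]$ restricted to $\mathbf{P}[X/\sim']$ is $\sum_{\sim\leq\sim'}\delta_\sim$, with $\delta_\sim:\mathbf{P}[X/\sim']\to\mathbf{P}[X/\sim]\otimes\mathbf{P}[X/\sim']$. Double twisted bialgebra $(\mathbf{Q},m,\Delta,\delta)$: (1) $(\mathbf{Q},m,\Delta)$ is a twisted bialgebra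 with unit $1_{\mathbf{Q}}$ and counit $\varepsilon_\Delta$; (2) for every finite set $X$, $\delta_X:\mathbf{Q}[X]\to\mathbf{Q}[X]\otimes\mathbf{Q}[X]$ is a coassociative coproduct with a counit $\epsilon_X$, $\delta_X$ and $\epsilon_X$ being natural in bijections; $\delta_{X\sqcup Y}\circ m_{X,Y}=(m_{X,Y}\otimes m_{X,Y})\circ(\mathrm{Id}\otimes c\otimes\mathrm{Id})\circ(\delta_X\otimes\delta_Y)$ and $\delta_\emptyset(1_{\mathbf{Q}})=1_{\mathbf{Q}}\otimes1_{\mathbf{Q}}$; (3) for all finite $X,Y$, $m_{1,3,24}\circ(\delta_X\otimes\delta_Y)\circ\Delta_{X,Y}=(\Delta_{X,Y}\otimes\mathrm{Id})\circ\delta_{X\sqcup Y}$, and $(\varepsilon_\Delta\otimes\mathrm{Id})\circ\delta_\emptyset(x)=\varepsilon_\Delta(x)1_{\mathbf{Q}}$ for $x\in\mathbf{Q}[\emptyset]$. *)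

theory Defs
  imports Complex_Main "HOL-Library.FSet" "HOL-Library.Function_Algebras"
begin

section \<open>Vector spaces and tensor products\<close>

text \<open>A \<open>'k\<close>-vector space is given by a vector space structure (in the sense of
  the library) on a whole type, together with a subspace of it. This makes addition and finite
  sums available as type class operations, while the vector spaces occurring as values of a
  species may have arbitrary and different dimensions. Maps out of such a space are only ever
  constrained on its carrier.\<close>

record ('k, 'v) kspace =
  vcarrier :: "'v set"
  vscale :: "'k \<Rightarrow> 'v \<Rightarrow> 'v"

definition vec_space :: "('k::field, 'v::ab_group_add) kspace \<Rightarrow> bool" where
  "vec_space V \<longleftrightarrow> vector_space (vscale V) \<and> module.subspace (vscale V) (vcarrier V)"

definition scalars :: "('k::field, 'k) kspace" where
  "scalars = \<lparr>vcarrier = UNIV, vscale = (*)\<rparr>"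

definition linear_on ::
  "('k::field, 'v::ab_group_add) kspace \<Rightarrow> ('k, 'w::ab_group_add) kspace \<Rightarrow> ('v \<Rightarrow> 'w) \<Rightarrow> bool" where
  "linear_on V W f \<longleftrightarrow>
     (\<forall>x \<in> vcarrier V. f x \<in> vcarrier W) \<and>
     (\<forall>x \<in> vcarrier V. \<forall>y \<in> vcarrier V. f (x + y) = f x + f y) \<and>
     (\<forall>c. \<forall>x \<in> vcarrier V. f (vscale V c x) = vscale W c (f x))"

definition bilinear_on ::
  "('k::field, 'v::ab_group_add) kspace \<Rightarrow> ('k, 'w::ab_group_add) kspace \<Rightarrow>
   ('k, 'u::ab_group_add) kspace \<Rightarrow> ('v \<Rightarrow> 'w \<Rightarrow> 'u) \<Rightarrow> bool" where
  "bilinear_on V W U b \<longleftrightarrow>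
     (\<forall>w \<in> vcarrier W. linear_on V U (\<lambda>v. b v w)) \<and>
     (\<forall>v \<in> vcarrier V. linear_on W U (\<lambda>w. b v w))"

text \<open>The tensor product \<open>V \<otimes> W\<close> is realised inside the dual of the space of bilinear
  forms on \<open>V \<times> W\<close>: the elementary tensor of \<open>v\<close> and \<open>w\<close> is evaluation at \<open>(v, w)\<close>, and
  \<open>V \<otimes> W\<close> consists of the finite sums of elementary tensors. The universal property is proved
  below (\<open>tlift_universal\<close>, \<open>tlift_unique\<close>).\<close>

type_synonym ('k, 'v, 'w) tensor = "('v \<Rightarrow> 'w \<Rightarrow> 'k) \<Rightarrow> 'k"

definition ten ::
  "('k::field, 'v::ab_group_add) kspace \<Rightarrow> ('k, 'w::ab_group_add) kspace \<Rightarrow> 'v \<Rightarrow> 'w \<Rightarrow> ('k, 'v, 'w) tensor" where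
  "ten V W v w = (\<lambda>b. if bilinear_on V W scalars b then b v w else 0)"

definition tensor_space ::
  "('k::field, 'v::ab_group_add) kspace \<Rightarrow> ('k, 'w::ab_group_add) kspace \<Rightarrow>
   ('k, ('k, 'v, 'w) tensor) kspace" (infixl "\<otimes>" 70) where
  "V \<otimes> W =
     \<lparr>vcarrier = {\<Sum>(v, w)\<leftarrow>ps. ten V W v w |ps. set ps \<subseteq> vcarrier V \<times> vcarrier W},
      vscale = (\<lambda>c t b. c * t b)\<rparr>"

text \<open>The linear map on \<open>V \<otimes> W\<close> sending \<open>v \<otimes> w\<close> to \<open>b v w\<close>, for a bilinear map \<open>b\<close>.\<close>

definition tlift ::
  "('k::field, 'v::ab_group_add) kspace \<Rightarrow> ('k, 'w::ab_group_add) kspace \<Rightarrow>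
   ('v \<Rightarrow> 'w \<Rightarrow> 'u::ab_group_add) \<Rightarrow> ('k, 'v, 'w) tensor \<Rightarrow> 'u" where
  "tlift V W b t =
     (THE u. \<exists>ps. set ps \<subseteq> vcarrier V \<times> vcarrier W \<and>
        t = (\<Sum>(v, w)\<leftarrow>ps. ten V W v w) \<and> u = (\<Sum>(v, w)\<leftarrow>ps. b v w))"

lemma vec_space_scalars: "vec_space (scalars :: ('k::field, 'k) kspace)"
proof -
  have vs: "vector_space ((*) :: 'k \<Rightarrow> 'k \<Rightarrow> 'k)"
    by unfold_locales (auto simp: algebra_simps)
  then interpret vector_space "(*) :: 'k \<Rightarrow> 'k \<Rightarrow> 'k" .
  show ?thesis
    using vs subspace_UNIV by (simp add: vec_space_def scalars_def)
qed

lemma vec_space_closed: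
  assumes "vec_space V"
  shows "0 \<in> vcarrier V"
    and "x \<in> vcarrier V \<Longrightarrow> y \<in> vcarrier V \<Longrightarrow> x + y \<in> vcarrier V"
    and "x \<in> vcarrier V \<Longrightarrow> vscale V c x \<in> vcarrier V"
proof -
  interpret vector_space "vscale V" using assms by (simp add: vec_space_def)
  have s: "subspace (vcarrier V)" using assms by (simp add: vec_space_def)
  show "0 \<in> vcarrier V"
    and "x \<in> vcarrier V \<Longrightarrow> y \<in> vcarrier V \<Longrightarrow> x + y \<in> vcarrier V"
    and "x \<in> vcarrier V \<Longrightarrow> vscale V c x \<in> vcarrier V"
    using s by (auto simp: subspace_def)
qed

lemma sum_list_closed:
  assumes "vec_space V" "set xs \<subseteq> vcarrier V"
  shows "sum_list xs \<in> vcarrier V"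
  using assms(2) by (induction xs) (auto simp: vec_space_closed[OF assms(1)])

lemma linear_on_zero:
  assumes "vec_space V" "linear_on V W f"
  shows "f 0 = 0"
proof -
  have "f (0 + 0) = f 0 + f 0"
    using assms vec_space_closed(1)[OF assms(1)] unfolding linear_on_def by blast
  then show ?thesis by simp
qed

lemma linear_on_sum_list:
  assumes "vec_space V" "linear_on V W f" "set xs \<subseteq> vcarrier V"
  shows "f (sum_list xs) = sum_list (map f xs)"
  using assms(3)
proof (induction xs)
  case Nil
  then show ?case using linear_on_zero[OF assms(1,2)] by simp
next
  case (Cons x xs)
  have "sum_list xs \<in> vcarrier V" using Cons.prems by (intro sum_list_closed assms(1)) auto
  then show ?case using Cons assms(2) by (auto simp: linear_on_def)
qed

lemma ten_add_left:
  assumes "v \<in> vcarrier V" "v' \<in> vcarrier V" "w \<in> vcarrier W"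
  shows "ten V W (v + v') w = ten V W v w + ten V W v' w"
  using assms by (auto simp: ten_def fun_eq_iff bilinear_on_def linear_on_def)

lemma ten_add_right:
  assumes "v \<in> vcarrier V" "w \<in> vcarrier W" "w' \<in> vcarrier W"
  shows "ten V W v (w + w') = ten V W v w + ten V W v w'"
  using assms by (auto simp: ten_def fun_eq_iff bilinear_on_def linear_on_def)

lemma ten_scale_left:
  assumes "v \<in> vcarrier V" "w \<in> vcarrier W"
  shows "ten V W (vscale V c v) w = vscale (V \<otimes> W) c (ten V W v w)"
  using assms
  by (auto simp: ten_def fun_eq_iff bilinear_on_def linear_on_def tensor_space_def scalars_def)

lemma ten_scale_right:
  assumes "v \<in> vcarrier V" "w \<in> vcarrier W"
  shows "ten V W v (vscale W c w) = vscale (V \<otimes> W) c (ten V W v w)"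
  using assms
  by (auto simp: ten_def fun_eq_iff bilinear_on_def linear_on_def tensor_space_def scalars_def)

lemma ten_in:
  assumes "v \<in> vcarrier V" "w \<in> vcarrier W"
  shows "ten V W v w \<in> vcarrier (V \<otimes> W)"
  using assms by (auto simp: tensor_space_def intro!: exI[of _ "[(v, w)]"])

lemma tensor_carrier_iff:
  "t \<in> vcarrier (V \<otimes> W) \<longleftrightarrow>
     (\<exists>ps. set ps \<subseteq> vcarrier V \<times> vcarrier W \<and> t = (\<Sum>(v, w)\<leftarrow>ps. ten V W v w))"
  by (auto simp: tensor_space_def)

lemma scale_tensor_sum_list:
  assumes "set ps \<subseteq> vcarrier V \<times> vcarrier W"
  shows "vscale (V \<otimes> W) c (\<Sum>(v, w)\<leftarrow>ps. ten V W v w) =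
    (\<Sum>(v, w)\<leftarrow>map (\<lambda>(v, w). (vscale V c v, w)) ps. ten V W v w)"
  using assms
proof (induction ps)
  case Nil
  then show ?case by (simp add: tensor_space_def fun_eq_iff)
next
  case (Cons p ps)
  obtain v w where p: "p = (v, w)" by force
  have "vscale (V \<otimes> W) c (s + t) = vscale (V \<otimes> W) c s + vscale (V \<otimes> W) c t" for s t
    by (simp add: tensor_space_def fun_eq_iff algebra_simps)
  then have "vscale (V \<otimes> W) c (\<Sum>(v, w)\<leftarrow>p # ps. ten V W v w) =
      vscale (V \<otimes> W) c (ten V W v w) + vscale (V \<otimes> W) c (\<Sum>(v, w)\<leftarrow>ps. ten V W v w)"
    by (simp only: p list.map sum_list.Cons prod.case)
  also have "vscale (V \<otimes> W) c (\<Sum>(v, w)\<leftarrow>ps. ten V W v w) =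
      (\<Sum>(v, w)\<leftarrow>map (\<lambda>(v, w). (vscale V c v, w)) ps. ten V W v w)"
    using Cons by simp
  also have "vscale (V \<otimes> W) c (ten V W v w) = ten V W (vscale V c v) w"
    using Cons.prems p by (simp add: ten_scale_left)
  finally show ?case by (simp only: p list.map sum_list.Cons prod.case)
qed

lemma vec_space_tensor:
  assumes "vec_space V" "vec_space W"
  shows "vec_space (V \<otimes> W)"
proof -
  have vs: "vector_space (vscale (V \<otimes> W))"
    by unfold_locales (auto simp: tensor_space_def fun_eq_iff algebra_simps)
  then interpret T: vector_space "vscale (V \<otimes> W)" .
  have "T.subspace (vcarrier (V \<otimes> W))"
    unfolding T.subspace_def
  proof (intro conjI ballI allI)
    show "0 \<in> vcarrier (V \<otimes> W)"
      unfolding tensor_carrier_iff by (rule exI[of _ "[]"]) simp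
  next
    fix s t assume "s \<in> vcarrier (V \<otimes> W)" "t \<in> vcarrier (V \<otimes> W)"
    then obtain ps qs where "set ps \<subseteq> vcarrier V \<times> vcarrier W" "s = (\<Sum>(v, w)\<leftarrow>ps. ten V W v w)"
      "set qs \<subseteq> vcarrier V \<times> vcarrier W" "t = (\<Sum>(v, w)\<leftarrow>qs. ten V W v w)"
      unfolding tensor_carrier_iff by blast
    then show "s + t \<in> vcarrier (V \<otimes> W)"
      unfolding tensor_carrier_iff by (intro exI[of _ "ps @ qs"]) auto
  next
    fix c t assume "t \<in> vcarrier (V \<otimes> W)"
    then obtain ps where ps: "set ps \<subseteq> vcarrier V \<times> vcarrier W" "t = (\<Sum>(v, w)\<leftarrow>ps. ten V W v w)"
      unfolding tensor_carrier_iff by blast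
    have "set (map (\<lambda>(v, w). (vscale V c v, w)) ps) \<subseteq> vcarrier V \<times> vcarrier W"
      using ps(1) vec_space_closed(3)[OF assms(1)] by auto
    with ps(2) scale_tensor_sum_list[OF ps(1), of c] show "vscale (V \<otimes> W) c t \<in> vcarrier (V \<otimes> W)"
      unfolding tensor_carrier_iff by metis
  qed
  with vs show ?thesis by (simp add: vec_space_def)
qed

lemma bilinear_on_ten: "bilinear_on V W (V \<otimes> W) (ten V W)"
  unfolding bilinear_on_def linear_on_def
  by (auto simp: ten_in ten_add_left ten_add_right ten_scale_left ten_scale_right)

lemma separating_form:
  assumes "vec_space (U :: ('k::field, 'u::ab_group_add) kspace)" "u \<noteq> 0"
  shows "\<exists>f. f u \<noteq> 0 \<and> (\<forall>x y. f (x + y) = f x + f y) \<and> (\<forall>c x. f (vscale U c x) = c * f x)"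
proof -
  interpret vector_space "vscale U" using assms by (simp add: vec_space_def)
  have i: "independent {u}" using assms(2) by simp
  let ?B = "extend_basis {u}"
  have B: "independent ?B" "span ?B = UNIV" "u \<in> ?B"
    using independent_extend_basis[OF i] span_extend_basis[OF i] extend_basis_superset[OF i] by auto
  show ?thesis
    by (rule exI[of _ "\<lambda>x. representation ?B x u"])
      (simp add: B representation_add representation_scale representation_basis)
qed

lemma bilinear_sum_cong:
  assumes U: "vec_space U" and b: "bilinear_on V W U b"
    and ps: "set ps \<subseteq> vcarrier V \<times> vcarrier W" and qs: "set qs \<subseteq> vcarrier V \<times> vcarrier W"
    and eq: "(\<Sum>(v, w)\<leftarrow>ps. ten V W v w) = (\<Sum>(v, w)\<leftarrow>qs. ten V W v w)"
  shows "(\<Sum>(v, w)\<leftarrow>ps. b v w) = (\<Sum>(v, w)\<leftarrow>qs. b v w)"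
proof (rule ccontr)
  let ?s = "\<lambda>ps. (\<Sum>(v, w)\<leftarrow>ps. b v w)"
  assume "?s ps \<noteq> ?s qs"
  then have "?s ps - ?s qs \<noteq> 0" by simp
  from separating_form[OF U this] obtain f where f: "f (?s ps - ?s qs) \<noteq> 0"
    and add: "\<And>x y. f (x + y) = f x + f y" and scale: "\<And>c x. f (vscale U c x) = c * f x"
    by blast
  have "f 0 = f 0 + f 0" using add[of 0 0] by (simp only: add_0)
  then have f0: "f 0 = 0" by (metis add_cancel_left_left)
  have "f (?s ps - ?s qs + ?s qs) = f (?s ps - ?s qs) + f (?s qs)" by (rule add)
  with f have ne: "f (?s ps) \<noteq> f (?s qs)" by auto
  let ?c = "\<lambda>v w. f (b v w)"
  have c: "bilinear_on V W scalars ?c"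
    using b by (simp add: bilinear_on_def linear_on_def scalars_def add scale)
  have ev: "(\<Sum>(v, w)\<leftarrow>rs. ten V W v w) ?c = f (?s rs)" for rs
  proof (induction rs)
    case (Cons r rs)
    obtain v w where r: "r = (v, w)" by force
    have "ten V W v w ?c = f (b v w)" using c by (simp add: ten_def)
    then show ?case using Cons r by (simp add: add)
  qed (simp add: f0)
  show False using ne ev[of ps] ev[of qs] eq by simp
qed

lemma tlift_sum_list:
  assumes "vec_space U" "bilinear_on V W U b" "set ps \<subseteq> vcarrier V \<times> vcarrier W"
  shows "tlift V W b (\<Sum>(v, w)\<leftarrow>ps. ten V W v w) = (\<Sum>(v, w)\<leftarrow>ps. b v w)"
  unfolding tlift_def
proof (rule the_equality, goal_cases)
  case 1
  show ?case using assms(3) by blast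
next
  case (2 u)
  then show ?case using bilinear_sum_cong[OF assms(1,2) _ assms(3)] by metis
qed

lemma tlift_universal:
  assumes V: "vec_space V" and W: "vec_space W" and U: "vec_space U" and b: "bilinear_on V W U b"
  shows "linear_on (V \<otimes> W) U (tlift V W b)"
    and "v \<in> vcarrier V \<Longrightarrow> w \<in> vcarrier W \<Longrightarrow> tlift V W b (ten V W v w) = b v w"
proof -
  note lift = tlift_sum_list[OF U b]
  have bin: "set ps \<subseteq> vcarrier V \<times> vcarrier W \<Longrightarrow> (\<Sum>(v, w)\<leftarrow>ps. b v w) \<in> vcarrier U" for ps
    using b by (intro sum_list_closed U) (auto simp: bilinear_on_def linear_on_def)
  show "linear_on (V \<otimes> W) U (tlift V W b)"
    unfolding linear_on_def
  proof (intro conjI ballI allI)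
    fix s assume "s \<in> vcarrier (V \<otimes> W)"
    then obtain ps where ps: "set ps \<subseteq> vcarrier V \<times> vcarrier W" "s = (\<Sum>(v, w)\<leftarrow>ps. ten V W v w)"
      unfolding tensor_carrier_iff by blast
    show "tlift V W b s \<in> vcarrier U" using ps lift bin by simp
    {
      fix t assume "t \<in> vcarrier (V \<otimes> W)"
      then obtain qs where qs: "set qs \<subseteq> vcarrier V \<times> vcarrier W" "t = (\<Sum>(v, w)\<leftarrow>qs. ten V W v w)"
        unfolding tensor_carrier_iff by blast
      have "s + t = (\<Sum>(v, w)\<leftarrow>ps @ qs. ten V W v w)" using ps qs by simp
      moreover have "set (ps @ qs) \<subseteq> vcarrier V \<times> vcarrier W" using ps qs by simp
      ultimately have "tlift V W b (s + t) = (\<Sum>(v, w)\<leftarrow>ps @ qs. b v w)" by (simp only: lift)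
      then show "tlift V W b (s + t) = tlift V W b s + tlift V W b t"
        using ps qs lift by simp
    }
    fix c
    let ?qs = "map (\<lambda>(v, w). (vscale V c v, w)) ps"
    have qs: "set ?qs \<subseteq> vcarrier V \<times> vcarrier W"
      using ps(1) vec_space_closed(3)[OF V] by auto
    interpret U: vector_space "vscale U" using U by (simp add: vec_space_def)
    have "vscale U c (\<Sum>(v, w)\<leftarrow>ps. b v w) = (\<Sum>(v, w)\<leftarrow>?qs. b v w)"
      using ps(1) b
      by (induction ps) (auto simp: bilinear_on_def linear_on_def U.scale_right_distrib)
    then show "tlift V W b (vscale (V \<otimes> W) c s) = vscale U c (tlift V W b s)"
      using ps scale_tensor_sum_list[OF ps(1), of c] lift[OF qs] lift[OF ps(1)] by simp
  qed
  show "v \<in> vcarrier V \<Longrightarrow> w \<in> vcarrier W \<Longrightarrow> tlift V W b (ten V W v w) = b v w"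
    using lift[of "[(v, w)]"] by simp
qed

lemma tlift_unique:
  assumes "vec_space V" "vec_space W"
    and f: "linear_on (V \<otimes> W) U f" and g: "linear_on (V \<otimes> W) U g"
    and eq: "\<And>v w. v \<in> vcarrier V \<Longrightarrow> w \<in> vcarrier W \<Longrightarrow> f (ten V W v w) = g (ten V W v w)"
    and t: "t \<in> vcarrier (V \<otimes> W)"
  shows "f t = g t"
proof -
  note T = vec_space_tensor[OF assms(1,2)]
  obtain ps where ps: "set ps \<subseteq> vcarrier V \<times> vcarrier W" "t = (\<Sum>(v, w)\<leftarrow>ps. ten V W v w)"
    using t unfolding tensor_carrier_iff by blast
  let ?xs = "map (\<lambda>(v, w). ten V W v w) ps"
  have xs: "set ?xs \<subseteq> vcarrier (V \<otimes> W)" using ps(1) by (auto intro: ten_in)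
  have "map f ?xs = map g ?xs" using ps(1) eq by auto
  then show ?thesis
    using linear_on_sum_list[OF T f xs] linear_on_sum_list[OF T g xs] ps(2) by (simp only:)
qed

text \<open>\<open>f \<otimes> g : V \<otimes> W \<rightarrow> V' \<otimes> W'\<close>.\<close>

definition tmap ::
  "('k::field, 'v::ab_group_add) kspace \<Rightarrow> ('k, 'w::ab_group_add) kspace \<Rightarrow>
   ('k, 'v2::ab_group_add) kspace \<Rightarrow> ('k, 'w2::ab_group_add) kspace \<Rightarrow>
   ('v \<Rightarrow> 'v2) \<Rightarrow> ('w \<Rightarrow> 'w2) \<Rightarrow> ('k, 'v, 'w) tensor \<Rightarrow> ('k, 'v2, 'w2) tensor" where
  "tmap V W V' W' f g = tlift V W (\<lambda>v w. ten V' W' (f v) (g w))"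

text \<open>The canonical isomorphism \<open>(A \<otimes> B) \<otimes> C \<rightarrow> A \<otimes> (B \<otimes> C)\<close>.\<close>

definition tassoc ::
  "('k::field, 'a::ab_group_add) kspace \<Rightarrow> ('k, 'b::ab_group_add) kspace \<Rightarrow> ('k, 'c::ab_group_add) kspace \<Rightarrow>
   ('k, ('k, 'a, 'b) tensor, 'c) tensor \<Rightarrow> ('k, 'a, ('k, 'b, 'c) tensor) tensor" where
  "tassoc A B C =
     tlift (A \<otimes> B) C (\<lambda>t c. tlift A B (\<lambda>a b. ten A (B \<otimes> C) a (ten B C b c)) t)"

text \<open>\<open>Id \<otimes> c \<otimes> Id : (A \<otimes> B) \<otimes> (C \<otimes> D) \<rightarrow> (A \<otimes> C) \<otimes> (B \<otimes> D)\<close>.\<close>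

definition tswap_mid ::
  "('k::field, 'a::ab_group_add) kspace \<Rightarrow> ('k, 'b::ab_group_add) kspace \<Rightarrow>
   ('k, 'c::ab_group_add) kspace \<Rightarrow> ('k, 'd::ab_group_add) kspace \<Rightarrow>
   ('k, ('k, 'a, 'b) tensor, ('k, 'c, 'd) tensor) tensor \<Rightarrow>
   ('k, ('k, 'a, 'c) tensor, ('k, 'b, 'd) tensor) tensor" where
  "tswap_mid A B C D =
     tlift (A \<otimes> B) (C \<otimes> D) (\<lambda>s t. tlift A B (\<lambda>a b. tlift C D (\<lambda>c d.
       ten (A \<otimes> C) (B \<otimes> D) (ten A C a c) (ten B D b d)) t) s)"

text \<open>\<open>m\<^bsub>1,3,24\<^esub> : (A \<otimes> B) \<otimes> (C \<otimes> D) \<rightarrow> (A \<otimes> C) \<otimes> M\<close> for \<open>m : B \<otimes> D \<rightarrow> M\<close>.\<close>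

definition m1324 ::
  "('k::field, 'a::ab_group_add) kspace \<Rightarrow> ('k, 'b::ab_group_add) kspace \<Rightarrow>
   ('k, 'c::ab_group_add) kspace \<Rightarrow> ('k, 'd::ab_group_add) kspace \<Rightarrow> ('k, 'm::ab_group_add) kspace \<Rightarrow>
   (('k, 'b, 'd) tensor \<Rightarrow> 'm) \<Rightarrow>
   ('k, ('k, 'a, 'b) tensor, ('k, 'c, 'd) tensor) tensor \<Rightarrow>
   ('k, ('k, 'a, 'c) tensor, 'm) tensor" where
  "m1324 A B C D M m =
     tlift (A \<otimes> B) (C \<otimes> D) (\<lambda>s t. tlift A B (\<lambda>a b. tlift C D (\<lambda>c d.
       ten (A \<otimes> C) M (ten A C a c) (m (ten B D b d))) t) s)"

text \<open>\<open>e \<otimes> Id : V \<otimes> W \<rightarrow> K \<otimes> W = W\<close> and \<open>Id \<otimes> e : V \<otimes> W \<rightarrow> V \<otimes> K = V\<close> for a linear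
  form \<open>e\<close>.\<close>

definition contract_left ::
  "('k::field, 'v::ab_group_add) kspace \<Rightarrow> ('k, 'w::ab_group_add) kspace \<Rightarrow> ('v \<Rightarrow> 'k) \<Rightarrow>
   ('k, 'v, 'w) tensor \<Rightarrow> 'w" where
  "contract_left V W e = tlift V W (\<lambda>v w. vscale W (e v) w)"

definition contract_right ::
  "('k::field, 'v::ab_group_add) kspace \<Rightarrow> ('k, 'w::ab_group_add) kspace \<Rightarrow> ('w \<Rightarrow> 'k) \<Rightarrow>
   ('k, 'v, 'w) tensor \<Rightarrow> 'v" where
  "contract_right V W e = tlift V W (\<lambda>v w. vscale V (e w) v)"


section \<open>Species and twisted structures\<close>

text \<open>Finite sets are the finite subsets of a type \<open>'u\<close>. A bijection \<open>X \<rightarrow> Y\<close> is given by a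
  function \<open>s :: 'u \<Rightarrow> 'u\<close> injective on \<open>X\<close>, with \<open>Y = s ` X\<close>; only its restriction to \<open>X\<close> matters
  (\<open>act_cong\<close>). The disjoint union is the union of disjoint sets, and a pair of bijections of
  disjoint sets \<open>X\<close>, \<open>Y\<close> onto disjoint sets is a function injective on \<open>X \<union> Y\<close>.\<close>

locale species =
  fixes P :: "'u set \<Rightarrow> ('k::field, 'v::ab_group_add) kspace"
    and act :: "'u set \<Rightarrow> ('u \<Rightarrow> 'u) \<Rightarrow> 'v \<Rightarrow> 'v"
  assumes vec_space_P: "finite X \<Longrightarrow> vec_space (P X)"
    and act_linear: "finite X \<Longrightarrow> inj_on s X \<Longrightarrow> linear_on (P X) (P (s ` X)) (act X s)"
    and act_cong: "finite X \<Longrightarrow> inj_on s X \<Longrightarrow> (\<And>x. x \<in> X \<Longrightarrow> s x = s' x) \<Longrightarrow> v \<in> vcarrier (P X) \<Longrightarrow>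
          act X s v = act X s' v"
    and act_id: "finite X \<Longrightarrow> v \<in> vcarrier (P X) \<Longrightarrow> act X id v = v"
    and act_comp: "finite X \<Longrightarrow> inj_on s X \<Longrightarrow> inj_on s' (s ` X) \<Longrightarrow> v \<in> vcarrier (P X) \<Longrightarrow>
          act X (s' \<circ> s) v = act (s ` X) s' (act X s v)"

locale twisted_algebra = species P act
  for P :: "'u set \<Rightarrow> ('k::field, 'v::ab_group_add) kspace" and act +
  fixes m :: "'u set \<Rightarrow> 'u set \<Rightarrow> ('k, 'v, 'v) tensor \<Rightarrow> 'v"
    and one :: 'v
  assumes m_linear: "finite X \<Longrightarrow> finite Y \<Longrightarrow> X \<inter> Y = {} \<Longrightarrow>
          linear_on (P X \<otimes> P Y) (P (X \<union> Y)) (m X Y)"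
    and m_natural: "finite X \<Longrightarrow> finite Y \<Longrightarrow> X \<inter> Y = {} \<Longrightarrow> inj_on s (X \<union> Y) \<Longrightarrow>
          t \<in> vcarrier (P X \<otimes> P Y) \<Longrightarrow>
          m (s ` X) (s ` Y) (tmap (P X) (P Y) (P (s ` X)) (P (s ` Y)) (act X s) (act Y s) t) =
          act (X \<union> Y) s (m X Y t)"
    and m_assoc: "finite X \<Longrightarrow> finite Y \<Longrightarrow> finite Z \<Longrightarrow>
          X \<inter> Y = {} \<Longrightarrow> X \<inter> Z = {} \<Longrightarrow> Y \<inter> Z = {} \<Longrightarrow>
          w \<in> vcarrier (P X \<otimes> P Y \<otimes> P Z) \<Longrightarrow>
          m (X \<union> Y) Z (tmap (P X \<otimes> P Y) (P Z) (P (X \<union> Y)) (P Z) (m X Y) id w) =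
          m X (Y \<union> Z) (tmap (P X) (P Y \<otimes> P Z) (P X) (P (Y \<union> Z)) id (m Y Z)
            (tassoc (P X) (P Y) (P Z) w))"
    and one_closed: "one \<in> vcarrier (P {})"
    and m_one_left: "finite X \<Longrightarrow> v \<in> vcarrier (P X) \<Longrightarrow> m {} X (ten (P {}) (P X) one v) = v"
    and m_one_right: "finite X \<Longrightarrow> v \<in> vcarrier (P X) \<Longrightarrow> m X {} (ten (P X) (P {}) v one) = v"

locale twisted_coalgebra = species P act
  for P :: "'u set \<Rightarrow> ('k::field, 'v::ab_group_add) kspace" and act +
  fixes D :: "'u set \<Rightarrow> 'u set \<Rightarrow> 'v \<Rightarrow> ('k, 'v, 'v) tensor"
    and counit :: "'v \<Rightarrow> 'k"
  assumes D_linear: "finite X \<Longrightarrow> finite Y \<Longrightarrow> X \<inter> Y = {} \<Longrightarrow>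
          linear_on (P (X \<union> Y)) (P X \<otimes> P Y) (D X Y)"
    and D_natural: "finite X \<Longrightarrow> finite Y \<Longrightarrow> X \<inter> Y = {} \<Longrightarrow> inj_on s (X \<union> Y) \<Longrightarrow>
          v \<in> vcarrier (P (X \<union> Y)) \<Longrightarrow>
          D (s ` X) (s ` Y) (act (X \<union> Y) s v) =
          tmap (P X) (P Y) (P (s ` X)) (P (s ` Y)) (act X s) (act Y s) (D X Y v)"
    and D_coassoc: "finite X \<Longrightarrow> finite Y \<Longrightarrow> finite Z \<Longrightarrow>
          X \<inter> Y = {} \<Longrightarrow> X \<inter> Z = {} \<Longrightarrow> Y \<inter> Z = {} \<Longrightarrow>
          v \<in> vcarrier (P (X \<union> Y \<union> Z)) \<Longrightarrow>
          tassoc (P X) (P Y) (P Z)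
            (tmap (P (X \<union> Y)) (P Z) (P X \<otimes> P Y) (P Z) (D X Y) id (D (X \<union> Y) Z v)) =
          tmap (P X) (P (Y \<union> Z)) (P X) (P Y \<otimes> P Z) id (D Y Z) (D X (Y \<union> Z) v)"
    and counit_linear: "linear_on (P {}) scalars counit"
    and D_counit_left: "finite X \<Longrightarrow> v \<in> vcarrier (P X) \<Longrightarrow>
          contract_left (P {}) (P X) counit (D {} X v) = v"
    and D_counit_right: "finite X \<Longrightarrow> v \<in> vcarrier (P X) \<Longrightarrow>
          contract_right (P X) (P {}) counit (D X {} v) = v"

locale twisted_bialgebra =
  twisted_algebra P act m one + twisted_coalgebra P act D counit
  for P :: "'u set \<Rightarrow> ('k::field, 'v::ab_group_add) kspace" and act m one D counit +
  assumes D_m: "finite I \<Longrightarrow> finite J \<Longrightarrow> I \<inter> J = {} \<Longrightarrow> finite I' \<Longrightarrow> finite J' \<Longrightarrow> I' \<inter> J' = {} \<Longrightarrow>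
          I \<union> J = I' \<union> J' \<Longrightarrow> t \<in> vcarrier (P I' \<otimes> P J') \<Longrightarrow>
          D I J (m I' J' t) =
          tmap (P (I' \<inter> I) \<otimes> P (J' \<inter> I)) (P (I' \<inter> J) \<otimes> P (J' \<inter> J)) (P I) (P J)
            (m (I' \<inter> I) (J' \<inter> I)) (m (I' \<inter> J) (J' \<inter> J))
            (tswap_mid (P (I' \<inter> I)) (P (I' \<inter> J)) (P (J' \<inter> I)) (P (J' \<inter> J))
              (tmap (P I') (P J') (P (I' \<inter> I) \<otimes> P (I' \<inter> J)) (P (J' \<inter> I) \<otimes> P (J' \<inter> J))
                (D (I' \<inter> I) (I' \<inter> J)) (D (J' \<inter> I) (J' \<inter> J)) t))"
    and D_one: "D {} {} one = ten (P {}) (P {}) one one"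
    and counit_mult: "v \<in> vcarrier (P {}) \<Longrightarrow> w \<in> vcarrier (P {}) \<Longrightarrow>
          counit (m {} {} (ten (P {}) (P {}) v w)) = counit v * counit w"
    and counit_one: "counit one = 1"

locale double_twisted_bialgebra =
  twisted_bialgebra Q act m one D counit
  for Q :: "'u set \<Rightarrow> ('k::field, 'v::ab_group_add) kspace" and act m one D counit +
  fixes d :: "'u set \<Rightarrow> 'v \<Rightarrow> ('k, 'v, 'v) tensor"
  assumes d_linear: "finite X \<Longrightarrow> linear_on (Q X) (Q X \<otimes> Q X) (d X)"
    and d_natural: "finite X \<Longrightarrow> inj_on s X \<Longrightarrow> v \<in> vcarrier (Q X) \<Longrightarrow>
          d (s ` X) (act X s v) = tmap (Q X) (Q X) (Q (s ` X)) (Q (s ` X)) (act X s) (act X s) (d X v)"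
    and d_coassoc: "finite X \<Longrightarrow> v \<in> vcarrier (Q X) \<Longrightarrow>
          tassoc (Q X) (Q X) (Q X) (tmap (Q X) (Q X) (Q X \<otimes> Q X) (Q X) (d X) id (d X v)) =
          tmap (Q X) (Q X) (Q X) (Q X \<otimes> Q X) id (d X) (d X v)"
    and d_counit: "\<exists>e. \<forall>X. finite X \<longrightarrow>
          linear_on (Q X) scalars (e X) \<and>
          (\<forall>s. inj_on s X \<longrightarrow> (\<forall>v \<in> vcarrier (Q X). e (s ` X) (act X s v) = e X v)) \<and>
          (\<forall>v \<in> vcarrier (Q X).
             contract_left (Q X) (Q X) (e X) (d X v) = v \<and>
             contract_right (Q X) (Q X) (e X) (d X v) = v)"
    and d_m: "finite X \<Longrightarrow> finite Y \<Longrightarrow> X \<inter> Y = {} \<Longrightarrow> t \<in> vcarrier (Q X \<otimes> Q Y) \<Longrightarrow>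
          d (X \<union> Y) (m X Y t) =
          tmap (Q X \<otimes> Q Y) (Q X \<otimes> Q Y) (Q (X \<union> Y)) (Q (X \<union> Y)) (m X Y) (m X Y)
            (tswap_mid (Q X) (Q X) (Q Y) (Q Y)
              (tmap (Q X) (Q Y) (Q X \<otimes> Q X) (Q Y \<otimes> Q Y) (d X) (d Y) t))"
    and d_one: "d {} one = ten (Q {}) (Q {}) one one"
    and d_D: "finite X \<Longrightarrow> finite Y \<Longrightarrow> X \<inter> Y = {} \<Longrightarrow> v \<in> vcarrier (Q (X \<union> Y)) \<Longrightarrow>
          m1324 (Q X) (Q X) (Q Y) (Q Y) (Q (X \<union> Y)) (m X Y)
            (tmap (Q X) (Q Y) (Q X \<otimes> Q X) (Q Y \<otimes> Q Y) (d X) (d Y) (D X Y v)) =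
          tmap (Q (X \<union> Y)) (Q (X \<union> Y)) (Q X \<otimes> Q Y) (Q (X \<union> Y)) (D X Y) id (d (X \<union> Y) v)"
    and d_D_counit: "v \<in> vcarrier (Q {}) \<Longrightarrow>
          contract_left (Q {}) (Q {}) counit (d {} v) = vscale (Q {}) (counit v) one"


section \<open>Equivalences and quotients\<close>

text \<open>Quotients \<open>X/\<sim>\<close> of finite sets must again be finite subsets of the same type. This is
  achieved by a universe closed under the formation of finite sets of elements; the constructor
  \<open>Cls\<close> turns an equivalence class into an element. Every finite subset of \<open>'a\<close> is available
  through \<open>Atom\<close>. The quotient of \<open>X \<squnion> Y\<close> by \<open>\<sim>\<^sub>X \<squnion> \<sim>\<^sub>Y\<close> is literally the union of the two
  quotients (\<open>quot_Un\<close>).\<close>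

datatype 'a hf = Atom 'a | Cls (members: "'a hf fset")

definition equivs :: "'u set \<Rightarrow> ('u \<times> 'u) set set" where
  "equivs X = {r. equiv X r}"

definition quot :: "'a hf set \<Rightarrow> ('a hf \<times> 'a hf) set \<Rightarrow> 'a hf set" where
  "quot X r = (\<lambda>C. Cls (Abs_fset C)) ` (X // r)"

definition cls :: "('a hf \<times> 'a hf) set \<Rightarrow> 'a hf \<Rightarrow> 'a hf" where
  "cls r x = Cls (Abs_fset (r `` {x}))"

text \<open>The transported equivalence \<open>\<sim>\<^sub>\<sigma>\<close> and the induced bijection \<open>\<sigma>/\<sim>\<close>.\<close>

definition transport :: "('u \<Rightarrow> 'w) \<Rightarrow> ('u \<times> 'u) set \<Rightarrow> ('w \<times> 'w) set" where
  "transport s r = map_prod s s ` r"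

definition quot_map :: "('a hf \<Rightarrow> 'a hf) \<Rightarrow> 'a hf \<Rightarrow> 'a hf" where
  "quot_map s c = Cls (s |`| members c)"

text \<open>The order \<open>r \<le> r'\<close> on equivalences is \<open>r' \<subseteq> r\<close>. For \<open>r \<le> r'\<close> in \<open>equivs X\<close>, the relation
  \<open>quot_rel r' r\<close> is \<open>r\<close> viewed as an equivalence on \<open>X/r'\<close>, and \<open>flatten\<close> is the canonical
  bijection \<open>(X/r')/r \<rightarrow> X/r\<close>, mapping a class of classes to its union.\<close>

definition quot_rel :: "('a hf \<times> 'a hf) set \<Rightarrow> ('a hf \<times> 'a hf) set \<Rightarrow> ('a hf \<times> 'a hf) set" where
  "quot_rel r' r = {(cls r' x, cls r' y) |x y. (x, y) \<in> r}"

definition flatten :: "'a hf \<Rightarrow> 'a hf" where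
  "flatten c = Cls (ffUnion (members |`| members c))"

lemma quot_eq: "quot X r = cls r ` X"
  by (auto simp: quot_def cls_def quotient_def)

lemma finite_class: "finite X \<Longrightarrow> r \<in> equivs X \<Longrightarrow> finite (r `` {x})"
  by (auto simp: equivs_def equiv_def intro: finite_subset)

lemma cls_eq_iff:
  assumes "finite X" "r \<in> equivs X" "x \<in> X" "y \<in> X"
  shows "cls r x = cls r y \<longleftrightarrow> (x, y) \<in> r"
proof -
  have "cls r x = cls r y \<longleftrightarrow> r `` {x} = r `` {y}"
    using finite_class[OF assms(1,2)] by (simp add: cls_def Abs_fset_inject)
  then show ?thesis
    using assms(2-4) eq_equiv_class_iff[of X r x y] by (simp add: equivs_def)
qed

lemma quot_rel_iff:
  assumes X: "finite X" "r \<in> equivs X" "r' \<in> equivs X" "r' \<subseteq> r" and xy: "x \<in> X" "y \<in> X"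
  shows "(cls r' x, cls r' y) \<in> quot_rel r' r \<longleftrightarrow> (x, y) \<in> r"
proof
  assume "(cls r' x, cls r' y) \<in> quot_rel r' r"
  then obtain x1 y1 where 1: "(x1, y1) \<in> r" "cls r' x = cls r' x1" "cls r' y = cls r' y1"
    unfolding quot_rel_def by blast
  have "x1 \<in> X" "y1 \<in> X" using 1(1) X(2) by (auto simp: equivs_def equiv_def)
  then have "(x, x1) \<in> r" "(y, y1) \<in> r"
    using 1 xy cls_eq_iff[OF X(1,3)] X(4) by auto
  then show "(x, y) \<in> r"
    using 1(1) X(2) unfolding equivs_def equiv_def by (metis (mono_tags, lifting) mem_Collect_eq symD transD)
qed (auto simp: quot_rel_def)

lemma quot_rel_equivs:
  assumes X: "finite X" "r \<in> equivs X" "r' \<in> equivs X" "r' \<subseteq> r"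
  shows "quot_rel r' r \<in> equivs (quot X r')"
proof -
  have e: "r \<subseteq> X \<times> X" "refl_on X r" "sym r" "trans r"
    using X(2) by (auto simp: equivs_def equiv_def)
  note q = quot_rel_iff[OF X]
  have sub: "quot_rel r' r \<subseteq> quot X r' \<times> quot X r'"
    using e(1) by (auto simp: quot_rel_def quot_eq)
  moreover have "refl_on (quot X r') (quot_rel r' r)"
    using e(2) by (auto simp: refl_on_def quot_eq q)
  moreover have "sym (quot_rel r' r)"
    using e(3) by (auto simp: sym_def quot_rel_def)
  moreover have "trans (quot_rel r' r)"
  proof (rule transI)
    fix a b c assume 1: "(a, b) \<in> quot_rel r' r" "(b, c) \<in> quot_rel r' r"
    then obtain x y z where "a = cls r' x" "b = cls r' y" "c = cls r' z" "x \<in> X" "y \<in> X" "z \<in> X"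
      using sub unfolding quot_eq by blast
    then show "(a, c) \<in> quot_rel r' r" using 1 e(4) q by (auto dest: transD)
  qed
  ultimately show ?thesis by (simp add: equivs_def equiv_def)
qed

text \<open>The identification of the equivalences on \<open>X/r'\<close> with the equivalences \<open>r \<le> r'\<close> on \<open>X\<close>.\<close>

lemma quot_rel_bij:
  assumes X: "finite X" "r' \<in> equivs X"
  shows "bij_betw (quot_rel r') {r \<in> equivs X. r' \<subseteq> r} (equivs (quot X r'))"
proof (rule bij_betw_imageI)
  show "inj_on (quot_rel r') {r \<in> equivs X. r' \<subseteq> r}"
  proof (rule inj_onI)
    fix r s assume r: "r \<in> {r \<in> equivs X. r' \<subseteq> r}" and s: "s \<in> {r \<in> equivs X. r' \<subseteq> r}"
      and eq: "quot_rel r' r = quot_rel r' s"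
    have "r \<subseteq> X \<times> X" "s \<subseteq> X \<times> X" using r s by (auto simp: equivs_def equiv_def)
    moreover have "(x, y) \<in> r \<longleftrightarrow> (x, y) \<in> s" if "x \<in> X" "y \<in> X" for x y
      using quot_rel_iff[OF X(1) _ X(2), of r x y] quot_rel_iff[OF X(1) _ X(2), of s x y]
        r s eq that by simp
    ultimately show "r = s" by auto
  qed
  show "quot_rel r' ` {r \<in> equivs X. r' \<subseteq> r} = equivs (quot X r')"
  proof (intro equalityI subsetI)
    fix q assume "q \<in> quot_rel r' ` {r \<in> equivs X. r' \<subseteq> r}"
    then show "q \<in> equivs (quot X r')" using quot_rel_equivs[OF X(1) _ X(2)] by auto
  next
    fix q assume "q \<in> equivs (quot X r')"
    then have q: "q \<subseteq> quot X r' \<times> quot X r'" "refl_on (quot X r') q" "sym q" "trans q"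
      by (auto simp: equivs_def equiv_def)
    let ?r = "{(x, y) \<in> X \<times> X. (cls r' x, cls r' y) \<in> q}"
    have "r' \<subseteq> X \<times> X" using X(2) by (auto simp: equivs_def equiv_def)
    then have "r' \<subseteq> ?r"
      using q(2) cls_eq_iff[OF X] by (fastforce simp: refl_on_def quot_eq)
    moreover have "?r \<in> equivs X"
      using q(2-4) unfolding equivs_def equiv_def
      by (auto simp: refl_on_def sym_def quot_eq intro!: transI dest: transD)
    moreover have "quot_rel r' ?r = q"
      using q(1) unfolding quot_rel_def quot_eq by fastforce
    ultimately show "q \<in> quot_rel r' ` {r \<in> equivs X. r' \<subseteq> r}" by blast
  qed
qed

lemma quot_Un:
  assumes "rX \<in> equivs X" "rY \<in> equivs Y" "X \<inter> Y = {}"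
  shows "quot (X \<union> Y) (rX \<union> rY) = quot X rX \<union> quot Y rY"
proof -
  have "rX \<subseteq> X \<times> X" "rY \<subseteq> Y \<times> Y" using assms by (auto simp: equivs_def equiv_def)
  then have "(rX \<union> rY) `` {x} = rX `` {x}" if "x \<in> X" for x using assms(3) that by blast
  moreover have "(rX \<union> rY) `` {y} = rY `` {y}" if "y \<in> Y" for y
    using \<open>rX \<subseteq> X \<times> X\<close> \<open>rY \<subseteq> Y \<times> Y\<close> assms(3) that by blast
  ultimately show ?thesis by (auto simp: quot_eq cls_def image_Un)
qed

lemma flatten_cls:
  assumes X: "finite X" "r \<in> equivs X" "r' \<in> equivs X" "r' \<subseteq> r" and x: "x \<in> X"
  shows "flatten (cls (quot_rel r' r) (cls r' x)) = cls r x"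
proof -
  have e: "r \<subseteq> X \<times> X" "refl_on X r'" "r' \<subseteq> X \<times> X" "trans r" using X by (auto simp: equivs_def equiv_def)
  have mem: "fset (members (cls s y)) = s `` {y}" if "finite (s `` {y})" for s and y :: "'a hf"
    using that by (simp add: cls_def Abs_fset_inverse)
  have "finite (quot X r')" using X(1) by (simp add: quot_eq)
  from finite_class[OF this quot_rel_equivs[OF X]]
  have "fset (members (cls (quot_rel r' r) (cls r' x))) = quot_rel r' r `` {cls r' x}"
    by (rule mem)
  also have "\<dots> = cls r' ` (r `` {x})"
    using quot_rel_iff[OF X x] e(1) unfolding quot_rel_def by fastforce
  finally have 1: "fset (members (cls (quot_rel r' r) (cls r' x))) = cls r' ` (r `` {x})" .
  have "fset (ffUnion (members |`| members (cls (quot_rel r' r) (cls r' x)))) =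
      (\<Union>c \<in> cls r' ` (r `` {x}). fset (members c))"
    by (simp add: ffUnion.rep_eq 1)
  also have "\<dots> = (\<Union>y \<in> r `` {x}. r' `` {y})"
    using mem[OF finite_class[OF X(1,3)]] by simp
  also have "\<dots> = r `` {x}"
  proof (intro equalityI subsetI)
    fix z assume "z \<in> (\<Union>y \<in> r `` {x}. r' `` {y})"
    then show "z \<in> r `` {x}" using X(4) transD[OF e(4)] by blast
  next
    fix z assume z: "z \<in> r `` {x}"
    then have "(z, z) \<in> r'" using e(1,2) by (auto simp: refl_on_def)
    then show "z \<in> (\<Union>y \<in> r `` {x}. r' `` {y})" using z by blast
  qed
  also have "\<dots> = fset (Abs_fset (r `` {x}))"
    using finite_class[OF X(1,2)] by (simp add: Abs_fset_inverse)
  finally show ?thesis by (simp add: flatten_def cls_def fset_inject)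
qed

lemma flatten_bij:
  assumes X: "finite X" "r \<in> equivs X" "r' \<in> equivs X" "r' \<subseteq> r"
  shows "bij_betw flatten (quot (quot X r') (quot_rel r' r)) (quot X r)"
proof (rule bij_betw_imageI)
  have fin: "finite (quot X r')" using X(1) by (simp add: quot_eq)
  show "inj_on flatten (quot (quot X r') (quot_rel r' r))"
  proof (rule inj_onI)
    fix a b assume "a \<in> quot (quot X r') (quot_rel r' r)" "b \<in> quot (quot X r') (quot_rel r' r)"
      and eq: "flatten a = flatten b"
    then obtain x y where xy: "x \<in> X" "y \<in> X" "a = cls (quot_rel r' r) (cls r' x)"
      "b = cls (quot_rel r' r) (cls r' y)"
      unfolding quot_eq by blast
    then have "(x, y) \<in> r" using eq cls_eq_iff[OF X(1,2)] flatten_cls[OF X] by simp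
    then show "a = b"
      using xy quot_rel_iff[OF X] cls_eq_iff[OF fin quot_rel_equivs[OF X]] by (simp add: quot_eq)
  qed
  have "flatten ` quot (quot X r') (quot_rel r' r) =
      (\<lambda>x. flatten (cls (quot_rel r' r) (cls r' x))) ` X"
    by (simp add: quot_eq image_image)
  then show "flatten ` quot (quot X r') (quot_rel r' r) = quot X r"
    by (simp add: flatten_cls[OF X] quot_eq)
qed


section \<open>Contraction-extraction coproducts\<close>

text \<open>\<open>delta X r\<close> is the map \<open>P[X] \<rightarrow> P[X/r] \<otimes> P[X]\<close>. For \<open>r \<le> r'\<close> in \<open>equivs X\<close>, the following is
  the map \<open>P[X/r'] \<rightarrow> P[X/r] \<otimes> P[X/r']\<close> obtained by viewing \<open>r\<close> as an equivalence on \<open>X/r'\<close> and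
  identifying \<open>(X/r')/r\<close> with \<open>X/r\<close>.\<close>

definition delta_quot ::
  "('a hf set \<Rightarrow> ('k::field, 'v::ab_group_add) kspace) \<Rightarrow> ('a hf set \<Rightarrow> ('a hf \<Rightarrow> 'a hf) \<Rightarrow> 'v \<Rightarrow> 'v) \<Rightarrow>
   ('a hf set \<Rightarrow> ('a hf \<times> 'a hf) set \<Rightarrow> 'v \<Rightarrow> ('k, 'v, 'v) tensor) \<Rightarrow>
   'a hf set \<Rightarrow> ('a hf \<times> 'a hf) set \<Rightarrow> ('a hf \<times> 'a hf) set \<Rightarrow> 'v \<Rightarrow> ('k, 'v, 'v) tensor" where
  "delta_quot P act delta X r' r v =
     tmap (P (quot (quot X r') (quot_rel r' r))) (P (quot X r')) (P (quot X r)) (P (quot X r'))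
       (act (quot (quot X r') (quot_rel r' r)) flatten) id
       (delta (quot X r') (quot_rel r' r) v)"

text \<open>In \<open>delta_counit\<close>, \<open>P[X]\<close> is identified with \<open>P[X/=]\<close> through the canonical bijection
  \<open>x \<mapsto> {x}\<close>.\<close>

locale contraction_extraction = species P act
  for P :: "'a hf set \<Rightarrow> ('k::field, 'v::ab_group_add) kspace" and act +
  fixes delta :: "'a hf set \<Rightarrow> ('a hf \<times> 'a hf) set \<Rightarrow> 'v \<Rightarrow> ('k, 'v, 'v) tensor"
  assumes delta_linear: "finite X \<Longrightarrow> r \<in> equivs X \<Longrightarrow>
          linear_on (P X) (P (quot X r) \<otimes> P X) (delta X r)"
    and delta_natural: "finite X \<Longrightarrow> r \<in> equivs X \<Longrightarrow> inj_on s X \<Longrightarrow> v \<in> vcarrier (P X) \<Longrightarrow>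
          delta (s ` X) (transport s r) (act X s v) =
          tmap (P (quot X r)) (P X) (P (quot (s ` X) (transport s r))) (P (s ` X))
            (act (quot X r) (quot_map s)) (act X s) (delta X r v)"
    and delta_coassoc: "finite X \<Longrightarrow> r \<in> equivs X \<Longrightarrow> r' \<in> equivs X \<Longrightarrow> r' \<subseteq> r \<Longrightarrow>
          v \<in> vcarrier (P X) \<Longrightarrow>
          tassoc (P (quot X r)) (P (quot X r')) (P X)
            (tmap (P (quot X r')) (P X) (P (quot X r) \<otimes> P (quot X r')) (P X)
              (delta_quot P act delta X r' r) id (delta X r' v)) =
          tmap (P (quot X r)) (P X) (P (quot X r)) (P (quot X r') \<otimes> P X)
            id (delta X r') (delta X r v)"
    and delta_zero: "finite X \<Longrightarrow> r \<in> equivs X \<Longrightarrow> r' \<in> equivs X \<Longrightarrow> \<not> r' \<subseteq> r \<Longrightarrow>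
          v \<in> vcarrier (P X) \<Longrightarrow>
          tmap (P (quot X r)) (P X) (P (quot X r)) (P (quot X r') \<otimes> P X)
            id (delta X r') (delta X r v) = 0"
    and delta_counit: "\<exists>e. \<forall>X. finite X \<longrightarrow>
          linear_on (P X) scalars (e X) \<and>
          (\<forall>s. inj_on s X \<longrightarrow> (\<forall>v \<in> vcarrier (P X). e (s ` X) (act X s v) = e X v)) \<and>
          (\<forall>v \<in> vcarrier (P X).
             (\<forall>r \<in> equivs X. contract_right (P (quot X r)) (P X) (e X) (delta X r v) =
                (if r = Id_on X then act X (\<lambda>x. Cls {|x|}) v else 0)) \<and>
             (\<Sum>r \<in> equivs X. contract_left (P (quot X r)) (P X) (e (quot X r)) (delta X r v)) = v)"


section \<open>The composition with \<open>Com\<close>\<close>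

text \<open>Elements of \<open>P'[X] = \<Oplus>\<^bsub>r\<^esub> P[X/r]\<close> are families indexed by relations, vanishing outside of the
  finite set \<open>equivs X\<close>; \<open>com_in r\<close> is the inclusion of the summand of index \<open>r\<close>.\<close>

type_synonym ('a, 'v) com = "('a hf \<times> 'a hf) set \<Rightarrow> 'v"

definition com_in :: "('a hf \<times> 'a hf) set \<Rightarrow> 'v::ab_group_add \<Rightarrow> ('a, 'v) com" where
  "com_in r v = (\<lambda>r'. if r' = r then v else 0)"

definition com_space ::
  "('a hf set \<Rightarrow> ('k::field, 'v::ab_group_add) kspace) \<Rightarrow> 'a hf set \<Rightarrow> ('k, ('a, 'v) com) kspace" where
  "com_space P X =
     \<lparr>vcarrier = {f. (\<forall>r \<in> equivs X. f r \<in> vcarrier (P (quot X r))) \<and> (\<forall>r. r \<notin> equivs X \<longrightarrow> f r = 0)},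
      vscale = (\<lambda>c f r. vscale (P (quot X r)) c (f r))\<rparr>"

definition com_act ::
  "('a hf set \<Rightarrow> ('a hf \<Rightarrow> 'a hf) \<Rightarrow> 'v::ab_group_add \<Rightarrow> 'v) \<Rightarrow>
   'a hf set \<Rightarrow> ('a hf \<Rightarrow> 'a hf) \<Rightarrow> ('a, 'v) com \<Rightarrow> ('a, 'v) com" where
  "com_act act X s f =
     (\<Sum>r \<in> equivs X. com_in (transport s r) (act (quot X r) (quot_map s) (f r)))"

definition com_mult ::
  "('a hf set \<Rightarrow> ('k::field, 'v::ab_group_add) kspace) \<Rightarrow>
   ('a hf set \<Rightarrow> 'a hf set \<Rightarrow> ('k, 'v, 'v) tensor \<Rightarrow> 'v) \<Rightarrow>
   'a hf set \<Rightarrow> 'a hf set \<Rightarrow> ('k, ('a, 'v) com, ('a, 'v) com) tensor \<Rightarrow> ('a, 'v) com" where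
  "com_mult P m X Y =
     tlift (com_space P X) (com_space P Y) (\<lambda>f g.
       \<Sum>rX \<in> equivs X. \<Sum>rY \<in> equivs Y.
         com_in (rX \<union> rY) (m (quot X rX) (quot Y rY) (ten (P (quot X rX)) (P (quot Y rY)) (f rX) (g rY))))"

definition com_one :: "'v::ab_group_add \<Rightarrow> ('a, 'v) com" where
  "com_one one = com_in {} one"

definition com_comult ::
  "('a hf set \<Rightarrow> ('k::field, 'v::ab_group_add) kspace) \<Rightarrow>
   ('a hf set \<Rightarrow> 'a hf set \<Rightarrow> 'v \<Rightarrow> ('k, 'v, 'v) tensor) \<Rightarrow>
   'a hf set \<Rightarrow> 'a hf set \<Rightarrow> ('a, 'v) com \<Rightarrow> ('k, ('a, 'v) com, ('a, 'v) com) tensor" where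
  "com_comult P D X Y f =
     (\<Sum>r \<in> equivs (X \<union> Y).
        let rX = r \<inter> X \<times> X; rY = r \<inter> Y \<times> Y in
        if r = rX \<union> rY
        then tmap (P (quot X rX)) (P (quot Y rY)) (com_space P X) (com_space P Y)
               (com_in rX) (com_in rY) (D (quot X rX) (quot Y rY) (f r))
        else 0)"

definition com_counit :: "('v \<Rightarrow> 'k) \<Rightarrow> ('a, 'v) com \<Rightarrow> 'k" where
  "com_counit counit f = counit (f {})"

definition com_delta ::
  "('a hf set \<Rightarrow> ('k::field, 'v::ab_group_add) kspace) \<Rightarrow> ('a hf set \<Rightarrow> ('a hf \<Rightarrow> 'a hf) \<Rightarrow> 'v \<Rightarrow> 'v) \<Rightarrow>
   ('a hf set \<Rightarrow> ('a hf \<times> 'a hf) set \<Rightarrow> 'v \<Rightarrow> ('k, 'v, 'v) tensor) \<Rightarrow>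
   'a hf set \<Rightarrow> ('a, 'v) com \<Rightarrow> ('k, ('a, 'v) com, ('a, 'v) com) tensor" where
  "com_delta P act delta X f =
     (\<Sum>r' \<in> equivs X. \<Sum>r | r \<in> equivs X \<and> r' \<subseteq> r.
        tmap (P (quot X r)) (P (quot X r')) (com_space P X) (com_space P X) (com_in r) (com_in r')
          (delta_quot P act delta X r' r (f r')))"

end

(*
Every axiom for P' = P o Com is an identity between linear maps out of tensor products of the spaces
P'[X], so it is enough to check it on the summands P[X/r]. There m' and Delta' restrict to m and
Delta of the quotients, and what remains are the axioms for P, transported by naturality of the
associator and of the flips, together with the bijection between the equivalences on the disjoint
union of X and Y that split and the pairs of equivalences on X and Y.

For delta', write dq r' r : P[X/r'] -> P[X/r] (x) P[X/r'] for delta_r read on X/r' through the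
identification of (X/r')/r with X/r. Naturality of delta under this identification turns axiom (ii)
into: (dq r' r (x) Id) o dq r'' r' = (Id (x) dq r'' r') o dq r'' r if r <= r' <= r'', and the
right-hand side vanishes if r, r' <= r'' but not r <= r'. Summing over all r and r', this is
coassociativity of delta'. The counit of delta' is epsilon_delta[X/r] on P[X/r].
*)
theory Submission
  imports Defs
begin

section \<open>Tensor calculus\<close>

text \<open>The obstacle is that (X/r')/r and X/r are different sets, matched by the bijection
  \<open>flatten\<close>. Axiom (ii), applied to X/r'', therefore speaks of triple quotients, and
  two composites of flattenings lead from these to X/r; they agree because a union of unions does
  not depend on the bracketing. Since \<open>flatten\<close> is a single function on the whole
  universe, it restricts on a quotient of a disjoint union to the flattenings of the two pieces, and
  passes through products and coproducts by naturality alone. Quotients of a disjoint union, in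
  contrast, are literal unions of quotients, and they stay disjoint because classes are nonempty.
  Maps are controlled only on carriers, so the recurring pattern is to fuse two tensor maps,
  exchange their components on the carriers, and separate them again in the other order. The
  coproducts produce tensors that are not elementary, so the inclusions of the summands have to be
  moved past products, flips and associators as maps of tensors.\<close>

lemma linear_onI:
  assumes "\<And>x. x \<in> vcarrier V \<Longrightarrow> f x \<in> vcarrier W"
    and "\<And>x y. x \<in> vcarrier V \<Longrightarrow> y \<in> vcarrier V \<Longrightarrow> f (x + y) = f x + f y"
    and "\<And>c x. x \<in> vcarrier V \<Longrightarrow> f (vscale V c x) = vscale W c (f x)"
  shows "linear_on V W f"
  using assms by (simp add: linear_on_def)

lemma linear_on_in: "linear_on V W f \<Longrightarrow> x \<in> vcarrier V \<Longrightarrow> f x \<in> vcarrier W"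
  and linear_on_add: "linear_on V W f \<Longrightarrow> x \<in> vcarrier V \<Longrightarrow> y \<in> vcarrier V \<Longrightarrow> f (x + y) = f x + f y"
  and linear_on_scale: "linear_on V W f \<Longrightarrow> x \<in> vcarrier V \<Longrightarrow> f (vscale V c x) = vscale W c (f x)"
  by (auto simp: linear_on_def)

lemma linear_on_cong:
  assumes "vec_space V" "\<And>x. x \<in> vcarrier V \<Longrightarrow> f x = g x"
  shows "linear_on V W f \<longleftrightarrow> linear_on V W g"
  using assms vec_space_closed[OF assms(1)] by (simp add: linear_on_def)

lemma linear_on_id: "linear_on V V (\<lambda>x. x)"
  by (simp add: linear_on_def)

lemma linear_on_comp: "linear_on V W f \<Longrightarrow> linear_on W U g \<Longrightarrow> linear_on V U (\<lambda>x. g (f x))"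
  by (simp add: linear_on_def)

lemma vec_space_scale:
  assumes "vec_space V"
  shows "vscale V c (x + y) = vscale V c x + vscale V c y"
    and "vscale V (a + b) x = vscale V a x + vscale V b x"
    and "vscale V (a * b) x = vscale V a (vscale V b x)"
    and "vscale V c 0 = 0" and "vscale V 0 x = 0" and "vscale V 1 x = x"
proof -
  interpret vector_space "vscale V" using assms by (simp add: vec_space_def)
  show "vscale V c (x + y) = vscale V c x + vscale V c y"
    and "vscale V (a + b) x = vscale V a x + vscale V b x"
    and "vscale V (a * b) x = vscale V a (vscale V b x)"
    and "vscale V c 0 = 0" and "vscale V 0 x = 0" and "vscale V 1 x = x"
    by (simp_all add: scale_right_distrib scale_left_distrib)
qed

lemma linear_on_const0: "vec_space W \<Longrightarrow> linear_on V W (\<lambda>x. 0)"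
  by (simp add: linear_on_def vec_space_closed vec_space_scale)

lemma linear_on_plus:
  assumes W: "vec_space W" and "linear_on V W f" "linear_on V W g"
  shows "linear_on V W (\<lambda>x. f x + g x)"
  using assms(2,3) by (auto simp: linear_on_def vec_space_closed[OF W] vec_space_scale[OF W])

lemma linear_on_sum:
  assumes W: "vec_space W" and "\<And>i. i \<in> I \<Longrightarrow> linear_on V W (f i)"
  shows "linear_on V W (\<lambda>x. \<Sum>i\<in>I. f i x)"
  using assms(2) by (induction I rule: infinite_finite_induct)
    (simp_all add: linear_on_const0[OF W] linear_on_plus[OF W])

lemma vec_space_sum:
  assumes W: "vec_space W" and "\<And>i. i \<in> I \<Longrightarrow> f i \<in> vcarrier W"
  shows "(\<Sum>i\<in>I. f i) \<in> vcarrier W"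
  using assms(2) by (induction I rule: infinite_finite_induct) (simp_all add: vec_space_closed[OF W])

lemma linear_on_map_sum:
  assumes V: "vec_space V" and f: "linear_on V W f" and "\<And>i. i \<in> I \<Longrightarrow> x i \<in> vcarrier V"
  shows "f (\<Sum>i\<in>I. x i) = (\<Sum>i\<in>I. f (x i))"
  using assms(3) by (induction I rule: infinite_finite_induct)
    (simp_all add: linear_on_zero[OF V f] linear_on_add[OF f] vec_space_sum[OF V])

lemma bilinear_onI:
  assumes "\<And>w. w \<in> vcarrier W \<Longrightarrow> linear_on V U (\<lambda>v. b v w)"
    and "\<And>v. v \<in> vcarrier V \<Longrightarrow> linear_on W U (\<lambda>w. b v w)"
  shows "bilinear_on V W U b"
  using assms by (simp add: bilinear_on_def)

lemma linear_on_ten: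
  "w \<in> vcarrier W \<Longrightarrow> linear_on V (V \<otimes> W) (\<lambda>v. ten V W v w)"
  "v \<in> vcarrier V \<Longrightarrow> linear_on W (V \<otimes> W) (\<lambda>w. ten V W v w)"
  using bilinear_on_ten[of V W] by (auto simp: bilinear_on_def)

text \<open>Scalars need no case of their own: the carrier consists of sums of elementary tensors
  without coefficients, and the induction runs along such a list.\<close>

lemma tensor_induct [consumes 1, case_names zero ten add]:
  assumes t: "t \<in> vcarrier (V \<otimes> W)"
    and zero: "Q 0" and ten: "\<And>v w. v \<in> vcarrier V \<Longrightarrow> w \<in> vcarrier W \<Longrightarrow> Q (ten V W v w)"
    and add: "\<And>s t. s \<in> vcarrier (V \<otimes> W) \<Longrightarrow> t \<in> vcarrier (V \<otimes> W) \<Longrightarrow> Q s \<Longrightarrow> Q t \<Longrightarrow> Q (s + t)"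
  shows "Q t"
proof -
  obtain ps where ps: "set ps \<subseteq> vcarrier V \<times> vcarrier W" "t = (\<Sum>(v, w)\<leftarrow>ps. ten V W v w)"
    using t unfolding tensor_carrier_iff by blast
  have "(\<Sum>(v, w)\<leftarrow>ps. ten V W v w) \<in> vcarrier (V \<otimes> W) \<and> Q (\<Sum>(v, w)\<leftarrow>ps. ten V W v w)"
    using ps(1)
  proof (induction ps)
    case Nil
    have "0 \<in> vcarrier (V \<otimes> W)" unfolding tensor_carrier_iff by (rule exI[of _ "[]"]) simp
    then show ?case using zero by (simp only: list.map sum_list.Nil simp_thms)
  next
    case (Cons p ps)
    obtain v w where p: "p = (v, w)" by force
    let ?s = "\<Sum>(v, w)\<leftarrow>ps. ten V W v w"
    have vw: "v \<in> vcarrier V" "w \<in> vcarrier W" using Cons.prems p by auto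
    have IH: "?s \<in> vcarrier (V \<otimes> W)" "Q ?s" using Cons by auto
    then have "Q (ten V W v w + ?s)" using vw by (intro add ten ten_in)
    moreover have "ten V W v w + ?s \<in> vcarrier (V \<otimes> W)"
    proof -
      obtain qs where "set qs \<subseteq> vcarrier V \<times> vcarrier W" "?s = (\<Sum>(v, w)\<leftarrow>qs. ten V W v w)"
        using IH(1) unfolding tensor_carrier_iff by blast
      then show ?thesis using vw unfolding tensor_carrier_iff
        by (intro exI[of _ "(v, w) # qs"]) simp
    qed
    ultimately show ?case using p by (simp only: list.map sum_list.Cons prod.case simp_thms)
  qed
  then show ?thesis using ps(2) by simp
qed

text \<open>\<open>tlift\<close> only looks at representations with entries in the carriers, so the
  values of the form elsewhere never enter. The two lifts are therefore equal as functions, even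
  outside of the tensor product.\<close>

lemma tlift_cong:
  assumes "\<And>v w. v \<in> vcarrier V \<Longrightarrow> w \<in> vcarrier W \<Longrightarrow> b v w = b' v w"
  shows "tlift V W b = tlift V W b'"
proof -
  have *: "(\<Sum>(v, w)\<leftarrow>ps. b v w) = (\<Sum>(v, w)\<leftarrow>ps. b' v w)" if "set ps \<subseteq> vcarrier V \<times> vcarrier W" for ps
    using that assms by (induction ps) auto
  show ?thesis
  proof
    fix t
    have "(\<exists>ps. set ps \<subseteq> vcarrier V \<times> vcarrier W \<and> t = (\<Sum>(v, w)\<leftarrow>ps. ten V W v w) \<and>
          u = (\<Sum>(v, w)\<leftarrow>ps. b v w)) \<longleftrightarrow>
        (\<exists>ps. set ps \<subseteq> vcarrier V \<times> vcarrier W \<and> t = (\<Sum>(v, w)\<leftarrow>ps. ten V W v w) \<and>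
          u = (\<Sum>(v, w)\<leftarrow>ps. b' v w))" for u
      using * by auto
    then show "tlift V W b t = tlift V W b' t" unfolding tlift_def by simp
  qed
qed

text \<open>\<open>tassoc\<close>, \<open>tswap_mid\<close> and \<open>m1324\<close> are nested
  lifts, in which the arguments of one lift are parameters of the other. Bilinearity of the outer
  form is linearity in such a parameter. It is obtained by induction on \<open>t\<close>, since the
  value of a lift is explicit only on elementary tensors.\<close>

lemma tlift_linear_param:
  assumes A: "vec_space A" and B: "vec_space B" and U: "vec_space U"
    and b: "\<And>c. c \<in> vcarrier C \<Longrightarrow> bilinear_on A B U (b c)" and C: "vec_space C"
    and l: "\<And>x y. x \<in> vcarrier A \<Longrightarrow> y \<in> vcarrier B \<Longrightarrow> linear_on C U (\<lambda>c. b c x y)"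
    and t: "t \<in> vcarrier (A \<otimes> B)"
  shows "linear_on C U (\<lambda>c. tlift A B (b c) t)"
proof -
  note T = vec_space_tensor[OF A B] and lift = tlift_universal[OF A B U b]
  show ?thesis using t
  proof (induction rule: tensor_induct)
    case zero
    have "c \<in> vcarrier C \<Longrightarrow> tlift A B (b c) 0 = 0" for c by (rule linear_on_zero[OF T lift(1)])
    then show ?case by (subst linear_on_cong[OF C, where g="\<lambda>c. 0"]) (simp_all add: linear_on_const0 U)
  next
    case (ten v w)
    then show ?case
      by (subst linear_on_cong[OF C, where g="\<lambda>c. b c v w"]) (simp_all add: lift(2) l)
  next
    case (add s t)
    have "c \<in> vcarrier C \<Longrightarrow> tlift A B (b c) (s + t) = tlift A B (b c) s + tlift A B (b c) t" for c
      using linear_on_add[OF lift(1)] add.hyps by blast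
    then show ?case using linear_on_plus[OF U add.IH]
      by (subst linear_on_cong[OF C, where g="\<lambda>c. tlift A B (b c) s + tlift A B (b c) t"])
  qed
qed

section \<open>Functoriality and additivity of the tensor product of maps\<close>

lemma bilinear_on_tmap:
  "linear_on V V' f \<Longrightarrow> linear_on W W' g \<Longrightarrow> bilinear_on V W (V' \<otimes> W') (\<lambda>v w. ten V' W' (f v) (g w))"
  by (auto intro!: bilinear_onI linear_on_comp[OF _ linear_on_ten(1)] linear_on_comp[OF _ linear_on_ten(2)]
      intro: linear_on_in)

lemma tmap_linear:
  assumes "vec_space V" "vec_space W" "vec_space V'" "vec_space W'" "linear_on V V' f" "linear_on W W' g"
  shows "linear_on (V \<otimes> W) (V' \<otimes> W') (tmap V W V' W' f g)"
  unfolding tmap_def using assms by (intro tlift_universal(1) vec_space_tensor bilinear_on_tmap)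

lemma tmap_ten:
  assumes "vec_space V" "vec_space W" "vec_space V'" "vec_space W'" "linear_on V V' f" "linear_on W W' g"
    and "v \<in> vcarrier V" "w \<in> vcarrier W"
  shows "tmap V W V' W' f g (ten V W v w) = ten V' W' (f v) (g w)"
  unfolding tmap_def using assms
  by (intro tlift_universal(2)[where U = "V' \<otimes> W'"] vec_space_tensor bilinear_on_tmap)

lemma tmap_cong:
  assumes "\<And>v. v \<in> vcarrier V \<Longrightarrow> f v = f' v" "\<And>w. w \<in> vcarrier W \<Longrightarrow> g w = g' w"
  shows "tmap V W V' W' f g = tmap V W V' W' f' g'"
  unfolding tmap_def using assms by (intro tlift_cong) simp

text \<open>Used in both directions throughout: fuse two tensor maps, rewrite the composed
  components with \<open>tmap_cong\<close>, and separate them again.\<close>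

lemma tmap_tmap:
  assumes v: "vec_space V" "vec_space W" "vec_space V'" "vec_space W'" "vec_space V''" "vec_space W''"
    and f: "linear_on V V' f" "linear_on W W' g" "linear_on V' V'' f'" "linear_on W' W'' g'"
    and t: "t \<in> vcarrier (V \<otimes> W)"
  shows "tmap V' W' V'' W'' f' g' (tmap V W V' W' f g t) =
    tmap V W V'' W'' (\<lambda>v. f' (f v)) (\<lambda>w. g' (g w)) t"
proof (rule tlift_unique[OF v(1,2) _ _ _ t])
  show "linear_on (V \<otimes> W) (V'' \<otimes> W'') (\<lambda>t. tmap V' W' V'' W'' f' g' (tmap V W V' W' f g t))"
    using v f by (intro linear_on_comp[OF tmap_linear tmap_linear])
  show "linear_on (V \<otimes> W) (V'' \<otimes> W'') (tmap V W V'' W'' (\<lambda>v. f' (f v)) (\<lambda>w. g' (g w)))"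
    using v f by (intro tmap_linear) (auto intro: linear_on_comp)
next
  fix x y assume xy: "x \<in> vcarrier V" "y \<in> vcarrier W"
  then show "tmap V' W' V'' W'' f' g' (tmap V W V' W' f g (ten V W x y)) =
        tmap V W V'' W'' (\<lambda>v. f' (f v)) (\<lambda>w. g' (g w)) (ten V W x y)"
    using v f linear_on_comp[OF f(1,3)] linear_on_comp[OF f(2,4)]
    by (simp add: tmap_ten linear_on_in[OF f(1)] linear_on_in[OF f(2)])
qed

lemma tmap_id:
  assumes v: "vec_space V" "vec_space W" and t: "t \<in> vcarrier (V \<otimes> W)"
  shows "tmap V W V W (\<lambda>v. v) (\<lambda>w. w) t = t"
  by (rule tlift_unique[OF v _ linear_on_id _ t])
    (simp_all add: v tmap_linear tmap_ten linear_on_id)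

text \<open>Lets a finite sum of maps leave a tensor factor; the restriction of
  \<open>delta'\<close> to a summand is such a sum.\<close>

lemma tmap_sum_left:
  assumes v: "vec_space V" "vec_space W" "vec_space V'" "vec_space W'"
    and f: "\<And>i. i \<in> I \<Longrightarrow> linear_on V V' (f i)" and g: "linear_on W W' g" and t: "t \<in> vcarrier (V \<otimes> W)"
  shows "tmap V W V' W' (\<lambda>v. \<Sum>i\<in>I. f i v) g t = (\<Sum>i\<in>I. tmap V W V' W' (f i) g t)"
proof (rule tlift_unique[OF v(1,2) _ _ _ t])
  show "linear_on (V \<otimes> W) (V' \<otimes> W') (tmap V W V' W' (\<lambda>v. \<Sum>i\<in>I. f i v) g)"
    using v f g by (intro tmap_linear linear_on_sum)
  show "linear_on (V \<otimes> W) (V' \<otimes> W') (\<lambda>t. \<Sum>i\<in>I. tmap V W V' W' (f i) g t)"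
    using v f g by (intro tmap_linear linear_on_sum vec_space_tensor)
next
  fix x y assume xy: "x \<in> vcarrier V" "y \<in> vcarrier W"
  have "ten V' W' (\<Sum>i\<in>I. f i x) (g y) = (\<Sum>i\<in>I. ten V' W' (f i x) (g y))"
    using xy by (intro linear_on_map_sum[OF v(3) linear_on_ten(1)] linear_on_in[OF f] linear_on_in[OF g])
  then show "tmap V W V' W' (\<lambda>v. \<Sum>i\<in>I. f i v) g (ten V W x y) =
      (\<Sum>i\<in>I. tmap V W V' W' (f i) g (ten V W x y))"
    using xy v f g by (simp add: tmap_ten linear_on_sum)
qed

lemma tmap_sum_right:
  assumes v: "vec_space V" "vec_space W" "vec_space V'" "vec_space W'"
    and g: "\<And>i. i \<in> I \<Longrightarrow> linear_on W W' (g i)" and f: "linear_on V V' f" and t: "t \<in> vcarrier (V \<otimes> W)"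
  shows "tmap V W V' W' f (\<lambda>w. \<Sum>i\<in>I. g i w) t = (\<Sum>i\<in>I. tmap V W V' W' f (g i) t)"
proof (rule tlift_unique[OF v(1,2) _ _ _ t])
  show "linear_on (V \<otimes> W) (V' \<otimes> W') (tmap V W V' W' f (\<lambda>v. \<Sum>i\<in>I. g i v))"
    using v f g by (intro tmap_linear linear_on_sum)
  show "linear_on (V \<otimes> W) (V' \<otimes> W') (\<lambda>t. \<Sum>i\<in>I. tmap V W V' W' f (g i) t)"
    using v f g by (intro tmap_linear linear_on_sum vec_space_tensor)
next
  fix x y assume xy: "x \<in> vcarrier V" "y \<in> vcarrier W"
  have "ten V' W' (f x) (\<Sum>i\<in>I. g i y) = (\<Sum>i\<in>I. ten V' W' (f x) (g i y))"
    using xy by (intro linear_on_map_sum[OF v(4) linear_on_ten(2)] linear_on_in[OF f] linear_on_in[OF g])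
  then show "tmap V W V' W' f (\<lambda>v. \<Sum>i\<in>I. g i v) (ten V W x y) =
      (\<Sum>i\<in>I. tmap V W V' W' f (g i) (ten V W x y))"
    using xy v f g by (simp add: tmap_ten linear_on_sum)
qed

lemma tmap_zero:
  assumes v: "vec_space V" "vec_space W" "vec_space V'" "vec_space W'"
    and t: "t \<in> vcarrier (V \<otimes> W)"
  shows "linear_on W W' g \<Longrightarrow> tmap V W V' W' (\<lambda>_. 0) g t = 0"
    and "linear_on V V' f \<Longrightarrow> tmap V W V' W' f (\<lambda>_. 0) t = 0"
  \<comment> \<open>The zero map is a sum over the empty index set.\<close>
  using tmap_sum_left[OF v, of "{}" _ g t] tmap_sum_right[OF v, of "{}" _ f t] t by auto

text \<open>The common part of the definitions of \<open>tswap_mid\<close> and \<open>m1324\<close>.\<close>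

lemma bilinear_on_tlift_tlift:
  assumes A: "vec_space A" and B: "vec_space B" and C: "vec_space C" and D: "vec_space D" and U: "vec_space U"
    and b1: "\<And>c d. c \<in> vcarrier C \<Longrightarrow> d \<in> vcarrier D \<Longrightarrow> bilinear_on A B U (\<lambda>a b. F a b c d)"
    and b2: "\<And>a b. a \<in> vcarrier A \<Longrightarrow> b \<in> vcarrier B \<Longrightarrow> bilinear_on C D U (F a b)"
  shows "bilinear_on (A \<otimes> B) (C \<otimes> D) U (\<lambda>s t. tlift A B (\<lambda>a b. tlift C D (F a b) t) s)"
    and "a \<in> vcarrier A \<Longrightarrow> b \<in> vcarrier B \<Longrightarrow> t \<in> vcarrier (C \<otimes> D) \<Longrightarrow>
      tlift A B (\<lambda>a b. tlift C D (F a b) t) (ten A B a b) = tlift C D (F a b) t"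
proof -
  have inner: "bilinear_on A B U (\<lambda>a b. tlift C D (F a b) t)" if t: "t \<in> vcarrier (C \<otimes> D)" for t
  proof (rule bilinear_onI)
    fix b assume b: "b \<in> vcarrier B"
    show "linear_on A U (\<lambda>a. tlift C D (F a b) t)"
      by (rule tlift_linear_param[OF C D U _ A _ t]) (use b1 b2 b in \<open>auto simp: bilinear_on_def\<close>)
  next
    fix a assume a: "a \<in> vcarrier A"
    show "linear_on B U (\<lambda>b. tlift C D (F a b) t)"
      by (rule tlift_linear_param[OF C D U _ B _ t]) (use b1 b2 a in \<open>auto simp: bilinear_on_def\<close>)
  qed
  show "bilinear_on (A \<otimes> B) (C \<otimes> D) U (\<lambda>s t. tlift A B (\<lambda>a b. tlift C D (F a b) t) s)"
  proof (rule bilinear_onI)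
    fix t assume "t \<in> vcarrier (C \<otimes> D)"
    then show "linear_on (A \<otimes> B) U (tlift A B (\<lambda>a b. tlift C D (F a b) t))"
      by (intro tlift_universal A B U inner)
  next
    fix s assume s: "s \<in> vcarrier (A \<otimes> B)"
    show "linear_on (C \<otimes> D) U (\<lambda>t. tlift A B (\<lambda>a b. tlift C D (F a b) t) s)"
      by (rule tlift_linear_param[OF A B U _ vec_space_tensor[OF C D] _ s])
        (intro inner tlift_universal C D U b2, assumption+)+
  qed
  show "a \<in> vcarrier A \<Longrightarrow> b \<in> vcarrier B \<Longrightarrow> t \<in> vcarrier (C \<otimes> D) \<Longrightarrow>
      tlift A B (\<lambda>a b. tlift C D (F a b) t) (ten A B a b) = tlift C D (F a b) t"
    by (rule tlift_universal(2)[OF A B U inner])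
qed

section \<open>The associator\<close>

context
  fixes A :: "('k::field, 'a::ab_group_add) kspace" and B :: "('k, 'b::ab_group_add) kspace"
    and C :: "('k, 'c::ab_group_add) kspace"
  assumes A: "vec_space A" and B: "vec_space B" and C: "vec_space C"
begin

lemma tassoc_bilinear:
  shows "bilinear_on (A \<otimes> B) C (A \<otimes> (B \<otimes> C)) (\<lambda>t c. tlift A B (\<lambda>a b. ten A (B \<otimes> C) a (ten B C b c)) t)"
    and "a \<in> vcarrier A \<Longrightarrow> b \<in> vcarrier B \<Longrightarrow> c \<in> vcarrier C \<Longrightarrow>
       tlift A B (\<lambda>a b. ten A (B \<otimes> C) a (ten B C b c)) (ten A B a b) = ten A (B \<otimes> C) a (ten B C b c)"
proof -
  note U = vec_space_tensor[OF A vec_space_tensor[OF B C]]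
  have inner: "bilinear_on A B (A \<otimes> (B \<otimes> C)) (\<lambda>a b. ten A (B \<otimes> C) a (ten B C b c))"
    if "c \<in> vcarrier C" for c
    using that by (auto intro!: bilinear_onI linear_on_ten(1) linear_on_comp[OF linear_on_ten(1) linear_on_ten(2)] ten_in)
  show "bilinear_on (A \<otimes> B) C (A \<otimes> (B \<otimes> C)) (\<lambda>t c. tlift A B (\<lambda>a b. ten A (B \<otimes> C) a (ten B C b c)) t)"
  proof (rule bilinear_onI)
    fix c assume "c \<in> vcarrier C"
    then show "linear_on (A \<otimes> B) (A \<otimes> (B \<otimes> C)) (tlift A B (\<lambda>a b. ten A (B \<otimes> C) a (ten B C b c)))"
      by (intro tlift_universal A B U inner)
  next
    fix t assume t: "t \<in> vcarrier (A \<otimes> B)"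
    show "linear_on C (A \<otimes> (B \<otimes> C)) (\<lambda>c. tlift A B (\<lambda>a b. ten A (B \<otimes> C) a (ten B C b c)) t)"
      by (rule tlift_linear_param[OF A B U _ C _ t])
        (auto intro!: inner linear_on_comp[OF linear_on_ten(2) linear_on_ten(2)])
  qed
  show "a \<in> vcarrier A \<Longrightarrow> b \<in> vcarrier B \<Longrightarrow> c \<in> vcarrier C \<Longrightarrow>
       tlift A B (\<lambda>a b. ten A (B \<otimes> C) a (ten B C b c)) (ten A B a b) = ten A (B \<otimes> C) a (ten B C b c)"
    by (rule tlift_universal(2)[OF A B U inner])
qed

lemma tassoc_linear: "linear_on (A \<otimes> B \<otimes> C) (A \<otimes> (B \<otimes> C)) (tassoc A B C)"
  unfolding tassoc_def by (intro tlift_universal vec_space_tensor A B C tassoc_bilinear)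

lemma tassoc_ten:
  assumes "a \<in> vcarrier A" "b \<in> vcarrier B" "c \<in> vcarrier C"
  shows "tassoc A B C (ten (A \<otimes> B) C (ten A B a b) c) = ten A (B \<otimes> C) a (ten B C b c)"
proof -
  have "tassoc A B C (ten (A \<otimes> B) C (ten A B a b) c) = tlift A B (\<lambda>a b. ten A (B \<otimes> C) a (ten B C b c)) (ten A B a b)"
    unfolding tassoc_def
    by (intro tlift_universal(2)[OF _ _ _ tassoc_bilinear(1)] vec_space_tensor A B C ten_in assms)
  then show ?thesis using tassoc_bilinear(2) assms by simp
qed

end

text \<open>One factor is peeled off at a time: with the last argument fixed, both maps are linear
  in the left tensor, and uniqueness on \<open>A \<otimes> B\<close> applies.\<close>

lemma tlift_unique3:
  assumes v: "vec_space A" "vec_space B" "vec_space C" "vec_space U"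
    and f: "linear_on (A \<otimes> B \<otimes> C) U f" and g: "linear_on (A \<otimes> B \<otimes> C) U g"
    and eq: "\<And>a b c. a \<in> vcarrier A \<Longrightarrow> b \<in> vcarrier B \<Longrightarrow> c \<in> vcarrier C \<Longrightarrow>
      f (ten (A \<otimes> B) C (ten A B a b) c) = g (ten (A \<otimes> B) C (ten A B a b) c)"
    and t: "t \<in> vcarrier (A \<otimes> B \<otimes> C)"
  shows "f t = g t"
proof (rule tlift_unique[OF vec_space_tensor[OF v(1,2)] v(3) f g _ t])
  fix s c assume s: "s \<in> vcarrier (A \<otimes> B)" and c: "c \<in> vcarrier C"
  have l: "linear_on (A \<otimes> B) U (\<lambda>s. h (ten (A \<otimes> B) C s c))" if "linear_on (A \<otimes> B \<otimes> C) U h" for h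
    by (rule linear_on_comp[OF linear_on_ten(1)[OF c] that])
  show "f (ten (A \<otimes> B) C s c) = g (ten (A \<otimes> B) C s c)"
    by (rule tlift_unique[OF v(1,2) l[OF f] l[OF g] _ s]) (rule eq[OF _ _ c])
qed

text \<open>The factor \<open>C \<otimes> D\<close> first counts as a single space in
  \<open>tlift_unique3\<close>, and is then split by uniqueness once more.\<close>

lemma tlift_unique4:
  assumes v: "vec_space A" "vec_space B" "vec_space C" "vec_space D" "vec_space U"
    and f: "linear_on ((A \<otimes> B) \<otimes> (C \<otimes> D)) U f" and g: "linear_on ((A \<otimes> B) \<otimes> (C \<otimes> D)) U g"
    and eq: "\<And>a b c d. a \<in> vcarrier A \<Longrightarrow> b \<in> vcarrier B \<Longrightarrow> c \<in> vcarrier C \<Longrightarrow> d \<in> vcarrier D \<Longrightarrow>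
      f (ten (A \<otimes> B) (C \<otimes> D) (ten A B a b) (ten C D c d)) = g (ten (A \<otimes> B) (C \<otimes> D) (ten A B a b) (ten C D c d))"
    and t: "t \<in> vcarrier ((A \<otimes> B) \<otimes> (C \<otimes> D))"
  shows "f t = g t"
proof (rule tlift_unique3[OF v(1,2) vec_space_tensor[OF v(3,4)] v(5) f g _ t])
  fix a b s assume ab: "a \<in> vcarrier A" "b \<in> vcarrier B" and s: "s \<in> vcarrier (C \<otimes> D)"
  have l: "linear_on (C \<otimes> D) U (\<lambda>s. h (ten (A \<otimes> B) (C \<otimes> D) (ten A B a b) s))"
    if "linear_on ((A \<otimes> B) \<otimes> (C \<otimes> D)) U h" for h
    by (rule linear_on_comp[OF linear_on_ten(2)[OF ten_in[OF ab]] that])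
  show "f (ten (A \<otimes> B) (C \<otimes> D) (ten A B a b) s) = g (ten (A \<otimes> B) (C \<otimes> D) (ten A B a b) s)"
    by (rule tlift_unique[OF v(3,4) l[OF f] l[OF g] _ s]) (rule eq[OF ab])
qed

text \<open>Naturality of the associator. It moves the inclusions \<open>com_in\<close> and the
  flattenings past \<open>tassoc\<close>.\<close>

lemma tassoc_tmap:
  assumes v: "vec_space A" "vec_space B" "vec_space C" "vec_space A'" "vec_space B'" "vec_space C'"
    and l: "linear_on A A' f" "linear_on B B' g" "linear_on C C' h"
    and t: "t \<in> vcarrier (A \<otimes> B \<otimes> C)"
  shows "tassoc A' B' C' (tmap (A \<otimes> B) C (A' \<otimes> B') C' (tmap A B A' B' f g) h t) =
    tmap A (B \<otimes> C) A' (B' \<otimes> C') f (tmap B C B' C' g h) (tassoc A B C t)"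
proof (rule tlift_unique3[OF v(1-3) _ _ _ _ t, where U = "A' \<otimes> (B' \<otimes> C')"])
  show "vec_space (A' \<otimes> (B' \<otimes> C'))" by (intro vec_space_tensor v)
  show "linear_on (A \<otimes> B \<otimes> C) (A' \<otimes> (B' \<otimes> C'))
     (\<lambda>t. tassoc A' B' C' (tmap (A \<otimes> B) C (A' \<otimes> B') C' (tmap A B A' B' f g) h t))"
    by (intro linear_on_comp[OF tmap_linear tassoc_linear] tmap_linear vec_space_tensor v l)
  show "linear_on (A \<otimes> B \<otimes> C) (A' \<otimes> (B' \<otimes> C'))
     (\<lambda>t. tmap A (B \<otimes> C) A' (B' \<otimes> C') f (tmap B C B' C' g h) (tassoc A B C t))"
    by (intro linear_on_comp[OF tassoc_linear tmap_linear] tmap_linear vec_space_tensor v l)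
next
  fix a b c assume "a \<in> vcarrier A" "b \<in> vcarrier B" "c \<in> vcarrier C"
  then show "tassoc A' B' C' (tmap (A \<otimes> B) C (A' \<otimes> B') C' (tmap A B A' B' f g) h (ten (A \<otimes> B) C (ten A B a b) c)) =
    tmap A (B \<otimes> C) A' (B' \<otimes> C') f (tmap B C B' C' g h) (tassoc A B C (ten (A \<otimes> B) C (ten A B a b) c))"
    by (simp add: tmap_ten tassoc_ten tmap_linear vec_space_tensor v l ten_in linear_on_in[OF l(1)]
        linear_on_in[OF l(2)] linear_on_in[OF l(3)])
qed

section \<open>Maps that permute four tensor factors\<close>

context
  fixes A :: "('k::field, 'a::ab_group_add) kspace" and B :: "('k, 'b::ab_group_add) kspace"
    and C :: "('k, 'c::ab_group_add) kspace" and D :: "('k, 'd::ab_group_add) kspace"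
  assumes A: "vec_space A" and B: "vec_space B" and C: "vec_space C" and D: "vec_space D"
begin

lemma
  fixes M :: "('k, 'm::ab_group_add) kspace"
  assumes M: "vec_space M" and m: "linear_on (B \<otimes> D) M m"
  shows m1324_linear: "linear_on ((A \<otimes> B) \<otimes> (C \<otimes> D)) ((A \<otimes> C) \<otimes> M) (m1324 A B C D M m)"
    and m1324_ten: "a \<in> vcarrier A \<Longrightarrow> b \<in> vcarrier B \<Longrightarrow> c \<in> vcarrier C \<Longrightarrow> d \<in> vcarrier D \<Longrightarrow>
      m1324 A B C D M m (ten (A \<otimes> B) (C \<otimes> D) (ten A B a b) (ten C D c d)) =
      ten (A \<otimes> C) M (ten A C a c) (m (ten B D b d))"
proof -
  let ?F = "\<lambda>a b c d. ten (A \<otimes> C) M (ten A C a c) (m (ten B D b d))"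
  let ?U = "(A \<otimes> C) \<otimes> M"
  have U: "vec_space ?U" by (intro vec_space_tensor A C M)
  have b1: "bilinear_on A B ?U (\<lambda>a b. ?F a b c d)" if "c \<in> vcarrier C" "d \<in> vcarrier D" for c d
    using that by (auto intro!: bilinear_onI linear_on_comp[OF linear_on_ten(1) linear_on_ten(1)]
        linear_on_comp[OF linear_on_comp[OF linear_on_ten(1) m] linear_on_ten(2)] ten_in linear_on_in[OF m])
  have b2: "bilinear_on C D ?U (?F a b)" if "a \<in> vcarrier A" "b \<in> vcarrier B" for a b
    using that by (auto intro!: bilinear_onI linear_on_comp[OF linear_on_ten(2) linear_on_ten(1)]
        linear_on_comp[OF linear_on_comp[OF linear_on_ten(2) m] linear_on_ten(2)] ten_in linear_on_in[OF m])
  note bil = bilinear_on_tlift_tlift[where F = ?F, OF A B C D U b1 b2]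
  show "linear_on ((A \<otimes> B) \<otimes> (C \<otimes> D)) ((A \<otimes> C) \<otimes> M) (m1324 A B C D M m)"
    unfolding m1324_def by (intro tlift_universal vec_space_tensor A B C D U bil)
  assume abcd: "a \<in> vcarrier A" "b \<in> vcarrier B" "c \<in> vcarrier C" "d \<in> vcarrier D"
  have "m1324 A B C D M m (ten (A \<otimes> B) (C \<otimes> D) (ten A B a b) (ten C D c d)) =
      tlift A B (\<lambda>a b. tlift C D (?F a b) (ten C D c d)) (ten A B a b)"
    unfolding m1324_def
    by (intro tlift_universal(2)[OF _ _ U bil(1)] vec_space_tensor A B C D ten_in abcd)
  also have "\<dots> = tlift C D (?F a b) (ten C D c d)" by (intro bil(2) ten_in abcd)
  also have "\<dots> = ?F a b c d" by (intro tlift_universal(2)[OF C D U b2] abcd)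
  finally show "m1324 A B C D M m (ten (A \<otimes> B) (C \<otimes> D) (ten A B a b) (ten C D c d)) =
      ten (A \<otimes> C) M (ten A C a c) (m (ten B D b d))" .
qed

text \<open>Taking the identity as the product makes linearity and naturality of the flip special
  cases of those of \<open>m1324\<close>.\<close>

lemma tswap_mid_eq_m1324: "tswap_mid A B C D = m1324 A B C D (B \<otimes> D) (\<lambda>t. t)"
  by (simp add: tswap_mid_def m1324_def)

lemma tswap_mid_linear: "linear_on ((A \<otimes> B) \<otimes> (C \<otimes> D)) ((A \<otimes> C) \<otimes> (B \<otimes> D)) (tswap_mid A B C D)"
  unfolding tswap_mid_eq_m1324 by (intro m1324_linear vec_space_tensor B D linear_on_id)

end

text \<open>The hypothesis \<open>mn\<close> is the square by which \<open>g\<close>,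
  \<open>k\<close> and \<open>n\<close> respect the two products. For inclusions of summands it is
  \<open>com_mult_tmap\<close>; for the flattenings, which act on \<open>A\<close> and
  \<open>C\<close> only, \<open>g\<close>, \<open>k\<close> and \<open>n\<close> are
  identities.\<close>

lemma m1324_tmap:
  assumes v: "vec_space A" "vec_space B" "vec_space C" "vec_space D" "vec_space M"
    "vec_space A'" "vec_space B'" "vec_space C'" "vec_space D'" "vec_space M'"
    and l: "linear_on A A' f" "linear_on B B' g" "linear_on C C' h" "linear_on D D' k"
    and m: "linear_on (B \<otimes> D) M m" "linear_on (B' \<otimes> D') M' m'" "linear_on M M' n"
    and mn: "\<And>s. s \<in> vcarrier (B \<otimes> D) \<Longrightarrow> m' (tmap B D B' D' g k s) = n (m s)"
    and t: "t \<in> vcarrier ((A \<otimes> B) \<otimes> (C \<otimes> D))"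
  shows "m1324 A' B' C' D' M' m' (tmap (A \<otimes> B) (C \<otimes> D) (A' \<otimes> B') (C' \<otimes> D') (tmap A B A' B' f g) (tmap C D C' D' h k) t) =
    tmap (A \<otimes> C) M (A' \<otimes> C') M' (tmap A C A' C' f h) n (m1324 A B C D M m t)"
proof (rule tlift_unique4[OF v(1-4) _ _ _ _ t, where U = "(A' \<otimes> C') \<otimes> M'"
      and f = "\<lambda>t. m1324 A' B' C' D' M' m' (tmap (A \<otimes> B) (C \<otimes> D) (A' \<otimes> B') (C' \<otimes> D') (tmap A B A' B' f g) (tmap C D C' D' h k) t)"
      and g = "\<lambda>t. tmap (A \<otimes> C) M (A' \<otimes> C') M' (tmap A C A' C' f h) n (m1324 A B C D M m t)"])
  show "vec_space ((A' \<otimes> C') \<otimes> M')" by (intro vec_space_tensor v)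
  show "linear_on ((A \<otimes> B) \<otimes> (C \<otimes> D)) ((A' \<otimes> C') \<otimes> M') (\<lambda>t. m1324 A' B' C' D' M' m' (tmap (A \<otimes> B) (C \<otimes> D) (A' \<otimes> B') (C' \<otimes> D') (tmap A B A' B' f g) (tmap C D C' D' h k) t))"
    by (intro linear_on_comp[OF tmap_linear m1324_linear] tmap_linear vec_space_tensor v l m)
  show "linear_on ((A \<otimes> B) \<otimes> (C \<otimes> D)) ((A' \<otimes> C') \<otimes> M') (\<lambda>t. tmap (A \<otimes> C) M (A' \<otimes> C') M' (tmap A C A' C' f h) n (m1324 A B C D M m t))"
    by (intro linear_on_comp[OF m1324_linear tmap_linear] tmap_linear vec_space_tensor v l m)
next
  fix a b c d assume x: "a \<in> vcarrier A" "b \<in> vcarrier B" "c \<in> vcarrier C" "d \<in> vcarrier D"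
  note i = linear_on_in[OF l(1)] linear_on_in[OF l(2)] linear_on_in[OF l(3)] linear_on_in[OF l(4)]
  have "m' (ten B' D' (g b) (k d)) = n (m (ten B D b d))"
    using mn[OF ten_in] x by (simp add: tmap_ten v l)
  with x show "m1324 A' B' C' D' M' m' (tmap (A \<otimes> B) (C \<otimes> D) (A' \<otimes> B') (C' \<otimes> D') (tmap A B A' B' f g) (tmap C D C' D' h k)
      (ten (A \<otimes> B) (C \<otimes> D) (ten A B a b) (ten C D c d))) =
    tmap (A \<otimes> C) M (A' \<otimes> C') M' (tmap A C A' C' f h) n (m1324 A B C D M m (ten (A \<otimes> B) (C \<otimes> D) (ten A B a b) (ten C D c d)))"
    by (simp add: tmap_ten m1324_ten tmap_linear vec_space_tensor v l m ten_in i linear_on_in[OF m(1)])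
qed

lemma tswap_mid_tmap:
  assumes v: "vec_space A" "vec_space B" "vec_space C" "vec_space D"
    "vec_space A'" "vec_space B'" "vec_space C'" "vec_space D'"
    and l: "linear_on A A' f" "linear_on B B' g" "linear_on C C' h" "linear_on D D' k"
    and t: "t \<in> vcarrier ((A \<otimes> B) \<otimes> (C \<otimes> D))"
  shows "tswap_mid A' B' C' D' (tmap (A \<otimes> B) (C \<otimes> D) (A' \<otimes> B') (C' \<otimes> D') (tmap A B A' B' f g) (tmap C D C' D' h k) t) =
    tmap (A \<otimes> C) (B \<otimes> D) (A' \<otimes> C') (B' \<otimes> D') (tmap A C A' C' f h) (tmap B D B' D' g k) (tswap_mid A B C D t)"
  unfolding tswap_mid_eq_m1324[OF v(1-4)] tswap_mid_eq_m1324[OF v(5-8)]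
  by (intro m1324_tmap linear_on_id vec_space_tensor tmap_linear v l t refl)

section \<open>Contraction of a tensor factor by a linear form\<close>

context
  fixes V :: "('k::field, 'v::ab_group_add) kspace" and W :: "('k, 'w::ab_group_add) kspace"
  assumes V: "vec_space V" and W: "vec_space W"
begin

lemma contract_left_bilinear: "linear_on V scalars e \<Longrightarrow> bilinear_on V W W (\<lambda>v w. vscale W (e v) w)"
  using vec_space_scale[OF W] vec_space_closed[OF W]
  by (auto intro!: bilinear_onI linear_onI simp: linear_on_def scalars_def mult.commute)
    \<comment> \<open>Two scalars acting on the same vector, the value of the form and the factor
      pulled out, have to be exchanged; this is commutativity of the field.\<close>
    (metis mult.commute vec_space_scale(3)[OF W])

lemma contract_right_bilinear: "linear_on W scalars e \<Longrightarrow> bilinear_on V W V (\<lambda>v w. vscale V (e w) v)"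
  using vec_space_scale[OF V] vec_space_closed[OF V]
  by (auto intro!: bilinear_onI linear_onI simp: linear_on_def scalars_def mult.commute)
    (metis mult.commute vec_space_scale(3)[OF V])

lemma contract_left_linear: "linear_on V scalars e \<Longrightarrow> linear_on (V \<otimes> W) W (contract_left V W e)"
  unfolding contract_left_def by (intro tlift_universal V W contract_left_bilinear)

lemma contract_right_linear: "linear_on W scalars e \<Longrightarrow> linear_on (V \<otimes> W) V (contract_right V W e)"
  unfolding contract_right_def by (intro tlift_universal V W contract_right_bilinear)

lemma contract_left_ten: "linear_on V scalars e \<Longrightarrow> v \<in> vcarrier V \<Longrightarrow> w \<in> vcarrier W \<Longrightarrow>
    contract_left V W e (ten V W v w) = vscale W (e v) w"
  unfolding contract_left_def by (rule tlift_universal(2)[OF V W W contract_left_bilinear])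

lemma contract_right_ten: "linear_on W scalars e \<Longrightarrow> v \<in> vcarrier V \<Longrightarrow> w \<in> vcarrier W \<Longrightarrow>
    contract_right V W e (ten V W v w) = vscale V (e w) v"
  unfolding contract_right_def by (rule tlift_universal(2)[OF V W V contract_right_bilinear])

end

text \<open>A form applied after a pair of maps becomes its pullback along one of them. This brings
  the counit laws of \<open>P'\<close> down to the summands, and those of an iterated quotient down
  to \<open>delta\<close>.\<close>

lemma contract_left_tmap:
  assumes v: "vec_space V" "vec_space W" "vec_space V'" "vec_space W'"
    and l: "linear_on V V' f" "linear_on W W' g"
    and e: "linear_on V' scalars e" and t: "t \<in> vcarrier (V \<otimes> W)"
  shows "contract_left V' W' e (tmap V W V' W' f g t) = g (contract_left V W (\<lambda>v. e (f v)) t)"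
proof (rule tlift_unique[OF v(1,2) _ _ _ t])
  note ef = linear_on_comp[OF l(1) e]
  show "linear_on (V \<otimes> W) W' (\<lambda>t. contract_left V' W' e (tmap V W V' W' f g t))"
    by (intro linear_on_comp[OF tmap_linear contract_left_linear] v l e)
  show "linear_on (V \<otimes> W) W' (\<lambda>t. g (contract_left V W (\<lambda>v. e (f v)) t))"
    by (intro linear_on_comp[OF contract_left_linear l(2)] v ef)
  fix x y assume "x \<in> vcarrier V" "y \<in> vcarrier W"
  then show "contract_left V' W' e (tmap V W V' W' f g (ten V W x y)) = g (contract_left V W (\<lambda>v. e (f v)) (ten V W x y))"
    by (simp add: tmap_ten contract_left_ten v l e ef linear_on_in[OF l(1)] linear_on_in[OF l(2)]
        linear_on_scale[OF l(2)])
qed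

lemma contract_right_tmap:
  assumes v: "vec_space V" "vec_space W" "vec_space V'" "vec_space W'"
    and l: "linear_on V V' f" "linear_on W W' g"
    and e: "linear_on W' scalars e" and t: "t \<in> vcarrier (V \<otimes> W)"
  shows "contract_right V' W' e (tmap V W V' W' f g t) = f (contract_right V W (\<lambda>w. e (g w)) t)"
proof (rule tlift_unique[OF v(1,2) _ _ _ t])
  note eg = linear_on_comp[OF l(2) e]
  show "linear_on (V \<otimes> W) V' (\<lambda>t. contract_right V' W' e (tmap V W V' W' f g t))"
    by (intro linear_on_comp[OF tmap_linear contract_right_linear] v l e)
  show "linear_on (V \<otimes> W) V' (\<lambda>t. f (contract_right V W (\<lambda>w. e (g w)) t))"
    by (intro linear_on_comp[OF contract_right_linear l(1)] v eg)
  fix x y assume "x \<in> vcarrier V" "y \<in> vcarrier W"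
  then show "contract_right V' W' e (tmap V W V' W' f g (ten V W x y)) = f (contract_right V W (\<lambda>w. e (g w)) (ten V W x y))"
    by (simp add: tmap_ten contract_right_ten v l e eg linear_on_in[OF l(1)] linear_on_in[OF l(2)]
        linear_on_scale[OF l(1)])
qed

lemma contract_cong:
  "(\<And>v. v \<in> vcarrier V \<Longrightarrow> e v = e' v) \<Longrightarrow> contract_left V W e = contract_left V W e'"
  "(\<And>w. w \<in> vcarrier W \<Longrightarrow> e w = e' w) \<Longrightarrow> contract_right V W e = contract_right V W e'"
  unfolding contract_left_def contract_right_def by (auto intro!: tlift_cong)

section \<open>Equivalences and quotients\<close>

lemma equivsD:
  assumes "r \<in> equivs X"
  shows "r \<subseteq> X \<times> X" and "x \<in> X \<Longrightarrow> (x, x) \<in> r" and "(x, y) \<in> r \<Longrightarrow> (y, x) \<in> r"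
    and "(x, y) \<in> r \<Longrightarrow> (y, z) \<in> r \<Longrightarrow> (x, z) \<in> r"
  using assms by (auto simp: equivs_def equiv_def refl_on_def sym_def dest: transD)

lemma equivsI:
  assumes "r \<subseteq> X \<times> X" and "\<And>x. x \<in> X \<Longrightarrow> (x, x) \<in> r" and "\<And>x y. (x, y) \<in> r \<Longrightarrow> (y, x) \<in> r"
    and "\<And>x y z. (x, y) \<in> r \<Longrightarrow> (y, z) \<in> r \<Longrightarrow> (x, z) \<in> r"
  shows "r \<in> equivs X"
  using assms unfolding equivs_def equiv_def by (blast intro: refl_onI symI transI)

lemma finite_equivs: "finite X \<Longrightarrow> finite (equivs X)"
  by (rule finite_subset[of _ "Pow (X \<times> X)"]) (auto dest: equivsD(1))

lemma equivs_empty: "equivs {} = {{}}"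
  by (auto intro: equivsI dest: equivsD(1))

lemma finite_quot: "finite X \<Longrightarrow> finite (quot X r)"
  by (simp add: quot_eq)

lemma quot_empty: "quot {} r = {}"
  by (simp add: quot_eq)

section \<open>Equivalences on a disjoint union\<close>

lemma equivs_Un: "r \<in> equivs X \<Longrightarrow> s \<in> equivs Y \<Longrightarrow> X \<inter> Y = {} \<Longrightarrow> r \<union> s \<in> equivs (X \<union> Y)"
proof (rule equivsI)
  assume r: "r \<in> equivs X" and s: "s \<in> equivs Y" and disj: "X \<inter> Y = {}"
  note sub = equivsD(1)[OF r] equivsD(1)[OF s]
  show "r \<union> s \<subseteq> (X \<union> Y) \<times> (X \<union> Y)" using sub by auto
  show "\<And>x. x \<in> X \<union> Y \<Longrightarrow> (x, x) \<in> r \<union> s" using equivsD(2)[OF r] equivsD(2)[OF s] by auto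
  show "\<And>x y. (x, y) \<in> r \<union> s \<Longrightarrow> (y, x) \<in> r \<union> s" using equivsD(3)[OF r] equivsD(3)[OF s] by auto
  fix x y z assume xyz: "(x, y) \<in> r \<union> s" "(y, z) \<in> r \<union> s"
  have "(x, y) \<in> r \<Longrightarrow> y \<in> X" "(y, z) \<in> r \<Longrightarrow> y \<in> X" "(x, y) \<in> s \<Longrightarrow> y \<in> Y" "(y, z) \<in> s \<Longrightarrow> y \<in> Y"
    using sub by auto
  then have "(x, y) \<in> r \<and> (y, z) \<in> r \<or> (x, y) \<in> s \<and> (y, z) \<in> s" using xyz disj by blast
  then show "(x, z) \<in> r \<union> s" using equivsD(4)[OF r] equivsD(4)[OF s] by blast
qed

lemma equivs_restrict: "r \<in> equivs X \<Longrightarrow> Y \<subseteq> X \<Longrightarrow> r \<inter> Y \<times> Y \<in> equivs Y"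

proof (rule equivsI)
  assume r: "r \<in> equivs X" and Y: "Y \<subseteq> X"
  show "r \<inter> Y \<times> Y \<subseteq> Y \<times> Y" by auto
  show "\<And>x. x \<in> Y \<Longrightarrow> (x, x) \<in> r \<inter> Y \<times> Y" using equivsD(2)[OF r] Y by auto
  show "\<And>x y. (x, y) \<in> r \<inter> Y \<times> Y \<Longrightarrow> (y, x) \<in> r \<inter> Y \<times> Y" using equivsD(3)[OF r] by auto
  show "\<And>x y z. (x, y) \<in> r \<inter> Y \<times> Y \<Longrightarrow> (y, z) \<in> r \<inter> Y \<times> Y \<Longrightarrow> (x, z) \<in> r \<inter> Y \<times> Y"
    using equivsD(4)[OF r] by blast
qed

lemma equivs_restrict_Un:
  assumes "r \<in> equivs X" "s \<in> equivs Y" "X \<inter> Y = {}"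
  shows "(r \<union> s) \<inter> X \<times> X = r" "(r \<union> s) \<inter> Y \<times> Y = s"
  using assms equivsD(1)[of r X] equivsD(1)[of s Y] by blast+

text \<open>For an equivalence on the disjoint union of \<open>X\<close> and \<open>Y\<close> this
  says that it has the form r_X \<squnion> r_Y: no class meets both sets. On the summands of all
  other relations the coproduct of \<open>P'\<close> vanishes.\<close>

definition splits :: "('u \<times> 'u) set \<Rightarrow> 'u set \<Rightarrow> 'u set \<Rightarrow> bool" where
  "splits r X Y \<longleftrightarrow> r = r \<inter> X \<times> X \<union> r \<inter> Y \<times> Y"

lemma splits_iff: "splits r X Y \<longleftrightarrow> (\<forall>(x, y) \<in> r. x \<in> X \<and> y \<in> X \<or> x \<in> Y \<and> y \<in> Y)"
  unfolding splits_def by auto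

lemma splits_Un: "r \<in> equivs X \<Longrightarrow> s \<in> equivs Y \<Longrightarrow> splits (r \<union> s) X Y"
  using equivsD(1)[of r X] equivsD(1)[of s Y] unfolding splits_iff by auto

text \<open>A pair joining \<open>X\<close> to \<open>Y\<close> persists in every larger relation.
  Hence a relation coarser than a non-split one is not split either, which settles the degenerate
  case of \<open>com_delta_D\<close>.\<close>

lemma splits_mono: "splits r X Y \<Longrightarrow> r' \<subseteq> r \<Longrightarrow> splits r' X Y"
  unfolding splits_iff by blast

lemma cls_Un:
  assumes "r \<in> equivs X" "s \<in> equivs Y" "X \<inter> Y = {}"
  shows "x \<in> X \<Longrightarrow> cls (r \<union> s) x = cls r x" "y \<in> Y \<Longrightarrow> cls (r \<union> s) y = cls s y"
proof -
  have "x \<in> X \<Longrightarrow> (r \<union> s) `` {x} = r `` {x}" "y \<in> Y \<Longrightarrow> (r \<union> s) `` {y} = s `` {y}"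
    using assms equivsD(1)[of r X] equivsD(1)[of s Y] by blast+
  then show "x \<in> X \<Longrightarrow> cls (r \<union> s) x = cls r x" "y \<in> Y \<Longrightarrow> cls (r \<union> s) y = cls s y"
    by (simp_all add: cls_def)
qed

lemma fset_members_cls: "finite X \<Longrightarrow> r \<in> equivs X \<Longrightarrow> fset (members (cls r x)) = r `` {x}"
  using finite_class[of X r x] by (simp add: cls_def Abs_fset_inverse)

text \<open>An element of a quotient determines its class, and a class contains its representative;
  a common element would put a point of \<open>X\<close> into a class inside \<open>Y\<close>. This
  makes the products and coproducts of the quotients available.\<close>

lemma quot_disjoint:
  assumes "finite X" "finite Y" "r \<in> equivs X" "s \<in> equivs Y" "X \<inter> Y = {}"
  shows "quot X r \<inter> quot Y s = {}"
proof -
  have "cls r x \<noteq> cls s y" if "x \<in> X" "y \<in> Y" for x y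
  proof
    assume "cls r x = cls s y"
    then have "r `` {x} = s `` {y}" using fset_members_cls assms by metis
    then have "x \<in> s `` {y}" using equivsD(2)[OF assms(3) that(1)] by blast
    then show False using that assms(5) equivsD(1)[OF assms(4)] by blast
  qed
  then show ?thesis by (auto simp: quot_eq)
qed

lemma quot_restrict_splits:
  assumes "r \<in> equivs (X \<union> Y)" "splits r X Y" "X \<inter> Y = {}"
  shows "quot (X \<union> Y) r = quot X (r \<inter> X \<times> X) \<union> quot Y (r \<inter> Y \<times> Y)"
  using quot_Un[OF equivs_restrict[OF assms(1)] equivs_restrict[OF assms(1)] assms(3)] assms(2)
  by (simp add: splits_def)

section \<open>Transport of equivalences along a bijection\<close>

lemma transport_equivs: "inj_on s X \<Longrightarrow> r \<in> equivs X \<Longrightarrow> transport s r \<in> equivs (s ` X)"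
proof (rule equivsI)
  assume s: "inj_on s X" and r: "r \<in> equivs X"
  show "transport s r \<subseteq> s ` X \<times> s ` X" using equivsD(1)[OF r] by (auto simp: transport_def)
  show "\<And>x. x \<in> s ` X \<Longrightarrow> (x, x) \<in> transport s r" using equivsD(2)[OF r] by (force simp: transport_def)
  show "\<And>x y. (x, y) \<in> transport s r \<Longrightarrow> (y, x) \<in> transport s r"
    using equivsD(3)[OF r] by (force simp: transport_def)
  fix x y z assume "(x, y) \<in> transport s r" "(y, z) \<in> transport s r"
  then obtain a b c d where 1: "(a, b) \<in> r" "x = s a" "y = s b" "(c, d) \<in> r" "y = s c" "z = s d"
    by (auto simp: transport_def)
  then have "b = c" using equivsD(1)[OF r] inj_onD[OF s] by auto
  then have "(a, d) \<in> r" using 1 equivsD(4)[OF r] by blast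
  then show "(x, z) \<in> transport s r" using 1 by (force simp: transport_def)
qed

lemma transport_iff:
  assumes "inj_on s X" "r \<subseteq> X \<times> X" "x \<in> X" "y \<in> X"
  shows "(s x, s y) \<in> transport s r \<longleftrightarrow> (x, y) \<in> r"
proof
  assume "(s x, s y) \<in> transport s r"
  then obtain a b where "(a, b) \<in> r" "s x = s a" "s y = s b" by (auto simp: transport_def)
  then show "(x, y) \<in> r" using assms by (auto dest: inj_onD)
qed (auto simp: transport_def)

lemma transport_comp: "transport (s' \<circ> s) r = transport s' (transport s r)"
  by (force simp: transport_def)

lemma transport_id: "transport id r = r" "transport (\<lambda>x. x) r = r"
  by (force simp: transport_def)+

lemma transport_cong:
  assumes "r \<subseteq> X \<times> X" "\<And>x. x \<in> X \<Longrightarrow> s x = s' x"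
  shows "transport s r = transport s' r"
  using assms unfolding transport_def by (intro image_cong) auto

lemma transport_mono: "r' \<subseteq> r \<Longrightarrow> transport s r' \<subseteq> transport s r"
  by (auto simp: transport_def)

lemma transport_subset_iff:
  assumes s: "inj_on s X" and r: "r \<in> equivs X" "r' \<in> equivs X"
  shows "transport s r' \<subseteq> transport s r \<longleftrightarrow> r' \<subseteq> r"
proof
  assume sub: "transport s r' \<subseteq> transport s r"
  show "r' \<subseteq> r"
  proof
    fix p assume p: "p \<in> r'"
    obtain x y where [simp]: "p = (x, y)" by force
    have xy: "x \<in> X" "y \<in> X" using p equivsD(1)[OF r(2)] by auto
    show "p \<in> r"
      using transport_iff[OF s equivsD(1)[OF r(1)] xy] transport_iff[OF s equivsD(1)[OF r(2)] xy] sub p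
      by auto
  qed
qed (rule transport_mono)

lemma transport_bij:
  assumes s: "inj_on s X"
  shows "bij_betw (transport s) (equivs X) (equivs (s ` X))"
proof (rule bij_betw_imageI)
  show "inj_on (transport s) (equivs X)"
    by (rule inj_onI) (use transport_subset_iff[OF s] in \<open>metis order.refl subset_antisym\<close>)
  show "transport s ` equivs X = equivs (s ` X)"
  proof (intro equalityI subsetI)
    fix q assume "q \<in> transport s ` equivs X"
    then show "q \<in> equivs (s ` X)" using transport_equivs[OF s] by auto
  next
    fix q assume q: "q \<in> equivs (s ` X)"
    let ?i = "inv_into X s"
    have i: "inj_on ?i (s ` X)" by (rule inj_on_inv_into) simp
    have "transport ?i q \<in> equivs (?i ` s ` X)" by (rule transport_equivs[OF i q])
    moreover have "?i ` s ` X = X" using s by simp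
    moreover have "transport s (transport ?i q) = q"
    proof -
      have "transport s (transport ?i q) = transport (s \<circ> ?i) q" by (simp add: transport_comp)
      also have "\<dots> = transport id q"
        by (rule transport_cong[OF equivsD(1)[OF q]]) (simp add: f_inv_into_f)
      finally show ?thesis by (simp add: transport_id)
    qed
    ultimately show "q \<in> transport s ` equivs X" by (metis imageI)
  qed
qed

lemma transport_Un: "transport s (r \<union> r') = transport s r \<union> transport s r'"
  by (auto simp: transport_def)

lemma transport_restrict:
  assumes "inj_on s X" "r \<subseteq> X \<times> X" "Y \<subseteq> X"
  shows "transport s (r \<inter> Y \<times> Y) = transport s r \<inter> (s ` Y) \<times> (s ` Y)"
proof
  show "transport s r \<inter> (s ` Y) \<times> (s ` Y) \<subseteq> transport s (r \<inter> Y \<times> Y)"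
  proof
    fix p assume p: "p \<in> transport s r \<inter> (s ` Y) \<times> (s ` Y)"
    then obtain x y where 1: "(x, y) \<in> r" "p = (s x, s y)" by (auto simp: transport_def)
    then have "x \<in> Y" "y \<in> Y" using p assms by (auto dest!: inj_onD[OF assms(1)])
    then show "p \<in> transport s (r \<inter> Y \<times> Y)" using 1 by (force simp: transport_def)
  qed
qed (auto simp: transport_def)

text \<open>Splitting is an equality between two equivalences on \<open>X \<union> Y\<close>, and
  transport is injective on these.\<close>

lemma transport_splits:
  assumes "inj_on s (X \<union> Y)" "r \<in> equivs (X \<union> Y)" "X \<inter> Y = {}"
  shows "splits (transport s r) (s ` X) (s ` Y) \<longleftrightarrow> splits r X Y"
proof -
  have "splits (transport s r) (s ` X) (s ` Y) \<longleftrightarrow> transport s r = transport s (r \<inter> X \<times> X \<union> r \<inter> Y \<times> Y)"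
    using transport_restrict[OF assms(1) equivsD(1)[OF assms(2)], of X] transport_restrict[OF assms(1) equivsD(1)[OF assms(2)], of Y]
    by (simp add: splits_def transport_Un)
  also have "\<dots> \<longleftrightarrow> r = r \<inter> X \<times> X \<union> r \<inter> Y \<times> Y"
  proof
    assume "transport s r = transport s (r \<inter> X \<times> X \<union> r \<inter> Y \<times> Y)"
    moreover have "r \<inter> X \<times> X \<union> r \<inter> Y \<times> Y \<in> equivs (X \<union> Y)"
      by (rule equivs_Un[OF equivs_restrict[OF assms(2)] equivs_restrict[OF assms(2)] assms(3)]) auto
    ultimately show "r = r \<inter> X \<times> X \<union> r \<inter> Y \<times> Y"
      using transport_bij[OF assms(1)] assms(2) by (auto simp: bij_betw_def dest: inj_onD)
  qed simp
  finally show ?thesis by (simp add: splits_def)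
qed

text \<open>By injectivity, the class of \<open>s x\<close> under the transported relation gains no
  member beyond the images of the class of \<open>x\<close>.\<close>

lemma quot_map_cls:
  assumes s: "inj_on s X" and fin: "finite X" and r: "r \<in> equivs X" and x: "x \<in> X"
  shows "quot_map s (cls r x) = cls (transport s r) (s x)"
proof -
  have "fset (s |`| members (cls r x)) = s ` (r `` {x})"
    using fset_members_cls[OF fin r] by simp
  also have "\<dots> = transport s r `` {s x}"
    using equivsD(1)[OF r] x inj_onD[OF s] by (fastforce simp: transport_def)
  finally have "s |`| members (cls r x) = Abs_fset (transport s r `` {s x})"
    by (metis fset_inverse)
  then show ?thesis by (simp add: quot_map_def cls_def)
qed

lemma quot_transport:
  assumes "inj_on s X" "finite X" "r \<in> equivs X"
  shows "quot (s ` X) (transport s r) = quot_map s ` quot X r"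
  using quot_map_cls[OF assms] by (force simp: quot_eq image_image)

lemma inj_on_quot_map:
  assumes "inj_on s X" "finite X" "r \<in> equivs X"
  shows "inj_on (quot_map s) (quot X r)"
proof (rule inj_onI)
  fix c d assume "c \<in> quot X r" "d \<in> quot X r" and eq: "quot_map s c = quot_map s d"
  then obtain x y where xy: "x \<in> X" "y \<in> X" "c = cls r x" "d = cls r y" by (auto simp: quot_eq)
  then have "cls (transport s r) (s x) = cls (transport s r) (s y)" using eq quot_map_cls[OF assms] by simp
  then have "(s x, s y) \<in> transport s r"
    using cls_eq_iff[OF _ transport_equivs[OF assms(1,3)]] xy assms(2) by simp
  then have "(x, y) \<in> r" using transport_iff[OF assms(1) equivsD(1)[OF assms(3)]] xy by simp
  then show "c = d" using xy cls_eq_iff[OF assms(2,3)] by simp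
qed

lemma quot_map_comp: "quot_map (s' \<circ> s) = quot_map s' \<circ> quot_map s"
  by (auto simp: quot_map_def fun_eq_iff fset.map_comp)

lemma quot_map_id: "c \<in> quot X r \<Longrightarrow> quot_map id c = c"
  by (auto simp: quot_map_def quot_eq cls_def)

text \<open>\<open>quot_map\<close> evaluates its function only at the members of \<open>c\<close>,
  and these lie in \<open>X\<close>.\<close>

lemma quot_map_cong:
  assumes "finite X" "r \<in> equivs X" "\<And>x. x \<in> X \<Longrightarrow> s x = s' x" "c \<in> quot X r"
  shows "quot_map s c = quot_map s' c"
proof -
  obtain x where x: "x \<in> X" "c = cls r x" using assms(4) by (auto simp: quot_eq)
  have "fset (members c) \<subseteq> X" using fset_members_cls[OF assms(1,2)] x equivsD(1)[OF assms(2)] by auto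
  then have "s |`| members c = s' |`| members c"
    using assms(3) by (intro fset.map_cong0) auto
  then show ?thesis by (simp add: quot_map_def)
qed

section \<open>Iterated quotients and their flattening\<close>

lemma quot_rel_transport:
  assumes "inj_on s X" "finite X" "r \<in> equivs X" "r' \<in> equivs X"
  shows "quot_rel (transport s r') (transport s r) = transport (quot_map s) (quot_rel r' r)"
proof -
  note c = quot_map_cls[OF assms(1,2,4)]
  have "quot_rel (transport s r') (transport s r) = {(cls (transport s r') (s x), cls (transport s r') (s y)) |x y. (x, y) \<in> r}"
    by (force simp: quot_rel_def transport_def)
  also have "\<dots> = {(quot_map s (cls r' x), quot_map s (cls r' y)) |x y. (x, y) \<in> r}"
    using c equivsD(1)[OF assms(3)] by (auto; metis SigmaD1 SigmaD2 subsetD)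
  also have "\<dots> = transport (quot_map s) (quot_rel r' r)"
    by (force simp: quot_rel_def transport_def)
  finally show ?thesis .
qed

text \<open>The image of a union is the union of the images. This is the naturality of the
  identification of iterated quotients, used for \<open>dq_natural\<close>.\<close>

lemma flatten_quot_map: "flatten (quot_map (quot_map s) c) = quot_map s (flatten c)"
proof -
  have "fset (ffUnion (members |`| members (quot_map (quot_map s) c))) = fset (s |`| ffUnion (members |`| members c))"
    by (simp add: ffUnion.rep_eq quot_map_def image_Union image_image)
  then show ?thesis unfolding flatten_def quot_map_def[of s] fset_inject by simp
qed

text \<open>A set of sets of sets has the same union whether the inner or the outer level is merged
  first. It is the coherence between the two ways from a triple quotient ((X/r'')/r')/r to
  X/r.\<close>

lemma flatten_flatten: "flatten (quot_map flatten c) = flatten (flatten c)"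
proof -
  have "fset (ffUnion (members |`| members (quot_map flatten c))) =
      fset (ffUnion (members |`| members (flatten c)))"
    by (simp add: ffUnion.rep_eq quot_map_def flatten_def image_image)
  then show ?thesis unfolding flatten_def[of "quot_map flatten c"] flatten_def[of "flatten c"] fset_inject by simp
qed

text \<open>Flattening undoes the bijection onto singletons by which \<open>delta_counit\<close>
  identifies P[X] with P[X/=].\<close>

lemma flatten_singleton: "c \<in> quot X r \<Longrightarrow> flatten (Cls {|c|}) = c"
  by (auto simp: quot_eq cls_def flatten_def)

lemma quot_rel_self:
  assumes "finite X" "r \<in> equivs X"
  shows "quot_rel r r = Id_on (quot X r)"
  using cls_eq_iff[OF assms] equivsD(1,2)[OF assms(2)] unfolding quot_rel_def quot_eq
  by fastforce

lemma quot_rel_eq_Id_iff: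
  assumes "finite X" "r \<in> equivs X" "r' \<in> equivs X" "r' \<subseteq> r"
  shows "quot_rel r' r = Id_on (quot X r') \<longleftrightarrow> r = r'"
proof
  assume "quot_rel r' r = Id_on (quot X r')"
  then have "quot_rel r' r = quot_rel r' r'" by (simp only: quot_rel_self[OF assms(1,3)])
  then show "r = r'" using quot_rel_bij[OF assms(1,3)] assms by (auto simp: bij_betw_def dest: inj_onD)
qed (simp add: quot_rel_self assms)

text \<open>The identification of the relations coarser than \<open>r''\<close> with the
  equivalences on X/r'' respects inclusion in both directions, so the case distinction in axiom (ii)
  for X/r'' can be read off on X.\<close>

lemma quot_rel_subset_iff:
  assumes X: "finite X" "r \<in> equivs X" "r' \<in> equivs X" "r'' \<in> equivs X" "r'' \<subseteq> r'" "r'' \<subseteq> r"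
  shows "quot_rel r'' r' \<subseteq> quot_rel r'' r \<longleftrightarrow> r' \<subseteq> r"
proof
  assume sub: "quot_rel r'' r' \<subseteq> quot_rel r'' r"
  show "r' \<subseteq> r"
  proof
    fix p assume p: "p \<in> r'"
    obtain x y where [simp]: "p = (x, y)" by force
    have xy: "x \<in> X" "y \<in> X" using p equivsD(1)[OF X(3)] by auto
    show "p \<in> r" using p sub quot_rel_iff[OF X(1,3,4,5) xy] quot_rel_iff[OF X(1,2,4,6) xy] by auto
  qed
qed (auto simp: quot_rel_def)

text \<open>On the quotient (X/r'')/r' the relation \<open>r\<close> arrives by way of X/r''.
  Flattening turns it into \<open>r\<close> seen directly on X/r', and this lets naturality of
  \<open>delta\<close> be applied to the bijection \<open>flatten\<close>.\<close>

lemma transport_flatten_quot_rel: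
  assumes X: "finite X" "r \<in> equivs X" "r' \<in> equivs X" "r'' \<in> equivs X" "r'' \<subseteq> r'" "r' \<subseteq> r"
  shows "transport flatten (quot_rel (quot_rel r'' r') (quot_rel r'' r)) = quot_rel r' r"
proof -
  have "quot_rel (quot_rel r'' r') (quot_rel r'' r) =
      {(cls (quot_rel r'' r') (cls r'' x), cls (quot_rel r'' r') (cls r'' y)) |x y. (x, y) \<in> r}"
    unfolding quot_rel_def[of _ "quot_rel r'' r"] by (force simp: quot_rel_def[of r'' r])
  then have "transport flatten (quot_rel (quot_rel r'' r') (quot_rel r'' r)) =
      {(flatten (cls (quot_rel r'' r') (cls r'' x)), flatten (cls (quot_rel r'' r') (cls r'' y))) |x y. (x, y) \<in> r}"
    by (force simp: transport_def)
  also have "\<dots> = {(cls r' x, cls r' y) |x y. (x, y) \<in> r}"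
    using flatten_cls[OF X(1,3,4,5)] equivsD(1)[OF X(2)] by (auto; metis SigmaD1 SigmaD2 subsetD)
  finally show ?thesis by (simp add: quot_rel_def)
qed

lemma quot_rel_Un:
  assumes "finite X" "finite Y" "X \<inter> Y = {}" "rX' \<in> equivs X" "rY' \<in> equivs Y"
    and "rX \<in> equivs X" "rY \<in> equivs Y"
  shows "quot_rel (rX' \<union> rY') (rX \<union> rY) = quot_rel rX' rX \<union> quot_rel rY' rY"
proof -
  note c = cls_Un[OF assms(4,5,3)]
  have "quot_rel (rX' \<union> rY') (rX \<union> rY) = map_prod (cls (rX' \<union> rY')) (cls (rX' \<union> rY')) ` rX
      \<union> map_prod (cls (rX' \<union> rY')) (cls (rX' \<union> rY')) ` rY" by (force simp: quot_rel_def)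
  also have "map_prod (cls (rX' \<union> rY')) (cls (rX' \<union> rY')) ` rX = map_prod (cls rX') (cls rX') ` rX"
    using c(1) equivsD(1)[OF assms(6)] by (intro image_cong) auto
  also have "map_prod (cls (rX' \<union> rY')) (cls (rX' \<union> rY')) ` rY = map_prod (cls rY') (cls rY') ` rY"
    using c(2) equivsD(1)[OF assms(7)] by (intro image_cong) auto
  finally show ?thesis by (force simp: quot_rel_def)
qed

text \<open>Classes are related exactly when their representatives are, and disjointness of the
  quotients lets a class tell on which side its representative lies. It transfers the case
  distinction in the compatibility of \<open>delta\<close> with the product to the
  quotients.\<close>

lemma quot_rel_splits:
  assumes X: "finite X" "finite Y" "X \<inter> Y = {}" "rX' \<in> equivs X" "rY' \<in> equivs Y"
    and r: "r \<in> equivs (X \<union> Y)" "rX' \<union> rY' \<subseteq> r"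
  shows "splits (quot_rel (rX' \<union> rY') r) (quot X rX') (quot Y rY') \<longleftrightarrow> splits r X Y"
proof
  let ?r' = "rX' \<union> rY'"
  have r': "?r' \<in> equivs (X \<union> Y)" by (rule equivs_Un[OF X(4,5,3)])
  note c = cls_Un[OF X(4,5,3)]
  have disj: "quot X rX' \<inter> quot Y rY' = {}" by (rule quot_disjoint[OF X(1,2,4,5,3)])
  assume sp: "splits (quot_rel ?r' r) (quot X rX') (quot Y rY')"
  show "splits r X Y"
    unfolding splits_iff
  proof (intro ballI, clarify)
    fix x y assume xy: "(x, y) \<in> r" "\<not> (x \<in> Y \<and> y \<in> Y)"
    have 1: "(cls ?r' x, cls ?r' y) \<in> quot_rel ?r' r" using xy by (auto simp: quot_rel_def)
    have m: "x \<in> X \<union> Y" "y \<in> X \<union> Y" using xy equivsD(1)[OF r(1)] by auto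
    have q: "cls ?r' z \<in> quot X rX' \<longleftrightarrow> z \<in> X" "cls ?r' z \<in> quot Y rY' \<longleftrightarrow> z \<in> Y" if "z \<in> X \<union> Y" for z
      using that c disj X(3) by (auto simp: quot_eq disjoint_iff)
    show "x \<in> X \<and> y \<in> X" using sp 1 q[OF m(1)] q[OF m(2)] xy(2) unfolding splits_iff by auto
  qed
next
  let ?r' = "rX' \<union> rY'"
  assume "splits r X Y"
  then have eq: "r = r \<inter> X \<times> X \<union> r \<inter> Y \<times> Y" by (simp add: splits_def)
  have e: "r \<inter> X \<times> X \<in> equivs X" "r \<inter> Y \<times> Y \<in> equivs Y" using equivs_restrict[OF r(1)] by auto
  have sub: "rX' \<subseteq> r \<inter> X \<times> X" "rY' \<subseteq> r \<inter> Y \<times> Y" using r(2) equivsD(1)[OF X(4)] equivsD(1)[OF X(5)] by auto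
  have "quot_rel ?r' r = quot_rel rX' (r \<inter> X \<times> X) \<union> quot_rel rY' (r \<inter> Y \<times> Y)"
    by (subst eq) (rule quot_rel_Un[OF X e])
  then show "splits (quot_rel ?r' r) (quot X rX') (quot Y rY')"
    using splits_Un[OF quot_rel_equivs[OF X(1) e(1) X(4) sub(1)] quot_rel_equivs[OF X(2) e(2) X(5) sub(2)]]
    by simp
qed

text \<open>The bound \<open>rX' \<union> rY' \<subseteq> r\<close> separates along the two blocks,
  so taking unions identifies pairs of coarser relations with the split relations above the bound.
  The terms that are set to zero come from the vanishing of \<open>delta\<close> in
  \<open>com_delta_m\<close> and of \<open>D'\<close> in \<open>com_delta_D\<close>.\<close>

lemma sum_splits:
  fixes g :: "('u \<times> 'u) set \<Rightarrow> 'v::comm_monoid_add"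
  assumes X: "finite X" "finite Y" "X \<inter> Y = {}" "rX' \<in> equivs X" "rY' \<in> equivs Y"
  shows "(\<Sum>r | r \<in> equivs (X \<union> Y) \<and> rX' \<union> rY' \<subseteq> r. if splits r X Y then g r else 0) =
    (\<Sum>rX | rX \<in> equivs X \<and> rX' \<subseteq> rX. \<Sum>rY | rY \<in> equivs Y \<and> rY' \<subseteq> rY. g (rX \<union> rY))"
proof -
  let ?S = "{r. r \<in> equivs (X \<union> Y) \<and> rX' \<union> rY' \<subseteq> r}"
  let ?A = "{rX. rX \<in> equivs X \<and> rX' \<subseteq> rX}" and ?B = "{rY. rY \<in> equivs Y \<and> rY' \<subseteq> rY}"
  have fin: "finite ?S" using finite_equivs[of "X \<union> Y"] X by (auto intro: finite_subset)
  have "(\<Sum>r\<in>?S. if splits r X Y then g r else 0) = sum g {r \<in> ?S. splits r X Y}"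
    by (rule sum.inter_filter[OF fin, symmetric])
  also have "\<dots> = (\<Sum>p\<in>?A \<times> ?B. g (fst p \<union> snd p))"
  proof (rule sum.reindex_bij_witness[of _ "\<lambda>p. fst p \<union> snd p" "\<lambda>r. (r \<inter> X \<times> X, r \<inter> Y \<times> Y)"])
    fix r assume r: "r \<in> {r \<in> ?S. splits r X Y}"
    show "fst (r \<inter> X \<times> X, r \<inter> Y \<times> Y) \<union> snd (r \<inter> X \<times> X, r \<inter> Y \<times> Y) = r" using r by (auto simp: splits_def)
    show "(r \<inter> X \<times> X, r \<inter> Y \<times> Y) \<in> ?A \<times> ?B"
      using r equivs_restrict[of r "X \<union> Y"] equivsD(1)[OF X(4)] equivsD(1)[OF X(5)] by auto
    show "g (fst (r \<inter> X \<times> X, r \<inter> Y \<times> Y) \<union> snd (r \<inter> X \<times> X, r \<inter> Y \<times> Y)) = g r"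
      using r by (auto simp: splits_def)
  next
    fix p assume p: "p \<in> ?A \<times> ?B"
    then have e: "fst p \<in> equivs X" "snd p \<in> equivs Y" by auto
    show "((fst p \<union> snd p) \<inter> X \<times> X, (fst p \<union> snd p) \<inter> Y \<times> Y) = p"
      using equivs_restrict_Un[OF e X(3)] by simp
    show "fst p \<union> snd p \<in> {r \<in> ?S. splits r X Y}"
      using p equivs_Un[OF e X(3)] splits_Un[OF e] by auto
  qed
  also have "\<dots> = (\<Sum>rX\<in>?A. \<Sum>rY\<in>?B. g (rX \<union> rY))"
    by (simp add: sum.cartesian_product case_prod_beta)
  finally show ?thesis .
qed

section \<open>The composition with \<open>Com\<close>\<close>

text \<open>The universe is fixed to \<open>'a hf\<close> because only there the quotients of finite
  sets are again sets on which the species is defined.\<close>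

locale hf_species = species P act
  for P :: "'a hf set \<Rightarrow> ('k::field, 'v::ab_group_add) kspace" and act
begin

abbreviation P' where "P' \<equiv> com_space P"
abbreviation PQ where "PQ X r \<equiv> P (quot X r)"
abbreviation act' where "act' \<equiv> com_act act"
abbreviation in2 where
  "in2 X r Y s \<equiv> tmap (PQ X r) (PQ Y s) (P' X) (P' Y) (com_in r) (com_in s)"

lemma vec_space_P_quot: "finite X \<Longrightarrow> vec_space (PQ X r)"
  by (intro vec_space_P finite_quot)

lemma vec_space_com:
  assumes "finite X"
  shows "vec_space (P' X)"
proof -
  note V = vec_space_P_quot[OF assms]
  note sc = vec_space_scale[OF V] and cl = vec_space_closed[OF V]
  have vs: "vector_space (vscale (P' X))"
    by unfold_locales (simp_all add: com_space_def fun_eq_iff sc)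
  then interpret C: vector_space "vscale (P' X)" .
  have "C.subspace (vcarrier (P' X))"
    unfolding C.subspace_def by (auto simp: com_space_def cl sc)
  with vs show ?thesis by (simp add: vec_space_def)
qed

lemma com_in_linear:
  assumes "finite X" "r \<in> equivs X"
  shows "linear_on (PQ X r) (P' X) (com_in r)"
  using assms vec_space_closed(1)[OF vec_space_P_quot[OF assms(1)]] vec_space_scale(4)[OF vec_space_P_quot[OF assms(1)]]
  by (auto intro!: linear_onI simp: com_space_def com_in_def fun_eq_iff)

lemma com_in_closed:
  "finite X \<Longrightarrow> r \<in> equivs X \<Longrightarrow> v \<in> vcarrier (PQ X r) \<Longrightarrow> com_in r v \<in> vcarrier (P' X)"
  by (rule linear_on_in[OF com_in_linear])

lemma com_component:
  "f \<in> vcarrier (P' X) \<Longrightarrow> r \<in> equivs X \<Longrightarrow> f r \<in> vcarrier (PQ X r)"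
  by (simp add: com_space_def)

lemma com_component_linear: "r \<in> equivs X \<Longrightarrow> linear_on (P' X) (PQ X r) (\<lambda>f. f r)"
  by (rule linear_onI) (auto simp: com_space_def)

lemma sum_com_in_apply: "finite E \<Longrightarrow> (\<Sum>r\<in>E. com_in r (f r)) r' = (if r' \<in> E then f r' else 0)"
  by (induction E rule: finite_induct) (auto simp: com_in_def)

section \<open>Reduction of linear identities to the summands\<close>

lemma com_decompose:
  assumes "finite X" "f \<in> vcarrier (P' X)"
  shows "f = (\<Sum>r\<in>equivs X. com_in r (f r))"
  using assms by (auto simp: fun_eq_iff sum_com_in_apply finite_equivs com_space_def)

lemma com_ext:
  assumes X: "finite X" and F: "linear_on (P' X) U F" and G: "linear_on (P' X) U G"
    and eq: "\<And>r v. r \<in> equivs X \<Longrightarrow> v \<in> vcarrier (PQ X r) \<Longrightarrow> F (com_in r v) = G (com_in r v)"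
    and f: "f \<in> vcarrier (P' X)"
  shows "F f = G f"
proof -
  note cl = com_in_closed[OF X _ com_component[OF f]]
  have H: "H f = (\<Sum>r\<in>equivs X. H (com_in r (f r)))" if H: "linear_on (P' X) U H" for H
    using arg_cong[OF com_decompose[OF X f], of H] linear_on_map_sum[OF vec_space_com[OF X] H cl] by simp
  show ?thesis
    unfolding H[OF F] H[OF G] by (intro sum.cong refl eq com_component[OF f])
qed

lemma com_ext2:
  assumes X: "finite X" "finite Y"
    and F: "linear_on (P' X \<otimes> P' Y) U F" and G: "linear_on (P' X \<otimes> P' Y) U G"
    and eq: "\<And>r s v w. r \<in> equivs X \<Longrightarrow> s \<in> equivs Y \<Longrightarrow> v \<in> vcarrier (PQ X r) \<Longrightarrow> w \<in> vcarrier (PQ Y s) \<Longrightarrow>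
      F (ten (P' X) (P' Y) (com_in r v) (com_in s w)) =
      G (ten (P' X) (P' Y) (com_in r v) (com_in s w))"
    and t: "t \<in> vcarrier (P' X \<otimes> P' Y)"
  shows "F t = G t"
proof (rule tlift_unique[OF vec_space_com[OF X(1)] vec_space_com[OF X(2)] F G _ t])
  fix f g assume f: "f \<in> vcarrier (P' X)" and g: "g \<in> vcarrier (P' Y)"
  have l: "linear_on (P' X) U (\<lambda>f. H (ten (P' X) (P' Y) f g))"
    "w \<in> vcarrier (P' X) \<Longrightarrow> linear_on (P' Y) U (\<lambda>g. H (ten (P' X) (P' Y) w g))"
    if "linear_on (P' X \<otimes> P' Y) U H" for H w
    by (intro linear_on_comp[OF linear_on_ten(1) that] g) (intro linear_on_comp[OF linear_on_ten(2) that])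
  show "F (ten (P' X) (P' Y) f g) = G (ten (P' X) (P' Y) f g)"
  proof (rule com_ext[OF X(1) l(1)[OF F] l(1)[OF G] _ f])
    fix r v assume rv: "r \<in> equivs X" "v \<in> vcarrier (PQ X r)"
    note c = com_in_closed[OF X(1) rv]
    show "F (ten (P' X) (P' Y) (com_in r v) g) = G (ten (P' X) (P' Y) (com_in r v) g)"
      by (rule com_ext[OF X(2) l(2)[OF F c] l(2)[OF G c] _ g]) (intro eq rv)
  qed
qed

lemma com_ext3:
  assumes X: "finite X" "finite Y" "finite Z"
    and F: "linear_on (P' X \<otimes> P' Y \<otimes> P' Z) U F"
    and G: "linear_on (P' X \<otimes> P' Y \<otimes> P' Z) U G"
    and eq: "\<And>r s q v w u. r \<in> equivs X \<Longrightarrow> s \<in> equivs Y \<Longrightarrow> q \<in> equivs Z \<Longrightarrow>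
      v \<in> vcarrier (PQ X r) \<Longrightarrow> w \<in> vcarrier (PQ Y s) \<Longrightarrow> u \<in> vcarrier (PQ Z q) \<Longrightarrow>
      F (ten (P' X \<otimes> P' Y) (P' Z) (ten (P' X) (P' Y) (com_in r v) (com_in s w)) (com_in q u)) =
      G (ten (P' X \<otimes> P' Y) (P' Z) (ten (P' X) (P' Y) (com_in r v) (com_in s w)) (com_in q u))"
    and t: "t \<in> vcarrier (P' X \<otimes> P' Y \<otimes> P' Z)"
  shows "F t = G t"
proof (rule tlift_unique[OF vec_space_tensor[OF vec_space_com[OF X(1)] vec_space_com[OF X(2)]] vec_space_com[OF X(3)] F G _ t])
  let ?T = "P' X \<otimes> P' Y"
  fix a g assume a: "a \<in> vcarrier ?T" and g: "g \<in> vcarrier (P' Z)"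
  have l: "g \<in> vcarrier (P' Z) \<Longrightarrow> linear_on ?T U (\<lambda>f. H (ten ?T (P' Z) f g))"
    "w \<in> vcarrier ?T \<Longrightarrow> linear_on (P' Z) U (\<lambda>g. H (ten ?T (P' Z) w g))"
    if "linear_on (?T \<otimes> P' Z) U H" for H w g
    by (auto intro: linear_on_comp[OF linear_on_ten(1) that] linear_on_comp[OF linear_on_ten(2) that])
  show "F (ten ?T (P' Z) a g) = G (ten ?T (P' Z) a g)"
  proof (rule com_ext[OF X(3) l(2)[OF F a] l(2)[OF G a] _ g])
    fix q u assume q: "q \<in> equivs Z" and u: "u \<in> vcarrier (PQ Z q)"
    note c = com_in_closed[OF X(3) q u]
    show "F (ten ?T (P' Z) a (com_in q u)) = G (ten ?T (P' Z) a (com_in q u))"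
      by (rule com_ext2[OF X(1,2) l(1)[OF F c] l(1)[OF G c] _ a]) (intro eq q u)
  qed
qed

lemma com_family_linear:
  assumes U: "vec_space U" and F: "\<And>r. r \<in> equivs X \<Longrightarrow> linear_on (PQ X r) U (F r)"
  shows "linear_on (P' X) U (\<lambda>f. \<Sum>r\<in>equivs X. F r (f r))"
  by (intro linear_on_sum[OF U] linear_on_comp[OF com_component_linear F])

lemma com_family_in:
  assumes X: "finite X" and F: "\<And>r. r \<in> equivs X \<Longrightarrow> linear_on (PQ X r) U (F r)" and r: "r \<in> equivs X"
  shows "(\<Sum>s\<in>equivs X. F s (com_in r v s)) = F r v"
proof -
  \<comment> \<open>The components of \<open>com_in r v\<close> away from \<open>r\<close> are zero,
    and a linear \<open>F s\<close> kills zero.\<close>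
  have "s \<in> equivs X \<Longrightarrow> F s (com_in r v s) = (if s = r then F r v else 0)" for s
    using linear_on_zero[OF vec_space_P_quot[OF X] F] by (auto simp: com_in_def)
  then show ?thesis using r finite_equivs[OF X] by simp
qed

section \<open>The action of bijections on the composition\<close>

lemma act_quot_linear:
  assumes "finite X" "inj_on s X" "r \<in> equivs X"
  shows "linear_on (PQ X r) (PQ (s ` X) (transport s r)) (act (quot X r) (quot_map s))"
  using act_linear[OF finite_quot[OF assms(1)] inj_on_quot_map[OF assms(2,1,3)]] assms
  by (simp add: quot_transport)

lemma com_act_summand_linear:
  assumes "finite X" "inj_on s X" "r \<in> equivs X"
  shows "linear_on (PQ X r) (P' (s ` X)) (\<lambda>v. com_in (transport s r) (act (quot X r) (quot_map s) v))"
  using assms by (intro linear_on_comp[OF act_quot_linear com_in_linear] transport_equivs) auto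

lemma com_act_linear:
  assumes "finite X" "inj_on s X"
  shows "linear_on (P' X) (P' (s ` X)) (act' X s)"
  unfolding com_act_def using assms
  by (intro com_family_linear vec_space_com com_act_summand_linear) auto

lemma com_act_in:
  assumes "finite X" "inj_on s X" "r \<in> equivs X"
  shows "act' X s (com_in r v) = com_in (transport s r) (act (quot X r) (quot_map s) v)"
  unfolding com_act_def by (rule com_family_in[OF assms(1) com_act_summand_linear assms(3)]) (use assms in auto)

lemma species_com: "species P' act'"
proof
  fix X :: "'a hf set" and s s' :: "'a hf \<Rightarrow> 'a hf" and v
  assume X: "finite X"
  show "vec_space (P' X)" by (rule vec_space_com[OF X])
  show "inj_on s X \<Longrightarrow> linear_on (P' X) (P' (s ` X)) (act' X s)"
    by (rule com_act_linear[OF X])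
  assume v: "v \<in> vcarrier (P' X)"
  show "act' X id v = v"
  proof (rule com_ext[OF X _ linear_on_id _ v])
    show "linear_on (P' X) (P' X) (act' X id)"
      using com_act_linear[OF X, of id] by simp
    fix r v assume r: "r \<in> equivs X" "v \<in> vcarrier (PQ X r)"
    \<comment> \<open>\<open>quot_map id\<close> is not the identity function, since it sends an
      atom to a class. The two agree on elements of a quotient only, whence the detour through
      \<open>act_cong\<close>.\<close>
    have "act (quot X r) (quot_map id) v = act (quot X r) id v"
      using inj_on_quot_map[OF _ X r(1), of id] quot_map_id
      by (intro act_cong finite_quot X r) auto
    then show "act' X id (com_in r v) = com_in r v"
      using r by (simp add: com_act_in X transport_id act_id finite_quot)
  qed
next
  fix X :: "'a hf set" and s s' :: "'a hf \<Rightarrow> 'a hf" and v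
  assume X: "finite X" and s: "inj_on s X" and eq: "\<And>x. x \<in> X \<Longrightarrow> s x = s' x"
    and v: "v \<in> vcarrier (P' X)"
  have s': "inj_on s' X" using s eq by (simp cong: inj_on_cong)
  have im: "s ` X = s' ` X" using eq by (intro image_cong) auto
  show "act' X s v = act' X s' v"
  proof (rule com_ext[OF X com_act_linear[OF X s] _ _ v])
    show "linear_on (P' X) (P' (s ` X)) (act' X s')"
      unfolding im by (rule com_act_linear[OF X s'])
    fix r v assume r: "r \<in> equivs X" "v \<in> vcarrier (PQ X r)"
    have "act (quot X r) (quot_map s) v = act (quot X r) (quot_map s') v"
      by (rule act_cong[OF finite_quot[OF X] inj_on_quot_map[OF s X r(1)] quot_map_cong[OF X r(1) eq] r(2)])
    then show "act' X s (com_in r v) = act' X s' (com_in r v)"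
      using transport_cong[OF equivsD(1)[OF r(1)] eq] by (simp add: com_act_in X s s' r)
  qed
next
  fix X :: "'a hf set" and s s' :: "'a hf \<Rightarrow> 'a hf" and v
  assume X: "finite X" and s: "inj_on s X" and s': "inj_on s' (s ` X)"
    and v: "v \<in> vcarrier (P' X)"
  have c: "inj_on (s' \<circ> s) X" by (rule comp_inj_on[OF s s'])
  have l: "linear_on (P' X) (P' (s' ` s ` X)) (act' X (s' \<circ> s))"
    using com_act_linear[OF X c] by (simp add: image_comp)
  show "act' X (s' \<circ> s) v = act' (s ` X) s' (act' X s v)"
  proof (rule com_ext[OF X l linear_on_comp[OF com_act_linear[OF X s] com_act_linear[OF finite_imageI[OF X] s']] _ v])
    fix r v assume r: "r \<in> equivs X" "v \<in> vcarrier (PQ X r)"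
    note t = transport_equivs[OF s r(1)]
    have "act (quot X r) (quot_map (s' \<circ> s)) v =
        act (quot (s ` X) (transport s r)) (quot_map s') (act (quot X r) (quot_map s) v)"
      using act_comp[OF finite_quot[OF X] inj_on_quot_map[OF s X r(1)] _ r(2), of "quot_map s'"]
        inj_on_quot_map[OF s' finite_imageI[OF X] t]
      by (simp add: quot_map_comp quot_transport[OF s X r(1)])
    then show "act' X (s' \<circ> s) (com_in r v) = act' (s ` X) s' (act' X s (com_in r v))"
      by (simp add: com_act_in X c r s s' t transport_comp)
  qed
qed

end

section \<open>Products and coproducts\<close>

locale hf_twisted_algebra = hf_species P act + twisted_algebra P act m one
  for P :: "'a hf set \<Rightarrow> ('k::field, 'v::ab_group_add) kspace" and act m one
begin

abbreviation m' where "m' \<equiv> com_mult P m"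

lemma m_quot_linear:
  assumes "finite X" "finite Y" "X \<inter> Y = {}" "r \<in> equivs X" "s \<in> equivs Y"
  shows "linear_on (PQ X r \<otimes> PQ Y s) (PQ (X \<union> Y) (r \<union> s)) (m (quot X r) (quot Y s))"
  using m_linear[OF finite_quot finite_quot quot_disjoint[OF assms(1,2,4,5,3)]] assms quot_Un[OF assms(4,5,3)]
  by simp

lemma com_mult_bilinear:
  assumes X: "finite X" "finite Y" "X \<inter> Y = {}"
  shows "bilinear_on (P' X) (P' Y) (P' (X \<union> Y)) (\<lambda>f g.
       \<Sum>r \<in> equivs X. \<Sum>s \<in> equivs Y.
         com_in (r \<union> s) (m (quot X r) (quot Y s) (ten (PQ X r) (PQ Y s) (f r) (g s))))"
proof -
  have U: "vec_space (P' (X \<union> Y))" using X by (intro vec_space_com) auto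
  have l: "linear_on (PQ X r \<otimes> PQ Y s) (P' (X \<union> Y)) (\<lambda>t. com_in (r \<union> s) (m (quot X r) (quot Y s) t))"
    if "r \<in> equivs X" "s \<in> equivs Y" for r s
    using X that by (intro linear_on_comp[OF m_quot_linear com_in_linear] equivs_Un) auto
  show ?thesis
  proof (rule bilinear_onI)
    fix g assume g: "g \<in> vcarrier (P' Y)"
    show "linear_on (P' X) (P' (X \<union> Y)) (\<lambda>f. \<Sum>r \<in> equivs X. \<Sum>s \<in> equivs Y.
         com_in (r \<union> s) (m (quot X r) (quot Y s) (ten (PQ X r) (PQ Y s) (f r) (g s))))"
      by (intro com_family_linear[OF U, where F = "\<lambda>r v. \<Sum>s \<in> equivs Y.
           com_in (r \<union> s) (m (quot X r) (quot Y s) (ten (PQ X r) (PQ Y s) v (g s)))"]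
          linear_on_sum[OF U] linear_on_comp[OF linear_on_ten(1) l] com_component[OF g])
  next
    fix f assume f: "f \<in> vcarrier (P' X)"
    show "linear_on (P' Y) (P' (X \<union> Y)) (\<lambda>g. \<Sum>r \<in> equivs X. \<Sum>s \<in> equivs Y.
         com_in (r \<union> s) (m (quot X r) (quot Y s) (ten (PQ X r) (PQ Y s) (f r) (g s))))"
      by (intro linear_on_sum[OF U] linear_on_comp[OF com_component_linear linear_on_comp[OF linear_on_ten(2) l]]
          com_component[OF f])
  qed
qed

lemma com_mult_linear:
  assumes "finite X" "finite Y" "X \<inter> Y = {}"
  shows "linear_on (P' X \<otimes> P' Y) (P' (X \<union> Y)) (m' X Y)"
  unfolding com_mult_def using assms
  by (intro tlift_universal(1) com_mult_bilinear vec_space_com) auto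

lemma com_mult_ten:
  assumes X: "finite X" "finite Y" "X \<inter> Y = {}" and r: "r \<in> equivs X" "s \<in> equivs Y"
    and v: "v \<in> vcarrier (PQ X r)" "w \<in> vcarrier (PQ Y s)"
  shows "m' X Y (ten (P' X) (P' Y) (com_in r v) (com_in s w)) =
    com_in (r \<union> s) (m (quot X r) (quot Y s) (ten (PQ X r) (PQ Y s) v w))"
proof -
  let ?G = "\<lambda>r s v w. com_in (r \<union> s) (m (quot X r) (quot Y s) (ten (PQ X r) (PQ Y s) v w))"
  have XY: "finite (X \<union> Y)" using X by simp
  have l: "linear_on (PQ X r \<otimes> PQ Y s) (P' (X \<union> Y)) (\<lambda>t. com_in (r \<union> s) (m (quot X r) (quot Y s) t))"
    if "r \<in> equivs X" "s \<in> equivs Y" for r s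
    using X that by (intro linear_on_comp[OF m_quot_linear com_in_linear] equivs_Un) auto
  note ci = com_in_closed[OF X(1) r(1) v(1)] com_in_closed[OF X(2) r(2) v(2)]
  have "m' X Y (ten (P' X) (P' Y) (com_in r v) (com_in s w)) =
     (\<Sum>r'\<in>equivs X. \<Sum>s'\<in>equivs Y. ?G r' s' (com_in r v r') (com_in s w s'))"
    unfolding com_mult_def
    by (rule tlift_universal(2)[OF vec_space_com[OF X(1)] vec_space_com[OF X(2)] vec_space_com[OF XY]
          com_mult_bilinear[OF X] ci])
  \<comment> \<open>The double sum collapses one index at a time: with one argument fixed, the other
    one ranges over a family of linear maps as in \<open>com_family_in\<close>.\<close>
  also have "\<dots> = (\<Sum>r'\<in>equivs X. ?G r' s (com_in r v r') w)"
  proof (rule sum.cong[OF refl])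
    fix r' assume r': "r' \<in> equivs X"
    show "(\<Sum>s'\<in>equivs Y. ?G r' s' (com_in r v r') (com_in s w s')) = ?G r' s (com_in r v r') w"
      by (rule com_family_in[OF X(2) _ r(2), where F = "\<lambda>s' w. ?G r' s' (com_in r v r') w" and U = "P' (X \<union> Y)"])
        (intro linear_on_comp[OF linear_on_ten(2) l] com_component[OF ci(1)] r')
  qed
  also have "\<dots> = ?G r s v w"
    by (rule com_family_in[OF X(1) _ r(1), where F = "\<lambda>r' v. ?G r' s v w" and U = "P' (X \<union> Y)"])
      (intro linear_on_comp[OF linear_on_ten(1) l] v r)
  finally show ?thesis .
qed

text \<open>Coproducts yield tensors that are not elementary, so their composition with the product
  needs the formula of \<open>com_mult_ten\<close> on all of the tensor product of two
  summands.\<close>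

lemma com_mult_tmap:
  assumes X: "finite X" "finite Y" "X \<inter> Y = {}" and r: "r \<in> equivs X" "s \<in> equivs Y"
    and t: "t \<in> vcarrier (PQ X r \<otimes> PQ Y s)"
  shows "m' X Y (in2 X r Y s t) =
    com_in (r \<union> s) (m (quot X r) (quot Y s) t)"
proof (rule tlift_unique[OF vec_space_P_quot[OF X(1)] vec_space_P_quot[OF X(2)] _ _ _ t])
  have e: "r \<union> s \<in> equivs (X \<union> Y)" using equivs_Un[OF r X(3)] .
  show "linear_on (PQ X r \<otimes> PQ Y s) (P' (X \<union> Y)) (\<lambda>t. m' X Y
    (in2 X r Y s t))"
    by (intro linear_on_comp[OF tmap_linear com_mult_linear] vec_space_P_quot vec_space_com com_in_linear X r)
  show "linear_on (PQ X r \<otimes> PQ Y s) (P' (X \<union> Y)) (\<lambda>t. com_in (r \<union> s) (m (quot X r) (quot Y s) t))"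
    using X e by (intro linear_on_comp[OF m_quot_linear com_in_linear] r) auto
  fix v w assume "v \<in> vcarrier (PQ X r)" "w \<in> vcarrier (PQ Y s)"
  then show "m' X Y (in2 X r Y s
      (ten (PQ X r) (PQ Y s) v w)) = com_in (r \<union> s) (m (quot X r) (quot Y s) (ten (PQ X r) (PQ Y s) v w))"
    by (simp add: tmap_ten com_mult_ten vec_space_P_quot vec_space_com com_in_linear X r)
qed

text \<open>Multiplying after the flip occurs both in the bialgebra axiom and in the compatibility
  of \<open>delta'\<close> with \<open>m'\<close>. Disjointness is asked of the factors that get
  multiplied, \<open>A\<close> with \<open>C\<close> and \<open>B\<close> with \<open>E\<close>: in
  the first use the sets are four blocks, in the second one \<open>A = B\<close> and
  \<open>C = E\<close>. Naturality of the flip and \<open>com_mult_tmap\<close> carry the inclusions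
  outside.\<close>

lemma com_mult_swap:
  assumes fin: "finite A" "finite B" "finite C" "finite E" and disj: "A \<inter> C = {}" "B \<inter> E = {}"
    and r: "a \<in> equivs A" "b \<in> equivs B" "c \<in> equivs C" "e \<in> equivs E"
    and t: "t \<in> vcarrier ((PQ A a \<otimes> PQ B b) \<otimes> (PQ C c \<otimes> PQ E e))"
  shows "tmap (P' A \<otimes> P' C) (P' B \<otimes> P' E) (P' (A \<union> C)) (P' (B \<union> E))
      (m' A C) (m' B E)
      (tswap_mid (P' A) (P' B) (P' C) (P' E)
        (tmap (PQ A a \<otimes> PQ B b) (PQ C c \<otimes> PQ E e) (P' A \<otimes> P' B) (P' C \<otimes> P' E)
          (in2 A a B b)
          (in2 C c E e) t)) =
    in2 (A \<union> C) (a \<union> c) (B \<union> E) (b \<union> e)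
      (tmap (PQ A a \<otimes> PQ C c) (PQ B b \<otimes> PQ E e) (PQ (A \<union> C) (a \<union> c)) (PQ (B \<union> E) (b \<union> e))
        (m (quot A a) (quot C c)) (m (quot B b) (quot E e))
        (tswap_mid (PQ A a) (PQ B b) (PQ C c) (PQ E e) t))"
proof -
  let ?QA = "P' A" and ?QB = "P' B" and ?QC = "P' C" and ?QE = "P' E"
  let ?QAC = "P' (A \<union> C)" and ?QBE = "P' (B \<union> E)"
  let ?PA = "PQ A a" and ?PB = "PQ B b" and ?PC = "PQ C c" and ?PE = "PQ E e"
  let ?PAC = "PQ (A \<union> C) (a \<union> c)" and ?PBE = "PQ (B \<union> E) (b \<union> e)"
  let ?sw = "tswap_mid ?PA ?PB ?PC ?PE t"
  have f: "finite (A \<union> C)" "finite (B \<union> E)" using fin by auto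
  note vs = vec_space_P_quot vec_space_com fin f vec_space_tensor
  note ue = equivs_Un[OF r(1,3) disj(1)] equivs_Un[OF r(2,4) disj(2)]
  have "linear_on ((?PA \<otimes> ?PB) \<otimes> (?PC \<otimes> ?PE)) ((?PA \<otimes> ?PC) \<otimes> (?PB \<otimes> ?PE)) (tswap_mid ?PA ?PB ?PC ?PE)"
    by (intro tswap_mid_linear vs)
  note sw = linear_on_in[OF this t]
  note ml = m_quot_linear[OF fin(1,3) disj(1) r(1,3)] m_quot_linear[OF fin(2,4) disj(2) r(2,4)]
  have "tmap ?PAC ?PBE ?QAC ?QBE (com_in (a \<union> c)) (com_in (b \<union> e))
      (tmap (?PA \<otimes> ?PC) (?PB \<otimes> ?PE) ?PAC ?PBE (m (quot A a) (quot C c)) (m (quot B b) (quot E e)) ?sw) =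
    tmap (?PA \<otimes> ?PC) (?PB \<otimes> ?PE) ?QAC ?QBE (\<lambda>t. com_in (a \<union> c) (m (quot A a) (quot C c) t))
      (\<lambda>t. com_in (b \<union> e) (m (quot B b) (quot E e) t)) ?sw"
    by (rule tmap_tmap) (intro vs ml com_in_linear ue sw)+
  \<comment> \<open>Each component is rewritten on its carrier only: multiplying and then including
    is the same as including and then multiplying in \<open>P'\<close>.\<close>
  also have "\<dots> = tmap (?PA \<otimes> ?PC) (?PB \<otimes> ?PE) ?QAC ?QBE
      (\<lambda>t. m' A C (tmap ?PA ?PC ?QA ?QC (com_in a) (com_in c) t))
      (\<lambda>t. m' B E (tmap ?PB ?PE ?QB ?QE (com_in b) (com_in e) t)) ?sw"
    by (rule arg_cong[where f = "\<lambda>h. h ?sw"], rule tmap_cong)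
      (simp_all add: com_mult_tmap[OF fin(1,3) disj(1) r(1,3)] com_mult_tmap[OF fin(2,4) disj(2) r(2,4)])
  also have "\<dots> = tmap (?QA \<otimes> ?QC) (?QB \<otimes> ?QE) ?QAC ?QBE (m' A C) (m' B E)
      (tmap (?PA \<otimes> ?PC) (?PB \<otimes> ?PE) (?QA \<otimes> ?QC) (?QB \<otimes> ?QE) (tmap ?PA ?PC ?QA ?QC (com_in a) (com_in c))
        (tmap ?PB ?PE ?QB ?QE (com_in b) (com_in e)) ?sw)"
    by (rule tmap_tmap[symmetric, where f = "tmap ?PA ?PC ?QA ?QC (com_in a) (com_in c)"
        and g = "tmap ?PB ?PE ?QB ?QE (com_in b) (com_in e)"
        and f' = "m' A C" and g' = "m' B E"])
      (intro vs com_mult_linear disj tmap_linear com_in_linear r sw)+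
  finally have mult: "tmap ?PAC ?PBE ?QAC ?QBE (com_in (a \<union> c)) (com_in (b \<union> e))
      (tmap (?PA \<otimes> ?PC) (?PB \<otimes> ?PE) ?PAC ?PBE (m (quot A a) (quot C c)) (m (quot B b) (quot E e)) ?sw) =
    tmap (?QA \<otimes> ?QC) (?QB \<otimes> ?QE) ?QAC ?QBE (m' A C) (m' B E)
      (tmap (?PA \<otimes> ?PC) (?PB \<otimes> ?PE) (?QA \<otimes> ?QC) (?QB \<otimes> ?QE) (tmap ?PA ?PC ?QA ?QC (com_in a) (com_in c))
        (tmap ?PB ?PE ?QB ?QE (com_in b) (com_in e)) ?sw)" .
  have swap: "tmap (?PA \<otimes> ?PC) (?PB \<otimes> ?PE) (?QA \<otimes> ?QC) (?QB \<otimes> ?QE) (tmap ?PA ?PC ?QA ?QC (com_in a) (com_in c))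
        (tmap ?PB ?PE ?QB ?QE (com_in b) (com_in e)) ?sw =
      tswap_mid ?QA ?QB ?QC ?QE (tmap (?PA \<otimes> ?PB) (?PC \<otimes> ?PE) (?QA \<otimes> ?QB) (?QC \<otimes> ?QE)
        (tmap ?PA ?PB ?QA ?QB (com_in a) (com_in b)) (tmap ?PC ?PE ?QC ?QE (com_in c) (com_in e)) t)"
    by (rule tswap_mid_tmap[symmetric]) (intro vs com_in_linear r t)+
  show ?thesis unfolding mult swap by (rule refl)
qed

lemma m_quot_closed:
  assumes "finite X" "finite Y" "X \<inter> Y = {}" "r \<in> equivs X" "s \<in> equivs Y"
    "v \<in> vcarrier (PQ X r)" "w \<in> vcarrier (PQ Y s)"
  shows "m (quot X r) (quot Y s) (ten (PQ X r) (PQ Y s) v w) \<in> vcarrier (PQ (X \<union> Y) (r \<union> s))"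
  using linear_on_in[OF m_quot_linear[OF assms(1-5)] ten_in] assms(6,7) by blast

lemma com_one_closed: "com_one one \<in> vcarrier (P' {})"
  using com_in_closed[of "{}" "{}" one] one_closed by (simp add: com_one_def equivs_empty quot_empty)

lemma twisted_algebra_com: "twisted_algebra P' act' m' (com_one one)"
proof (intro twisted_algebra.intro species_com, unfold_locales)
  fix X Y :: "'a hf set" and s :: "'a hf \<Rightarrow> 'a hf" and t
  assume X: "finite X" "finite Y" "X \<inter> Y = {}"
  show "linear_on (P' X \<otimes> P' Y) (P' (X \<union> Y)) (m' X Y)"
    by (rule com_mult_linear[OF X])
  assume s: "inj_on s (X \<union> Y)" and t: "t \<in> vcarrier (P' X \<otimes> P' Y)"
  have s': "inj_on s X" "inj_on s Y" using s by (auto simp: inj_on_Un)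
  have fin: "finite (X \<union> Y)" "finite (s ` X)" "finite (s ` Y)" using X by auto
  have disj: "s ` X \<inter> s ` Y = {}" using s X(3) by (auto simp: inj_on_Un)
  show "m' (s ` X) (s ` Y) (tmap (P' X) (P' Y) (P' (s ` X)) (P' (s ` Y))
       (act' X s) (act' Y s) t) = act' (X \<union> Y) s (m' X Y t)"
  proof (rule com_ext2[OF X(1,2) _ _ _ t])
    show "linear_on (P' X \<otimes> P' Y) (P' (s ` X \<union> s ` Y)) (\<lambda>t. m' (s ` X) (s ` Y)
      (tmap (P' X) (P' Y) (P' (s ` X)) (P' (s ` Y)) (act' X s) (act' Y s) t))"
      by (intro linear_on_comp[OF tmap_linear com_mult_linear] vec_space_com com_act_linear X s' fin disj)
    show "linear_on (P' X \<otimes> P' Y) (P' (s ` X \<union> s ` Y)) (\<lambda>t. act' (X \<union> Y) s (m' X Y t))"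
      using linear_on_comp[OF com_mult_linear[OF X] com_act_linear[OF fin(1) s]] by (simp add: image_Un)
  next
    fix r r' v w
    assume r: "r \<in> equivs X" "r' \<in> equivs Y" and v: "v \<in> vcarrier (PQ X r)" "w \<in> vcarrier (PQ Y r')"
    note e = equivs_Un[OF r X(3)] and te = transport_equivs[OF s'(1) r(1)] transport_equivs[OF s'(2) r(2)]
    \<comment> \<open>A single induced map serves both quotients, because their union is the
      quotient of \<open>X \<union> Y\<close> by \<open>r \<union> r'\<close>; naturality of
      \<open>m\<close> asks for injectivity on this union.\<close>
    have q: "inj_on (quot_map s) (quot X r \<union> quot Y r')"
      using inj_on_quot_map[OF s fin(1) e] by (simp add: quot_Un r X)
    note lin = act_quot_linear[OF X(1) s'(1) r(1)] act_quot_linear[OF X(2) s'(2) r(2)]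
    have "m (quot (s ` X) (transport s r)) (quot (s ` Y) (transport s r'))
        (ten (PQ (s ` X) (transport s r)) (PQ (s ` Y) (transport s r')) (act (quot X r) (quot_map s) v) (act (quot Y r') (quot_map s) w))
      = m (quot_map s ` quot X r) (quot_map s ` quot Y r')
         (tmap (PQ X r) (PQ Y r') (P (quot_map s ` quot X r)) (P (quot_map s ` quot Y r'))
           (act (quot X r) (quot_map s)) (act (quot Y r') (quot_map s)) (ten (PQ X r) (PQ Y r') v w))"
      using lin v by (simp add: quot_transport X s' r tmap_ten vec_space_P finite_quot)
    also have "\<dots> = act (quot X r \<union> quot Y r') (quot_map s) (m (quot X r) (quot Y r') (ten (PQ X r) (PQ Y r') v w))"
      by (rule m_natural[OF finite_quot[OF X(1)] finite_quot[OF X(2)] quot_disjoint[OF X(1,2) r X(3)] q ten_in[OF v]])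
    finally have 1: "m (quot (s ` X) (transport s r)) (quot (s ` Y) (transport s r'))
        (ten (PQ (s ` X) (transport s r)) (PQ (s ` Y) (transport s r')) (act (quot X r) (quot_map s) v) (act (quot Y r') (quot_map s) w))
      = act (quot (X \<union> Y) (r \<union> r')) (quot_map s) (m (quot X r) (quot Y r') (ten (PQ X r) (PQ Y r') v w))"
      by (simp add: quot_Un r X)
    show "m' (s ` X) (s ` Y) (tmap (P' X) (P' Y) (P' (s ` X)) (P' (s ` Y))
        (act' X s) (act' Y s) (ten (P' X) (P' Y) (com_in r v) (com_in r' w))) =
      act' (X \<union> Y) s (m' X Y (ten (P' X) (P' Y) (com_in r v) (com_in r' w)))"
      using 1 v
      by (simp add: tmap_ten vec_space_com X fin com_act_linear s' com_in_closed r com_act_in com_mult_ten disj te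
          linear_on_in[OF lin(1)] linear_on_in[OF lin(2)] e s m_quot_closed transport_Un)
  qed
next
  fix X Y Z :: "'a hf set" and w
  assume X: "finite X" "finite Y" "finite Z" "X \<inter> Y = {}" "X \<inter> Z = {}" "Y \<inter> Z = {}"
    and w: "w \<in> vcarrier (P' X \<otimes> P' Y \<otimes> P' Z)"
  have fin: "finite (X \<union> Y)" "finite (Y \<union> Z)" "(X \<union> Y) \<inter> Z = {}" "X \<inter> (Y \<union> Z) = {}" using X by auto
  show "m' (X \<union> Y) Z (tmap (P' X \<otimes> P' Y) (P' Z) (P' (X \<union> Y)) (P' Z) (m' X Y) id w) =
     m' X (Y \<union> Z) (tmap (P' X) (P' Y \<otimes> P' Z) (P' X) (P' (Y \<union> Z)) id (m' Y Z)
        (tassoc (P' X) (P' Y) (P' Z) w))"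
  proof (rule com_ext3[OF X(1-3) _ _ _ w])
    show "linear_on (P' X \<otimes> P' Y \<otimes> P' Z) (P' (X \<union> Y \<union> Z)) (\<lambda>w. m' (X \<union> Y) Z
      (tmap (P' X \<otimes> P' Y) (P' Z) (P' (X \<union> Y)) (P' Z) (m' X Y) id w))"
      unfolding id_def
      by (intro linear_on_comp[OF tmap_linear com_mult_linear] vec_space_tensor vec_space_com com_mult_linear linear_on_id X fin)
    have "linear_on (P' X \<otimes> P' Y \<otimes> P' Z) (P' (X \<union> (Y \<union> Z))) (\<lambda>w. m' X (Y \<union> Z)
      (tmap (P' X) (P' Y \<otimes> P' Z) (P' X) (P' (Y \<union> Z)) id (m' Y Z)
        (tassoc (P' X) (P' Y) (P' Z) w)))"
      unfolding id_def
      by (intro linear_on_comp[OF tassoc_linear linear_on_comp[OF tmap_linear com_mult_linear]]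
          vec_space_tensor vec_space_com com_mult_linear linear_on_id X fin)
    then show "linear_on (P' X \<otimes> P' Y \<otimes> P' Z) (P' (X \<union> Y \<union> Z)) (\<lambda>w. m' X (Y \<union> Z)
      (tmap (P' X) (P' Y \<otimes> P' Z) (P' X) (P' (Y \<union> Z)) id (m' Y Z)
        (tassoc (P' X) (P' Y) (P' Z) w)))" by (simp add: Un_assoc)
  next
    fix r s q u v w
    assume r: "r \<in> equivs X" "s \<in> equivs Y" "q \<in> equivs Z"
      and v: "u \<in> vcarrier (PQ X r)" "v \<in> vcarrier (PQ Y s)" "w \<in> vcarrier (PQ Z q)"
    note e = equivs_Un[OF r(1,2) X(4)] equivs_Un[OF r(2,3) X(6)]
    let ?A = "PQ X r" and ?B = "PQ Y s" and ?C = "PQ Z q"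
    have d: "quot X r \<inter> quot Y s = {}" "quot X r \<inter> quot Z q = {}" "quot Y s \<inter> quot Z q = {}"
      by (rule quot_disjoint[OF X(1,2) r(1,2) X(4)] quot_disjoint[OF X(1,3) r(1,3) X(5)]
          quot_disjoint[OF X(2,3) r(2,3) X(6)])+
    have lin: "linear_on (?A \<otimes> ?B) (P (quot X r \<union> quot Y s)) (m (quot X r) (quot Y s))"
      "linear_on (?B \<otimes> ?C) (P (quot Y s \<union> quot Z q)) (m (quot Y s) (quot Z q))"
      using X d by (auto intro!: m_linear finite_quot)
    have 1: "m (quot (X \<union> Y) (r \<union> s)) (quot Z q) (ten (PQ (X \<union> Y) (r \<union> s)) ?C (m (quot X r) (quot Y s) (ten ?A ?B u v)) w) =
        m (quot X r) (quot (Y \<union> Z) (s \<union> q)) (ten ?A (PQ (Y \<union> Z) (s \<union> q)) u (m (quot Y s) (quot Z q) (ten ?B ?C v w)))"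
      using m_assoc[OF _ _ _ d ten_in[OF ten_in]] lin v X r
      by (simp add: quot_Un finite_quot tmap_ten tassoc_ten vec_space_tensor vec_space_P linear_on_id[folded id_def] ten_in)
    show "m' (X \<union> Y) Z (tmap (P' X \<otimes> P' Y) (P' Z) (P' (X \<union> Y)) (P' Z) (m' X Y) id
        (ten (P' X \<otimes> P' Y) (P' Z) (ten (P' X) (P' Y) (com_in r u) (com_in s v)) (com_in q w))) =
      m' X (Y \<union> Z) (tmap (P' X) (P' Y \<otimes> P' Z) (P' X) (P' (Y \<union> Z)) id (m' Y Z)
        (tassoc (P' X) (P' Y) (P' Z)
        (ten (P' X \<otimes> P' Y) (P' Z) (ten (P' X) (P' Y) (com_in r u) (com_in s v)) (com_in q w))))"
      using 1 v
      by (simp add: tmap_ten tassoc_ten vec_space_com vec_space_tensor X fin com_mult_linear linear_on_id[folded id_def]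
          com_in_closed r ten_in com_mult_ten e m_quot_closed Un_assoc)
  qed
next
  show "com_one one \<in> vcarrier (P' {})" by (rule com_one_closed)
next
  fix X :: "'a hf set" and v assume X: "finite X" and v: "v \<in> vcarrier (P' X)"
  have l: "linear_on (P' {} \<otimes> P' X) (P' X) (m' {} X)"
    "linear_on (P' X \<otimes> P' {}) (P' X) (m' X {})"
    using com_mult_linear[of "{}" X] com_mult_linear[of X "{}"] X by auto
  \<comment> \<open>The empty set has one equivalence, whose quotient is again empty, so
    P[\<emptyset>] is the only summand of P'[\<emptyset>].\<close>
  have o: "one \<in> vcarrier (PQ {} {})" "{} \<in> equivs {}" using one_closed by (simp_all add: quot_empty equivs_empty)
  show "m' {} X (ten (P' {}) (P' X) (com_one one) v) = v"
  proof (rule com_ext[OF X linear_on_comp[OF linear_on_ten(2)[OF com_one_closed] l(1)] linear_on_id _ v])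
    fix r v assume r: "r \<in> equivs X" "v \<in> vcarrier (PQ X r)"
    then show "m' {} X (ten (P' {}) (P' X) (com_one one) (com_in r v)) = com_in r v"
      using com_mult_ten[OF _ X _ o(2) r(1) o(1) r(2)] m_one_left[OF finite_quot[OF X] r(2)]
      by (simp add: com_one_def quot_empty)
  qed
  show "m' X {} (ten (P' X) (P' {}) v (com_one one)) = v"
  proof (rule com_ext[OF X linear_on_comp[OF linear_on_ten(1)[OF com_one_closed] l(2)] linear_on_id _ v])
    fix r v assume r: "r \<in> equivs X" "v \<in> vcarrier (PQ X r)"
    then show "m' X {} (ten (P' X) (P' {}) (com_in r v) (com_one one)) = com_in r v"
      using com_mult_ten[OF X _ _ r(1) o(2) r(2) o(1)] m_one_right[OF finite_quot[OF X] r(2)]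
      by (simp add: com_one_def quot_empty)
  qed
qed

end

section \<open>The coproduct\<close>

lemma restrict_restrict: "Y \<subseteq> X \<Longrightarrow> r \<inter> X \<times> X \<inter> Y \<times> Y = r \<inter> Y \<times> Y"
  by (simp add: Int_assoc Int_absorb1 Sigma_mono)

text \<open>In the bialgebra axiom the blocks are the intersections of the two decompositions. A
  relation on \<open>A \<union> B\<close> does not reach \<open>C \<union> E\<close>, so cutting the
  union along the other decomposition cuts each part separately.\<close>

lemma four_blocks:
  assumes r: "r \<subseteq> (A \<union> B) \<times> (A \<union> B)" and s: "s \<subseteq> (C \<union> E) \<times> (C \<union> E)"
    and disj: "(A \<union> B) \<inter> (C \<union> E) = {}"
  shows "(r \<union> s) \<inter> (A \<union> C) \<times> (A \<union> C) = r \<inter> A \<times> A \<union> s \<inter> C \<times> C"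
    and "(r \<union> s) \<inter> (B \<union> E) \<times> (B \<union> E) = r \<inter> B \<times> B \<union> s \<inter> E \<times> E"
    and "splits (r \<union> s) (A \<union> C) (B \<union> E) \<longleftrightarrow> splits r A B \<and> splits s C E"
proof -
  have 1: "r \<inter> (A \<union> C) \<times> (A \<union> C) = r \<inter> A \<times> A" "r \<inter> (B \<union> E) \<times> (B \<union> E) = r \<inter> B \<times> B"
    using r disj by blast+
  have 2: "s \<inter> (A \<union> C) \<times> (A \<union> C) = s \<inter> C \<times> C" "s \<inter> (B \<union> E) \<times> (B \<union> E) = s \<inter> E \<times> E"
    using s disj by blast+
  show 3: "(r \<union> s) \<inter> (A \<union> C) \<times> (A \<union> C) = r \<inter> A \<times> A \<union> s \<inter> C \<times> C"
    "(r \<union> s) \<inter> (B \<union> E) \<times> (B \<union> E) = r \<inter> B \<times> B \<union> s \<inter> E \<times> E"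
    by (simp_all only: Int_Un_distrib2 1 2)
  have rs: "r \<inter> s = {}" using r s disj by blast
  have "splits (r \<union> s) (A \<union> C) (B \<union> E) \<longleftrightarrow> r \<union> s = (r \<inter> A \<times> A \<union> r \<inter> B \<times> B) \<union> (s \<inter> C \<times> C \<union> s \<inter> E \<times> E)"
    unfolding splits_def 3 by (simp only: Un_ac)
  also have "\<dots> \<longleftrightarrow> r = r \<inter> A \<times> A \<union> r \<inter> B \<times> B \<and> s = s \<inter> C \<times> C \<union> s \<inter> E \<times> E" using rs by blast
  finally show "splits (r \<union> s) (A \<union> C) (B \<union> E) \<longleftrightarrow> splits r A B \<and> splits s C E" by (simp only: splits_def)
qed

text \<open>Either order of cutting asks that no related pair joins different blocks, so the two
  sides of coassociativity vanish on the same summands.\<close>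

lemma splits_three:
  assumes "X \<inter> Y = {}" "X \<inter> Z = {}" "Y \<inter> Z = {}"
  shows "splits r (X \<union> Y) Z \<and> splits (r \<inter> (X \<union> Y) \<times> (X \<union> Y)) X Y \<longleftrightarrow>
      r \<subseteq> X \<times> X \<union> Y \<times> Y \<union> Z \<times> Z"
    and "splits r X (Y \<union> Z) \<and> splits (r \<inter> (Y \<union> Z) \<times> (Y \<union> Z)) Y Z \<longleftrightarrow>
      r \<subseteq> X \<times> X \<union> Y \<times> Y \<union> Z \<times> Z"
proof -
  have sub: "splits q U W \<longleftrightarrow> q \<subseteq> U \<times> U \<union> W \<times> W" for q U W
    unfolding splits_def by auto
  have d: "Z \<times> Z \<inter> (X \<union> Y) \<times> (X \<union> Y) = {}" "X \<times> X \<inter> (Y \<union> Z) \<times> (Y \<union> Z) = {}" using assms by auto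
  have m: "U \<times> U \<union> W \<times> W \<subseteq> (U \<union> W) \<times> (U \<union> W)" for U W :: "'a set" by auto
  show "splits r (X \<union> Y) Z \<and> splits (r \<inter> (X \<union> Y) \<times> (X \<union> Y)) X Y \<longleftrightarrow> r \<subseteq> X \<times> X \<union> Y \<times> Y \<union> Z \<times> Z"
    unfolding sub using d(1) m[of X Y] by (intro iffI conjI subsetI) (fast | blast)+
  show "splits r X (Y \<union> Z) \<and> splits (r \<inter> (Y \<union> Z) \<times> (Y \<union> Z)) Y Z \<longleftrightarrow> r \<subseteq> X \<times> X \<union> Y \<times> Y \<union> Z \<times> Z"
    unfolding sub using d(2) m[of Y Z] by (intro iffI conjI subsetI) (fast | blast)+
qed

locale hf_twisted_coalgebra = hf_species P act + twisted_coalgebra P act D counit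
  for P :: "'a hf set \<Rightarrow> ('k::field, 'v::ab_group_add) kspace" and act D counit
begin

abbreviation D' where "D' \<equiv> com_comult P D"
abbreviation counit' where "counit' \<equiv> com_counit counit"

lemma D_quot_linear:
  assumes X: "finite X" "finite Y" "X \<inter> Y = {}" and r: "r \<in> equivs (X \<union> Y)" "splits r X Y"
  shows "linear_on (PQ (X \<union> Y) r) (PQ X (r \<inter> X \<times> X) \<otimes> PQ Y (r \<inter> Y \<times> Y))
    (D (quot X (r \<inter> X \<times> X)) (quot Y (r \<inter> Y \<times> Y)))"
proof -
  have e: "r \<inter> X \<times> X \<in> equivs X" "r \<inter> Y \<times> Y \<in> equivs Y" using equivs_restrict[OF r(1)] by auto
  show ?thesis
    unfolding quot_restrict_splits[OF r X(3)]
    by (rule D_linear[OF finite_quot[OF X(1)] finite_quot[OF X(2)] quot_disjoint[OF X(1,2) e X(3)]])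
qed

text \<open>Isolates the component of \<open>D'\<close> on one summand, so that \<open>D'\<close>
  has the shape of a family of linear maps required by \<open>com_family_linear\<close> and
  \<open>com_family_in\<close>.\<close>

definition com_comult_summand where
  "com_comult_summand X Y r v = (if splits r X Y
     then in2 X (r \<inter> X \<times> X) Y (r \<inter> Y \<times> Y) (D (quot X (r \<inter> X \<times> X)) (quot Y (r \<inter> Y \<times> Y)) v)
     else 0)"

lemma com_comult_eq: "D' X Y = (\<lambda>f. \<Sum>r\<in>equivs (X \<union> Y). com_comult_summand X Y r (f r))"
  by (simp add: com_comult_def com_comult_summand_def fun_eq_iff splits_def Let_def)

lemma com_comult_summand_linear:
  assumes X: "finite X" "finite Y" "X \<inter> Y = {}" and r: "r \<in> equivs (X \<union> Y)"
  shows "linear_on (PQ (X \<union> Y) r) (P' X \<otimes> P' Y) (com_comult_summand X Y r)"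
proof (cases "splits r X Y")
  case True
  have e: "r \<inter> X \<times> X \<in> equivs X" "r \<inter> Y \<times> Y \<in> equivs Y" using equivs_restrict[OF r(1)] by auto
  show ?thesis unfolding com_comult_summand_def if_P[OF True]
    by (intro linear_on_comp[OF D_quot_linear tmap_linear] com_in_linear vec_space_com vec_space_P_quot X r e True)
next
  case False
  then show ?thesis
    unfolding com_comult_summand_def if_not_P[OF False]
    by (intro linear_on_const0 vec_space_tensor vec_space_com X)
qed

lemma com_comult_linear:
  assumes "finite X" "finite Y" "X \<inter> Y = {}"
  shows "linear_on (P' (X \<union> Y)) (P' X \<otimes> P' Y) (D' X Y)"
  unfolding com_comult_eq using assms
  by (intro com_family_linear vec_space_tensor vec_space_com com_comult_summand_linear)

lemma com_comult_in:
  assumes X: "finite X" "finite Y" "X \<inter> Y = {}" and r: "r \<in> equivs (X \<union> Y)"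
  shows "D' X Y (com_in r v) = (if splits r X Y
     then in2 X (r \<inter> X \<times> X) Y (r \<inter> Y \<times> Y) (D (quot X (r \<inter> X \<times> X)) (quot Y (r \<inter> Y \<times> Y)) v)
     else 0)"
  unfolding com_comult_eq com_comult_summand_def[symmetric]
  by (rule com_family_in[OF _ com_comult_summand_linear[OF X] r]) (use X in auto)

text \<open>Treats a coproduct applied to one factor of a tensor that already lies in a product of
  summands: a second \<open>D'\<close>, or \<open>D'\<close> after \<open>delta'\<close>. The map
  \<open>g\<close> stands for the inclusion of the other factor. Either the inclusions come out on
  the left of \<open>D\<close>, or the whole map is zero.\<close>

lemma com_comult_tmap:
  fixes W :: "('k, 'w::ab_group_add) kspace" and W' :: "('k, 'w2::ab_group_add) kspace"
  assumes X: "finite X" "finite Y" "X \<inter> Y = {}" and r: "r \<in> equivs (X \<union> Y)"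
    and W: "vec_space W" "vec_space W'" "linear_on W W' g"
  shows "t \<in> vcarrier (PQ (X \<union> Y) r \<otimes> W) \<Longrightarrow>
    tmap (PQ (X \<union> Y) r) W (P' X \<otimes> P' Y) W' (\<lambda>v. D' X Y (com_in r v)) g t =
    (if splits r X Y
     then tmap (PQ X (r \<inter> X \<times> X) \<otimes> PQ Y (r \<inter> Y \<times> Y)) W (P' X \<otimes> P' Y) W'
       (in2 X (r \<inter> X \<times> X) Y (r \<inter> Y \<times> Y)) g
       (tmap (PQ (X \<union> Y) r) W (PQ X (r \<inter> X \<times> X) \<otimes> PQ Y (r \<inter> Y \<times> Y)) W
         (D (quot X (r \<inter> X \<times> X)) (quot Y (r \<inter> Y \<times> Y))) id t)
     else 0)" (is "_ \<Longrightarrow> ?left")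
   and "t' \<in> vcarrier (W \<otimes> PQ (X \<union> Y) r) \<Longrightarrow>
    tmap W (PQ (X \<union> Y) r) W' (P' X \<otimes> P' Y) g (\<lambda>v. D' X Y (com_in r v)) t' =
    (if splits r X Y
     then tmap W (PQ X (r \<inter> X \<times> X) \<otimes> PQ Y (r \<inter> Y \<times> Y)) W' (P' X \<otimes> P' Y) g
       (in2 X (r \<inter> X \<times> X) Y (r \<inter> Y \<times> Y))
       (tmap W (PQ (X \<union> Y) r) W (PQ X (r \<inter> X \<times> X) \<otimes> PQ Y (r \<inter> Y \<times> Y))
         id (D (quot X (r \<inter> X \<times> X)) (quot Y (r \<inter> Y \<times> Y))) t')
     else 0)" (is "_ \<Longrightarrow> ?right")
proof -
  have XY: "finite (X \<union> Y)" using X by simp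
  have e: "r \<inter> X \<times> X \<in> equivs X" "r \<inter> Y \<times> Y \<in> equivs Y" using equivs_restrict[OF r(1)] by auto
  note vs = vec_space_P_quot[OF XY] vec_space_P_quot[OF X(1)] vec_space_P_quot[OF X(2)]
    vec_space_com[OF X(1)] vec_space_com[OF X(2)] vec_space_tensor W
  note lin = com_in_linear X e r tmap_linear D_quot_linear linear_on_id
  show ?left if "t \<in> vcarrier (PQ (X \<union> Y) r \<otimes> W)"
  proof (cases "splits r X Y")
    case True
    show ?thesis
      unfolding com_comult_in[OF X r] if_P[OF True] id_def
      by (rule tmap_tmap[symmetric]) (intro vs lin True that)+
  next
    case False
    show ?thesis
      unfolding com_comult_in[OF X r] if_not_P[OF False]
      by (rule tmap_zero) (intro vs that)+
  qed
  show ?right if "t' \<in> vcarrier (W \<otimes> PQ (X \<union> Y) r)"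
  proof (cases "splits r X Y")
    case True
    show ?thesis
      unfolding com_comult_in[OF X r] if_P[OF True] id_def
      by (rule tmap_tmap[symmetric]) (intro vs lin True that)+
  next
    case False
    show ?thesis
      unfolding com_comult_in[OF X r] if_not_P[OF False]
      by (rule tmap_zero) (intro vs that)+
  qed
qed

lemma com_counit_linear: "linear_on (P' {}) scalars counit'"
proof -
  have "linear_on (PQ {} {}) scalars counit" using counit_linear by (simp add: quot_empty)
  from linear_on_comp[OF com_component_linear this] show ?thesis
    unfolding com_counit_def by (simp add: equivs_empty)
qed

lemma com_comult_natural:
  assumes X: "finite X" "finite Y" "X \<inter> Y = {}" and s: "inj_on s (X \<union> Y)" and v: "v \<in> vcarrier (P' (X \<union> Y))"
  shows "D' (s ` X) (s ` Y) (act' (X \<union> Y) s v) =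
    tmap (P' X) (P' Y) (P' (s ` X)) (P' (s ` Y)) (act' X s) (act' Y s)
      (D' X Y v)"
proof -
  have s': "inj_on s X" "inj_on s Y" using s by (auto simp: inj_on_Un)
  have fin: "finite (X \<union> Y)" "finite (s ` X)" "finite (s ` Y)" using X by auto
  have disj: "s ` X \<inter> s ` Y = {}" using s X(3) by (auto simp: inj_on_Un)
  show ?thesis
  proof (rule com_ext[OF fin(1) _ _ _ v])
    show "linear_on (P' (X \<union> Y)) (P' (s ` X) \<otimes> P' (s ` Y))
        (\<lambda>v. D' (s ` X) (s ` Y) (act' (X \<union> Y) s v))"
      using linear_on_comp[OF com_act_linear[OF fin(1) s]] com_comult_linear[OF fin(2,3) disj] by (simp add: image_Un)
    show "linear_on (P' (X \<union> Y)) (P' (s ` X) \<otimes> P' (s ` Y))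
        (\<lambda>v. tmap (P' X) (P' Y) (P' (s ` X)) (P' (s ` Y)) (act' X s) (act' Y s)
          (D' X Y v))"
      by (intro linear_on_comp[OF com_comult_linear tmap_linear] vec_space_com com_act_linear X fin s')
  next
    fix r v assume r: "r \<in> equivs (X \<union> Y)" and v: "v \<in> vcarrier (PQ (X \<union> Y) r)"
    let ?rX = "r \<inter> X \<times> X" and ?rY = "r \<inter> Y \<times> Y"
    have e: "?rX \<in> equivs X" "?rY \<in> equivs Y" using equivs_restrict[OF r] by auto
    note te = transport_equivs[OF s r] transport_equivs[OF s'(1) e(1)] transport_equivs[OF s'(2) e(2)]
    have tr: "transport s r \<inter> s ` X \<times> s ` X = transport s ?rX" "transport s r \<inter> s ` Y \<times> s ` Y = transport s ?rY"
      using transport_restrict[OF s equivsD(1)[OF r]] by auto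
    have te0: "transport s r \<in> equivs (s ` X \<union> s ` Y)" using te(1) by (simp add: image_Un)
    note vs = vec_space_P_quot vec_space_com X fin
    show "D' (s ` X) (s ` Y) (act' (X \<union> Y) s (com_in r v)) =
      tmap (P' X) (P' Y) (P' (s ` X)) (P' (s ` Y)) (act' X s) (act' Y s)
        (D' X Y (com_in r v))"
    \<comment> \<open>Transport respects splitting, so both sides vanish together.\<close>
    proof (cases "splits r X Y")
      case False
      have "linear_on (P' X \<otimes> P' Y) (P' (s ` X) \<otimes> P' (s ` Y))
          (tmap (P' X) (P' Y) (P' (s ` X)) (P' (s ` Y)) (act' X s) (act' Y s))"
        by (intro tmap_linear vs com_act_linear s')
      from linear_on_zero[OF vec_space_tensor[OF vec_space_com[OF X(1)] vec_space_com[OF X(2)]] this]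
      show ?thesis
        unfolding com_act_in[OF fin(1) s r] com_comult_in[OF fin(2,3) disj te0] com_comult_in[OF X r]
          transport_splits[OF s r X(3)] if_not_P[OF False] ..
    next
      case True
      let ?A = "PQ X ?rX" and ?B = "PQ Y ?rY"
      let ?A' = "PQ (s ` X) (transport s ?rX)" and ?B' = "PQ (s ` Y) (transport s ?rY)"
      let ?a = "act (quot X ?rX) (quot_map s)" and ?b = "act (quot Y ?rY) (quot_map s)"
      let ?d = "D (quot X ?rX) (quot Y ?rY) v"
      have d: "?d \<in> vcarrier (?A \<otimes> ?B)" by (rule linear_on_in[OF D_quot_linear[OF X r True] v])
      note q = quot_restrict_splits[OF r True X(3)]
      have "inj_on (quot_map s) (quot X ?rX \<union> quot Y ?rY)"
        using inj_on_quot_map[OF s fin(1) r] by (simp add: q)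
      from D_natural[OF finite_quot[OF X(1)] finite_quot[OF X(2)] quot_disjoint[OF X(1,2) e X(3)] this] v
      have nat: "D (quot (s ` X) (transport s ?rX)) (quot (s ` Y) (transport s ?rY)) (act (quot (X \<union> Y) r) (quot_map s) v) =
          tmap ?A ?B ?A' ?B' ?a ?b ?d"
        by (simp add: q quot_transport X s' e)
      have "D' (s ` X) (s ` Y) (act' (X \<union> Y) s (com_in r v)) =
          tmap ?A' ?B' (P' (s ` X)) (P' (s ` Y)) (com_in (transport s ?rX)) (com_in (transport s ?rY))
            (tmap ?A ?B ?A' ?B' ?a ?b ?d)"
        unfolding com_act_in[OF fin(1) s r] com_comult_in[OF fin(2,3) disj te0] tr transport_splits[OF s r X(3)]
          if_P[OF True] nat ..
      also have "\<dots> = tmap ?A ?B (P' (s ` X)) (P' (s ` Y))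
          (\<lambda>x. com_in (transport s ?rX) (?a x)) (\<lambda>y. com_in (transport s ?rY) (?b y)) ?d"
        by (rule tmap_tmap) (intro vs act_quot_linear s' e com_in_linear te d)+
      also have "\<dots> = tmap ?A ?B (P' (s ` X)) (P' (s ` Y))
          (\<lambda>x. act' X s (com_in ?rX x)) (\<lambda>y. act' Y s (com_in ?rY y)) ?d"
        using X s' e by (simp add: com_act_in)
      also have "\<dots> = tmap (P' X) (P' Y) (P' (s ` X)) (P' (s ` Y)) (act' X s) (act' Y s)
          (tmap ?A ?B (P' X) (P' Y) (com_in ?rX) (com_in ?rY) ?d)"
        by (rule tmap_tmap[symmetric]) (intro vs com_act_linear s' e com_in_linear d)+
      finally show ?thesis unfolding com_comult_in[OF X r] if_P[OF True] .
    qed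
  qed
qed

lemma com_comult_coassoc:
  assumes X: "finite X" "finite Y" "finite Z" "X \<inter> Y = {}" "X \<inter> Z = {}" "Y \<inter> Z = {}"
    and v: "v \<in> vcarrier (P' (X \<union> Y \<union> Z))"
  shows "tassoc (P' X) (P' Y) (P' Z)
      (tmap (P' (X \<union> Y)) (P' Z) (P' X \<otimes> P' Y) (P' Z) (D' X Y) id
        (D' (X \<union> Y) Z v)) =
    tmap (P' X) (P' (Y \<union> Z)) (P' X) (P' Y \<otimes> P' Z) id (D' Y Z)
      (D' X (Y \<union> Z) v)"
proof -
  let ?QX = "P' X" and ?QY = "P' Y" and ?QZ = "P' Z"
  have fin: "finite (X \<union> Y)" "finite (Y \<union> Z)" "finite (X \<union> Y \<union> Z)" and disj: "(X \<union> Y) \<inter> Z = {}" "X \<inter> (Y \<union> Z) = {}" using X by auto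
  note vs = vec_space_P_quot vec_space_com X fin vec_space_tensor
  note lid = linear_on_id[folded id_def]
  have tl: "linear_on (P' (X \<union> Y) \<otimes> ?QZ) (?QX \<otimes> (?QY \<otimes> ?QZ))
      (\<lambda>t. tassoc ?QX ?QY ?QZ (tmap (P' (X \<union> Y)) ?QZ (?QX \<otimes> ?QY) ?QZ (D' X Y) id t))"
    by (intro linear_on_comp[OF tmap_linear tassoc_linear] vs com_comult_linear lid)
  have tr: "linear_on (?QX \<otimes> P' (Y \<union> Z)) (?QX \<otimes> (?QY \<otimes> ?QZ))
      (tmap ?QX (P' (Y \<union> Z)) ?QX (?QY \<otimes> ?QZ) id (D' Y Z))"
    by (intro tmap_linear vs com_comult_linear lid)
  show ?thesis
  proof (rule com_ext[OF fin(3) _ _ _ v])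
    show "linear_on (P' (X \<union> Y \<union> Z)) (?QX \<otimes> (?QY \<otimes> ?QZ)) (\<lambda>v. tassoc ?QX ?QY ?QZ
        (tmap (P' (X \<union> Y)) ?QZ (?QX \<otimes> ?QY) ?QZ (D' X Y) id (D' (X \<union> Y) Z v)))"
      by (intro linear_on_comp[OF com_comult_linear tl] fin X disj)
    have "linear_on (P' (X \<union> (Y \<union> Z))) (?QX \<otimes> (?QY \<otimes> ?QZ)) (\<lambda>v. 
        tmap ?QX (P' (Y \<union> Z)) ?QX (?QY \<otimes> ?QZ) id (D' Y Z) (D' X (Y \<union> Z) v))"
      by (intro linear_on_comp[OF com_comult_linear tr] fin X disj)
    then show "linear_on (P' (X \<union> Y \<union> Z)) (?QX \<otimes> (?QY \<otimes> ?QZ)) (\<lambda>v. 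
        tmap ?QX (P' (Y \<union> Z)) ?QX (?QY \<otimes> ?QZ) id (D' Y Z) (D' X (Y \<union> Z) v))"
      by (simp add: Un_assoc)
  next
    fix r v assume r: "r \<in> equivs (X \<union> Y \<union> Z)" and v: "v \<in> vcarrier (PQ (X \<union> Y \<union> Z) r)"
    let ?XY = "r \<inter> (X \<union> Y) \<times> (X \<union> Y)" and ?YZ = "r \<inter> (Y \<union> Z) \<times> (Y \<union> Z)"
    let ?rX = "r \<inter> X \<times> X" and ?rY = "r \<inter> Y \<times> Y" and ?rZ = "r \<inter> Z \<times> Z"
    let ?PX = "PQ X ?rX" and ?PY = "PQ Y ?rY" and ?PZ = "PQ Z ?rZ"
    let ?PXY = "PQ (X \<union> Y) ?XY" and ?PYZ = "PQ (Y \<union> Z) ?YZ"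
    have r': "r \<in> equivs (X \<union> (Y \<union> Z))" using r by (simp add: Un_assoc)
    have e: "?rX \<in> equivs X" "?rY \<in> equivs Y" "?rZ \<in> equivs Z" "?XY \<in> equivs (X \<union> Y)" "?YZ \<in> equivs (Y \<union> Z)"
      by (rule equivs_restrict[OF r], blast)+
    have rr: "?XY \<inter> X \<times> X = ?rX" "?XY \<inter> Y \<times> Y = ?rY" "?YZ \<inter> Y \<times> Y = ?rY" "?YZ \<inter> Z \<times> Z = ?rZ" by (simp_all add: restrict_restrict)
    let ?dl = "D (quot (X \<union> Y) ?XY) (quot Z ?rZ) v" and ?dr = "D (quot X ?rX) (quot (Y \<union> Z) ?YZ) v"
    let ?in3 = "tmap ?PX (?PY \<otimes> ?PZ) ?QX (?QY \<otimes> ?QZ) (com_in ?rX) (tmap ?PY ?PZ ?QY ?QZ (com_in ?rY) (com_in ?rZ))"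
    \<comment> \<open>Both sides are brought to one shape: the triple inclusion of the corresponding
      composite for \<open>P\<close> if all cuts succeed, and zero otherwise. The conditions are
      then compared by \<open>splits_three\<close>.\<close>
    have L: "tassoc ?QX ?QY ?QZ (tmap (P' (X \<union> Y)) ?QZ (?QX \<otimes> ?QY) ?QZ (D' X Y) id
          (D' (X \<union> Y) Z (com_in r v))) =
        (if splits r (X \<union> Y) Z \<and> splits ?XY X Y then
          ?in3 (tassoc ?PX ?PY ?PZ (tmap ?PXY ?PZ (?PX \<otimes> ?PY) ?PZ (D (quot X ?rX) (quot Y ?rY)) id ?dl)) else 0)"
    proof (cases "splits r (X \<union> Y) Z")
      case False
      then show ?thesis
        using linear_on_zero[OF vec_space_tensor tl] by (simp add: com_comult_in[OF fin(1) X(3) disj(1) r] vs)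
    next
      case sp: True
      note dl = linear_on_in[OF D_quot_linear[OF fin(1) X(3) disj(1) r sp] v]
      have 1: "tmap (P' (X \<union> Y)) ?QZ (?QX \<otimes> ?QY) ?QZ (D' X Y) id (D' (X \<union> Y) Z (com_in r v)) =
          tmap ?PXY ?PZ (?QX \<otimes> ?QY) ?QZ (\<lambda>x. D' X Y (com_in ?XY x)) (\<lambda>z. com_in ?rZ z) ?dl"
        unfolding com_comult_in[OF fin(1) X(3) disj(1) r] if_P[OF sp] id_def
        by (rule tmap_tmap) (intro vs com_in_linear e com_comult_linear linear_on_id dl)+
      note 2 = trans[OF 1 com_comult_tmap(1)[OF X(1,2,4) e(4) vec_space_P_quot[OF X(3)] vec_space_com[OF X(3)] com_in_linear[OF X(3) e(3)] dl, unfolded rr]]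
      show ?thesis
      proof (cases "splits ?XY X Y")
        case False
        have "linear_on (?QX \<otimes> ?QY \<otimes> ?QZ) (?QX \<otimes> (?QY \<otimes> ?QZ)) (tassoc ?QX ?QY ?QZ)" by (intro tassoc_linear vs)
        then have "tassoc ?QX ?QY ?QZ 0 = 0" by (rule linear_on_zero[rotated]) (intro vs)
        then show ?thesis using 2 False by (simp only: if_False simp_thms)
      next
        case sp2: True
        have "linear_on (?PXY \<otimes> ?PZ) (?PX \<otimes> ?PY \<otimes> ?PZ) (tmap ?PXY ?PZ (?PX \<otimes> ?PY) ?PZ (D (quot X ?rX) (quot Y ?rY)) id)"
          using D_quot_linear[OF X(1,2,4) e(4) sp2] by (intro tmap_linear vs lid) (simp add: rr)
        from linear_on_in[OF this dl]
        have "tassoc ?QX ?QY ?QZ (tmap (?PX \<otimes> ?PY) ?PZ (?QX \<otimes> ?QY) ?QZ (tmap ?PX ?PY ?QX ?QY (com_in ?rX) (com_in ?rY)) (com_in ?rZ)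
             (tmap ?PXY ?PZ (?PX \<otimes> ?PY) ?PZ (D (quot X ?rX) (quot Y ?rY)) id ?dl)) =
            ?in3 (tassoc ?PX ?PY ?PZ (tmap ?PXY ?PZ (?PX \<otimes> ?PY) ?PZ (D (quot X ?rX) (quot Y ?rY)) id ?dl))"
          by (rule tassoc_tmap[rotated -1]) (intro vs com_in_linear e)+
        then show ?thesis using 2 sp sp2 by (simp only: if_True simp_thms)
      qed
    qed
    have R: "tmap ?QX (P' (Y \<union> Z)) ?QX (?QY \<otimes> ?QZ) id (D' Y Z) (D' X (Y \<union> Z) (com_in r v)) =
        (if splits r X (Y \<union> Z) \<and> splits ?YZ Y Z then
          ?in3 (tmap ?PX ?PYZ ?PX (?PY \<otimes> ?PZ) id (D (quot Y ?rY) (quot Z ?rZ)) ?dr) else 0)"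
    proof (cases "splits r X (Y \<union> Z)")
      case False
      then show ?thesis
        using linear_on_zero[OF vec_space_tensor tr] by (simp add: com_comult_in[OF X(1) fin(2) disj(2) r'] vs)
    next
      case sp: True
      note dr = linear_on_in[OF D_quot_linear[OF X(1) fin(2) disj(2) r' sp] v[unfolded Un_assoc]]
      have 1: "tmap ?QX (P' (Y \<union> Z)) ?QX (?QY \<otimes> ?QZ) id (D' Y Z) (D' X (Y \<union> Z) (com_in r v)) =
          tmap ?PX ?PYZ ?QX (?QY \<otimes> ?QZ) (\<lambda>z. com_in ?rX z) (\<lambda>x. D' Y Z (com_in ?YZ x)) ?dr"
        unfolding com_comult_in[OF X(1) fin(2) disj(2) r'] if_P[OF sp] id_def
        by (rule tmap_tmap) (intro vs com_in_linear e com_comult_linear linear_on_id dr)+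
      note 2 = trans[OF 1 com_comult_tmap(2)[OF X(2,3,6) e(5) vec_space_P_quot[OF X(1)] vec_space_com[OF X(1)] com_in_linear[OF X(1) e(1)] dr, unfolded rr]]
      show ?thesis using 2 sp by (simp only: if_True simp_thms)
    qed
    \<comment> \<open>When all blocks are separated, each quotient is the union of the quotients of
      its blocks, and coassociativity of \<open>P\<close> for these three finite sets
      concludes.\<close>
    show "tassoc ?QX ?QY ?QZ (tmap (P' (X \<union> Y)) ?QZ (?QX \<otimes> ?QY) ?QZ (D' X Y) id
          (D' (X \<union> Y) Z (com_in r v))) =
      tmap ?QX (P' (Y \<union> Z)) ?QX (?QY \<otimes> ?QZ) id (D' Y Z) (D' X (Y \<union> Z) (com_in r v))"
    proof (cases "r \<subseteq> X \<times> X \<union> Y \<times> Y \<union> Z \<times> Z")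
      case False
      then show ?thesis unfolding L R splits_three[OF X(4-6)] by (simp only: if_False)
    next
      case True
      then have sp: "splits r (X \<union> Y) Z" "splits ?XY X Y" "splits r X (Y \<union> Z)" "splits ?YZ Y Z"
        using splits_three[OF X(4-6), of r] by (simp_all only: simp_thms)
      have q: "quot (X \<union> Y) ?XY = quot X ?rX \<union> quot Y ?rY" "quot (Y \<union> Z) ?YZ = quot Y ?rY \<union> quot Z ?rZ"
        "quot (X \<union> Y \<union> Z) r = quot X ?rX \<union> quot Y ?rY \<union> quot Z ?rZ"
        using quot_restrict_splits[OF e(4) sp(2) X(4)] quot_restrict_splits[OF e(5) sp(4) X(6)]
          quot_restrict_splits[OF r sp(1) disj(1)] by (simp_all only: rr)
      have "tassoc ?PX ?PY ?PZ (tmap ?PXY ?PZ (?PX \<otimes> ?PY) ?PZ (D (quot X ?rX) (quot Y ?rY)) id ?dl) =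
          tmap ?PX ?PYZ ?PX (?PY \<otimes> ?PZ) id (D (quot Y ?rY) (quot Z ?rZ)) ?dr"
        unfolding q using v[unfolded q]
        by (intro D_coassoc finite_quot X quot_disjoint e)
      then show ?thesis unfolding L R splits_three[OF X(4-6)] if_P[OF True] by (simp only:)
    qed
  qed
qed

lemma com_comult_counit:
  assumes X: "finite X" and v: "v \<in> vcarrier (P' X)"
  shows "contract_left (P' {}) (P' X) counit' (D' {} X v) = v"
    and "contract_right (P' X) (P' {}) counit' (D' X {} v) = v"
proof -
  have E: "finite {}" "{} \<in> equivs {}" by (simp_all add: equivs_empty)
  note Q = vec_space_com[OF E(1)] vec_space_com[OF X]
  note l = com_comult_linear[OF E(1) X, simplified] com_comult_linear[OF X E(1), simplified]
  have cc: "(\<lambda>v. counit' (com_in {} v)) = counit" by (simp add: com_counit_def com_in_def)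
  show "contract_left (P' {}) (P' X) counit' (D' {} X v) = v"
  proof (rule com_ext[OF X linear_on_comp[OF l(1) contract_left_linear[OF Q com_counit_linear]] linear_on_id _ v])
    fix r v assume r: "r \<in> equivs X" and v: "v \<in> vcarrier (PQ X r)"
    \<comment> \<open>With an empty block every relation splits, so no summand is lost.\<close>
    have rX: "r \<inter> X \<times> X = r" "splits r {} X" using equivsD(1)[OF r] by (auto simp: splits_def)
    have d: "D (quot {} {}) (quot X r) v \<in> vcarrier (PQ {} {} \<otimes> PQ X r)"
      using linear_on_in[OF D_quot_linear[OF E(1) X, of r]] r v by (simp add: rX)
    have "D' {} X (com_in r v) = in2 {} {} X r (D (quot {} {}) (quot X r) v)"
      using com_comult_in[OF E(1) X, of r v] r by (simp add: rX)
    then show "contract_left (P' {}) (P' X) counit' (D' {} X (com_in r v)) = com_in r v"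
      using contract_left_tmap[OF vec_space_P_quot[OF E(1)] vec_space_P_quot[OF X] Q com_in_linear[OF E] com_in_linear[OF X r] com_counit_linear d]
        D_counit_left[OF finite_quot[OF X] v] by (simp add: cc quot_empty)
  qed
  show "contract_right (P' X) (P' {}) counit' (D' X {} v) = v"
  proof (rule com_ext[OF X linear_on_comp[OF l(2) contract_right_linear[OF Q(2,1) com_counit_linear]] linear_on_id _ v])
    fix r v assume r: "r \<in> equivs X" and v: "v \<in> vcarrier (PQ X r)"
    have rX: "r \<inter> X \<times> X = r" "splits r X {}" using equivsD(1)[OF r] by (auto simp: splits_def)
    have d: "D (quot X r) (quot {} {}) v \<in> vcarrier (PQ X r \<otimes> PQ {} {})"
      using linear_on_in[OF D_quot_linear[OF X E(1), of r]] r v by (simp add: rX)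
    have "D' X {} (com_in r v) = in2 X r {} {} (D (quot X r) (quot {} {}) v)"
      using com_comult_in[OF X E(1), of r v] r by (simp add: rX)
    then show "contract_right (P' X) (P' {}) counit' (D' X {} (com_in r v)) = com_in r v"
      using contract_right_tmap[OF vec_space_P_quot[OF X] vec_space_P_quot[OF E(1)] Q(2,1) com_in_linear[OF X r] com_in_linear[OF E] com_counit_linear d]
        D_counit_right[OF finite_quot[OF X] v] by (simp add: cc quot_empty)
  qed
qed

lemma twisted_coalgebra_com: "twisted_coalgebra P' act' D' counit'"
  by (intro twisted_coalgebra.intro twisted_coalgebra_axioms.intro species_com com_comult_linear com_comult_natural
      com_comult_coassoc com_counit_linear com_comult_counit)

end

section \<open>Compatibility of product and coproduct\<close>

locale hf_twisted_bialgebra = twisted_bialgebra P act m one D counit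
  for P :: "'a hf set \<Rightarrow> ('k::field, 'v::ab_group_add) kspace" and act m one D counit

sublocale hf_twisted_bialgebra \<subseteq> hf_twisted_algebra P act m one
  by (simp add: hf_twisted_algebra_def hf_species_def species_axioms twisted_algebra_axioms)

sublocale hf_twisted_bialgebra \<subseteq> hf_twisted_coalgebra P act D counit
  by (simp add: hf_twisted_coalgebra_def hf_species_def species_axioms twisted_coalgebra_axioms)

context hf_twisted_bialgebra
begin

text \<open>The axiom is stated with intersections of two decompositions. Taking the four blocks
  themselves as data is better suited to quotients, which are unions of the quotients of the blocks,
  with no intersections of quotients to be computed.\<close>

lemma D_m_blocks:
  assumes fin: "finite A" "finite B" "finite C" "finite E" and disj: "A \<inter> B = {}" "C \<inter> E = {}" "(A \<union> B) \<inter> (C \<union> E) = {}"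
    and t: "t \<in> vcarrier (P (A \<union> B) \<otimes> P (C \<union> E))"
  shows "D (A \<union> C) (B \<union> E) (m (A \<union> B) (C \<union> E) t) =
    tmap (P A \<otimes> P C) (P B \<otimes> P E) (P (A \<union> C)) (P (B \<union> E)) (m A C) (m B E)
      (tswap_mid (P A) (P B) (P C) (P E) (tmap (P (A \<union> B)) (P (C \<union> E)) (P A \<otimes> P B) (P C \<otimes> P E) (D A B) (D C E) t))"
proof -
  have i: "(A \<union> B) \<inter> (A \<union> C) = A" "(A \<union> B) \<inter> (B \<union> E) = B" "(C \<union> E) \<inter> (A \<union> C) = C" "(C \<union> E) \<inter> (B \<union> E) = E"
    using disj by auto
  \<comment> \<open>The axiom is taken at \<open>I = A \<union> C\<close>,
    \<open>J = B \<union> E\<close>, \<open>I' = A \<union> B\<close> and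
    \<open>J' = C \<union> E\<close>.\<close>
  have "(A \<union> C) \<inter> (B \<union> E) = {}" using disj by auto
  from D_m[OF _ _ this _ _ disj(3) _ t, unfolded i] fin show ?thesis by (simp add: Un_ac)
qed

text \<open>On a pair of summands both sides vanish unless each of the two relations splits. In that
  case \<open>D_m_blocks\<close> applies to the quotients of the blocks, and
  \<open>com_mult_swap\<close> moves the inclusions outside.\<close>

lemma com_D_m_blocks:
  assumes fin: "finite A" "finite B" "finite C" "finite E" and disj: "A \<inter> B = {}" "C \<inter> E = {}" "(A \<union> B) \<inter> (C \<union> E) = {}"
    and t: "t \<in> vcarrier (P' (A \<union> B) \<otimes> P' (C \<union> E))"
  shows "D' (A \<union> C) (B \<union> E) (m' (A \<union> B) (C \<union> E) t) =
    tmap (P' A \<otimes> P' C) (P' B \<otimes> P' E) (P' (A \<union> C)) (P' (B \<union> E))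
      (m' A C) (m' B E)
      (tswap_mid (P' A) (P' B) (P' C) (P' E)
        (tmap (P' (A \<union> B)) (P' (C \<union> E)) (P' A \<otimes> P' B) (P' C \<otimes> P' E)
          (D' A B) (D' C E) t))"
proof -
  let ?QA = "P' A" and ?QB = "P' B" and ?QC = "P' C" and ?QE = "P' E"
  let ?QAB = "P' (A \<union> B)" and ?QCE = "P' (C \<union> E)" and ?QAC = "P' (A \<union> C)" and ?QBE = "P' (B \<union> E)"
  have d: "A \<inter> C = {}" "B \<inter> E = {}" "(A \<union> C) \<inter> (B \<union> E) = {}" using disj by auto
  have f: "finite (A \<union> B)" "finite (C \<union> E)" "finite (A \<union> C)" "finite (B \<union> E)" using fin by auto
  have un: "(A \<union> C) \<union> (B \<union> E) = (A \<union> B) \<union> (C \<union> E)" by auto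
  note vs = vec_space_P_quot vec_space_com fin f vec_space_tensor
  have lR: "linear_on ((?QA \<otimes> ?QB) \<otimes> (?QC \<otimes> ?QE)) (?QAC \<otimes> ?QBE)
      (\<lambda>t. tmap (?QA \<otimes> ?QC) (?QB \<otimes> ?QE) ?QAC ?QBE (m' A C) (m' B E) (tswap_mid ?QA ?QB ?QC ?QE t))"
    by (intro linear_on_comp[OF tswap_mid_linear tmap_linear] vs com_mult_linear d)
  show ?thesis
  proof (rule com_ext2[OF f(1,2) _ _ _ t, where U = "?QAC \<otimes> ?QBE"
        and F = "\<lambda>t. D' (A \<union> C) (B \<union> E) (m' (A \<union> B) (C \<union> E) t)"
        and G = "\<lambda>t. tmap (?QA \<otimes> ?QC) (?QB \<otimes> ?QE) ?QAC ?QBE (m' A C) (m' B E)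
          (tswap_mid ?QA ?QB ?QC ?QE
            (tmap ?QAB ?QCE (?QA \<otimes> ?QB) (?QC \<otimes> ?QE) (D' A B) (D' C E) t))"])
    have "linear_on (P' ((A \<union> B) \<union> (C \<union> E))) (?QAC \<otimes> ?QBE) (D' (A \<union> C) (B \<union> E))"
      using com_comult_linear[OF f(3,4) d(3)] by (simp only: un)
    then show "linear_on (?QAB \<otimes> ?QCE) (?QAC \<otimes> ?QBE) (\<lambda>t. D' (A \<union> C) (B \<union> E) (m' (A \<union> B) (C \<union> E) t))"
      by (rule linear_on_comp[OF com_mult_linear[OF f(1,2) disj(3)]])
    show "linear_on (?QAB \<otimes> ?QCE) (?QAC \<otimes> ?QBE) (\<lambda>t.
        tmap (?QA \<otimes> ?QC) (?QB \<otimes> ?QE) ?QAC ?QBE (m' A C) (m' B E) (tswap_mid ?QA ?QB ?QC ?QE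
        (tmap ?QAB ?QCE (?QA \<otimes> ?QB) (?QC \<otimes> ?QE) (D' A B) (D' C E) t)))"
      by (intro linear_on_comp[OF tmap_linear lR] vs com_comult_linear disj)
  next
    fix r s v w assume r: "r \<in> equivs (A \<union> B)" "s \<in> equivs (C \<union> E)"
      and v: "v \<in> vcarrier (PQ (A \<union> B) r)" "w \<in> vcarrier (PQ (C \<union> E) s)"
    have e: "r \<union> s \<in> equivs ((A \<union> C) \<union> (B \<union> E))" using equivs_Un[OF r disj(3)] by (simp add: un)
    note fb = four_blocks[OF equivsD(1)[OF r(1)] equivsD(1)[OF r(2)] disj(3)]
    let ?rA = "r \<inter> A \<times> A" and ?rB = "r \<inter> B \<times> B" and ?sC = "s \<inter> C \<times> C" and ?sE = "s \<inter> E \<times> E"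
    let ?PA = "PQ A ?rA" and ?PB = "PQ B ?rB" and ?PC = "PQ C ?sC" and ?PE = "PQ E ?sE"
    have re: "?rA \<in> equivs A" "?rB \<in> equivs B" "?sC \<in> equivs C" "?sE \<in> equivs E"
      using equivs_restrict[OF r(1)] equivs_restrict[OF r(2)] by auto
    note ue = equivs_Un[OF re(1,3) d(1)] equivs_Un[OF re(2,4) d(2)]
    let ?PAC = "PQ (A \<union> C) (?rA \<union> ?sC)" and ?PBE = "PQ (B \<union> E) (?rB \<union> ?sE)"
    have L: "D' (A \<union> C) (B \<union> E) (m' (A \<union> B) (C \<union> E) (ten ?QAB ?QCE (com_in r v) (com_in s w))) =
       (if splits r A B \<and> splits s C E then
         tmap ?PAC ?PBE ?QAC ?QBE (com_in (?rA \<union> ?sC)) (com_in (?rB \<union> ?sE))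
           (D (quot (A \<union> C) (?rA \<union> ?sC)) (quot (B \<union> E) (?rB \<union> ?sE))
             (m (quot (A \<union> B) r) (quot (C \<union> E) s) (ten (PQ (A \<union> B) r) (PQ (C \<union> E) s) v w))) else 0)"
      unfolding com_mult_ten[OF f(1,2) disj(3) r v] com_comult_in[OF f(3,4) d(3) e] fb ..
    have R: "tmap ?QAB ?QCE (?QA \<otimes> ?QB) (?QC \<otimes> ?QE) (D' A B) (D' C E) (ten ?QAB ?QCE (com_in r v) (com_in s w)) =
        ten (?QA \<otimes> ?QB) (?QC \<otimes> ?QE) (D' A B (com_in r v)) (D' C E (com_in s w))"
      by (intro tmap_ten vs com_comult_linear disj com_in_closed r v)
    note cl = linear_on_in[OF com_comult_linear[OF fin(1,2) disj(1)] com_in_closed[OF f(1) r(1) v(1)]]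
      linear_on_in[OF com_comult_linear[OF fin(3,4) disj(2)] com_in_closed[OF f(2) r(2) v(2)]]
    show "D' (A \<union> C) (B \<union> E) (m' (A \<union> B) (C \<union> E) (ten ?QAB ?QCE (com_in r v) (com_in s w))) =
       tmap (?QA \<otimes> ?QC) (?QB \<otimes> ?QE) ?QAC ?QBE (m' A C) (m' B E) (tswap_mid ?QA ?QB ?QC ?QE
        (tmap ?QAB ?QCE (?QA \<otimes> ?QB) (?QC \<otimes> ?QE) (D' A B) (D' C E) (ten ?QAB ?QCE (com_in r v) (com_in s w))))"
    proof (cases "splits r A B \<and> splits s C E")
      case False
      then have "D' A B (com_in r v) = 0 \<or> D' C E (com_in s w) = 0"
        using com_comult_in[OF fin(1,2) disj(1) r(1)] com_comult_in[OF fin(3,4) disj(2) r(2)] by auto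
      then have "ten (?QA \<otimes> ?QB) (?QC \<otimes> ?QE) (D' A B (com_in r v)) (D' C E (com_in s w)) = 0"
        using linear_on_zero[OF _ linear_on_ten(1)[OF cl(2)], of "?QA \<otimes> ?QB"] linear_on_zero[OF _ linear_on_ten(2)[OF cl(1)], of "?QC \<otimes> ?QE"]
        by (auto simp: vs)
      then show ?thesis
        using linear_on_zero[OF _ lR] unfolding L R if_not_P[OF False] by (simp add: vs)
    next
      case sp: True
      let ?dv = "D (quot A ?rA) (quot B ?rB) v" and ?dw = "D (quot C ?sC) (quot E ?sE) w"
      have sp12: "splits r A B" "splits s C E" using sp by auto
      note dl = D_quot_linear[OF fin(1,2) disj(1) r(1) sp12(1)] D_quot_linear[OF fin(3,4) disj(2) r(2) sp12(2)]
      have dv: "?dv \<in> vcarrier (?PA \<otimes> ?PB)" "?dw \<in> vcarrier (?PC \<otimes> ?PE)"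
        using linear_on_in[OF dl(1) v(1)] linear_on_in[OF dl(2) v(2)] by auto
      have q: "quot (A \<union> B) r = quot A ?rA \<union> quot B ?rB" "quot (C \<union> E) s = quot C ?sC \<union> quot E ?sE"
        using quot_restrict_splits[OF r(1) sp12(1) disj(1)] quot_restrict_splits[OF r(2) sp12(2) disj(2)] .
      have q2: "quot (A \<union> C) (?rA \<union> ?sC) = quot A ?rA \<union> quot C ?sC" "quot (B \<union> E) (?rB \<union> ?sE) = quot B ?rB \<union> quot E ?sE"
        using quot_Un[OF re(1,3) d(1)] quot_Un[OF re(2,4) d(2)] .
      have qd: "quot A ?rA \<inter> quot B ?rB = {}" "quot C ?sC \<inter> quot E ?sE = {}"
          "(quot A ?rA \<union> quot B ?rB) \<inter> (quot C ?sC \<union> quot E ?sE) = {}"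
        using quot_disjoint[OF fin(1,2) re(1,2) disj(1)] quot_disjoint[OF fin(3,4) re(3,4) disj(2)]
          quot_disjoint[OF f(1,2) r disj(3)] by (simp_all only: q)
      have base: "D (quot (A \<union> C) (?rA \<union> ?sC)) (quot (B \<union> E) (?rB \<union> ?sE))
             (m (quot (A \<union> B) r) (quot (C \<union> E) s) (ten (PQ (A \<union> B) r) (PQ (C \<union> E) s) v w)) =
           tmap (?PA \<otimes> ?PC) (?PB \<otimes> ?PE) ?PAC ?PBE (m (quot A ?rA) (quot C ?sC)) (m (quot B ?rB) (quot E ?sE))
             (tswap_mid ?PA ?PB ?PC ?PE (ten (?PA \<otimes> ?PB) (?PC \<otimes> ?PE) ?dv ?dw))"
        using D_m_blocks[OF finite_quot[OF fin(1)] finite_quot[OF fin(2)] finite_quot[OF fin(3)] finite_quot[OF fin(4)] qd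
            ten_in[OF v[unfolded q]]]
          tmap_ten[OF vs(1)[OF f(1), of r] vs(1)[OF f(2), of s] _ _ dl v]
        by (simp add: q q2 vs vec_space_P finite_quot)
      have comult: "tmap (?PA \<otimes> ?PB) (?PC \<otimes> ?PE) (?QA \<otimes> ?QB) (?QC \<otimes> ?QE)
            (tmap ?PA ?PB ?QA ?QB (com_in ?rA) (com_in ?rB)) (tmap ?PC ?PE ?QC ?QE (com_in ?sC) (com_in ?sE))
            (ten (?PA \<otimes> ?PB) (?PC \<otimes> ?PE) ?dv ?dw) =
          ten (?QA \<otimes> ?QB) (?QC \<otimes> ?QE) (D' A B (com_in r v)) (D' C E (com_in s w))"
        unfolding com_comult_in[OF fin(1,2) disj(1) r(1)] com_comult_in[OF fin(3,4) disj(2) r(2)]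
          if_P[OF sp12(1)] if_P[OF sp12(2)]
        by (rule tmap_ten) (intro vs tmap_linear com_in_linear re dv)+
      show ?thesis unfolding L R if_P[OF sp] base comult[symmetric]
        by (rule com_mult_swap[OF fin d(1,2) re ten_in[OF dv], symmetric])
    qed
  qed
qed

lemma twisted_bialgebra_com:
  "twisted_bialgebra P' act' m' (com_one one) D' counit'"
proof (intro twisted_bialgebra.intro twisted_algebra_com twisted_coalgebra_com twisted_bialgebra_axioms.intro)
  fix I J I' J' :: "'a hf set" and t
  assume fin: "finite I" "finite J" "I \<inter> J = {}" "finite I'" "finite J'" "I' \<inter> J' = {}" and eq: "I \<union> J = I' \<union> J'"
    and t: "t \<in> vcarrier (P' I' \<otimes> P' J')"
  have I: "I' \<inter> I \<union> J' \<inter> I = I" "I' \<inter> J \<union> J' \<inter> J = J" "I' \<inter> I \<union> I' \<inter> J = I'" "J' \<inter> I \<union> J' \<inter> J = J'"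
    using eq by auto
  show "D' I J (m' I' J' t) =
    tmap (P' (I' \<inter> I) \<otimes> P' (J' \<inter> I)) (P' (I' \<inter> J) \<otimes> P' (J' \<inter> J)) (P' I) (P' J)
      (m' (I' \<inter> I) (J' \<inter> I)) (m' (I' \<inter> J) (J' \<inter> J))
      (tswap_mid (P' (I' \<inter> I)) (P' (I' \<inter> J)) (P' (J' \<inter> I)) (P' (J' \<inter> J))
        (tmap (P' I') (P' J') (P' (I' \<inter> I) \<otimes> P' (I' \<inter> J)) (P' (J' \<inter> I) \<otimes> P' (J' \<inter> J))
          (D' (I' \<inter> I) (I' \<inter> J)) (D' (J' \<inter> I) (J' \<inter> J)) t))"
    using com_D_m_blocks[of "I' \<inter> I" "I' \<inter> J" "J' \<inter> I" "J' \<inter> J" t] fin t unfolding I by auto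
next
  have o: "one \<in> vcarrier (PQ {} {})" "{} \<in> equivs {}" using one_closed by (simp_all add: quot_empty equivs_empty)
  have "D' {} {} (com_one one) = in2 {} {} {} {}
      (ten (PQ {} {}) (PQ {} {}) one one)"
    using com_comult_in[of "{}" "{}" "{}" one] o(2) D_one by (simp add: com_one_def splits_def quot_empty)
  also have "\<dots> = ten (P' {}) (P' {}) (com_one one) (com_one one)"
    unfolding com_one_def by (rule tmap_ten) (intro vec_space_P_quot vec_space_com finite.emptyI com_in_linear o)+
  finally show "D' {} {} (com_one one) = ten (P' {}) (P' {}) (com_one one) (com_one one)" .
next
  fix v w assume v: "v \<in> vcarrier (P' {})" and w: "w \<in> vcarrier (P' {})"
  have c: "f = com_in {} (f {})" "f {} \<in> vcarrier (PQ {} {})" if "f \<in> vcarrier (P' {})" for f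
    using com_decompose[OF _ that] com_component[OF that] by (simp_all add: equivs_empty)
  have "m' {} {} (ten (P' {}) (P' {}) v w) =
      com_in ({} \<union> {}) (m (quot {} {}) (quot {} {}) (ten (PQ {} {}) (PQ {} {}) (v {}) (w {})))"
    by (subst c(1)[OF v], subst c(1)[OF w], rule com_mult_ten) (use c(2) v w in \<open>simp_all add: equivs_empty\<close>)
  then show "counit' (m' {} {} (ten (P' {}) (P' {}) v w)) =
      counit' v * counit' w"
    using counit_mult c(2)[OF v] c(2)[OF w] by (simp add: com_counit_def com_in_def quot_empty)
next
  show "counit' (com_one one) = 1" by (simp add: com_counit_def com_one_def com_in_def counit_one)
qed

end

section \<open>Contraction-extraction on quotients\<close>

lemma quot_Id_on: "quot X (Id_on X) = (\<lambda>x. Cls {|x|}) ` X"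
proof -
  have "cls (Id_on X) x = Cls {|x|}" if "x \<in> X" for x
  proof -
    have "Id_on X `` {x} = fset {|x|}" using that by auto
    then show ?thesis unfolding cls_def by (simp only: fset_inverse)
  qed
  then show ?thesis by (simp add: quot_eq)
qed

locale hf_contraction_extraction = hf_species P act + contraction_extraction P act delta
  for P :: "'a hf set \<Rightarrow> ('k::field, 'v::ab_group_add) kspace" and act delta
begin

abbreviation dq where "dq \<equiv> delta_quot P act delta"

abbreviation iq where "iq X r' r \<equiv> quot (quot X r') (quot_rel r' r)"
abbreviation fl where "fl X r' r \<equiv> act (iq X r' r) flatten"

lemma flatten_quot:
  assumes X: "finite X" "r \<in> equivs X" "r' \<in> equivs X" "r' \<subseteq> r"
  shows "flatten ` iq X r' r = quot X r"
    and "inj_on flatten (iq X r' r)"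
  using flatten_bij[OF X] by (auto simp: bij_betw_def)

lemma act_flatten_linear:
  assumes X: "finite X" "r \<in> equivs X" "r' \<in> equivs X" "r' \<subseteq> r"
  shows "linear_on (P (iq X r' r)) (PQ X r) (fl X r' r)"
  using act_linear[OF finite_quot[OF finite_quot[OF X(1)]] flatten_quot(2)[OF X]] by (simp add: flatten_quot(1)[OF X])

lemma delta_quot_rel_linear:
  assumes X: "finite X" "r \<in> equivs X" "r' \<in> equivs X" "r' \<subseteq> r"
  shows "linear_on (PQ X r') (P (iq X r' r) \<otimes> PQ X r') (delta (quot X r') (quot_rel r' r))"
  by (rule delta_linear[OF finite_quot[OF X(1)] quot_rel_equivs[OF X]])

lemma dq_linear:
  assumes X: "finite X" "r \<in> equivs X" "r' \<in> equivs X" "r' \<subseteq> r"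
  shows "linear_on (PQ X r') (PQ X r \<otimes> PQ X r') (dq X r' r)"
  unfolding delta_quot_def id_def
  by (intro linear_on_comp[OF delta_quot_rel_linear tmap_linear] act_flatten_linear linear_on_id vec_space_P finite_quot X)

text \<open>Two squares are put side by side: naturality of \<open>delta\<close> for the map that
  \<open>s\<close> induces on X/r', and the commutation of \<open>flatten\<close> with induced
  maps.\<close>

lemma dq_natural:
  assumes X: "finite X" "r \<in> equivs X" "r' \<in> equivs X" "r' \<subseteq> r" and s: "inj_on s X"
    and v: "v \<in> vcarrier (PQ X r')"
  shows "dq (s ` X) (transport s r') (transport s r) (act (quot X r') (quot_map s) v) =
    tmap (PQ X r) (PQ X r') (PQ (s ` X) (transport s r)) (PQ (s ` X) (transport s r'))
      (act (quot X r) (quot_map s)) (act (quot X r') (quot_map s)) (dq X r' r v)"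
proof -
  let ?B = "quot X r'" and ?q = "quot_rel r' r" and ?s = "quot_map s"
  let ?B' = "quot (s ` X) (transport s r')" and ?q' = "quot_rel (transport s r') (transport s r)"
  let ?R' = "quot (s ` X) (transport s r)"
  have sX: "finite (s ` X)" using X(1) by simp
  note tX = sX transport_equivs[OF s X(2)] transport_equivs[OF s X(3)] transport_mono[OF X(4)]
  have B': "?B' = ?s ` ?B" by (rule quot_transport[OF s X(1,3)])
  have R': "?R' = ?s ` quot X r" by (rule quot_transport[OF s X(1,2)])
  have q': "?q' = transport ?s ?q" by (rule quot_rel_transport[OF s X(1-3)])
  note q = quot_rel_equivs[OF X]
  note injB = inj_on_quot_map[OF s X(1,3)] and injR = inj_on_quot_map[OF s X(1,2)]
  have fB: "finite ?B" by (rule finite_quot[OF X(1)])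
  have Bq': "quot ?B' ?q' = quot_map ?s ` quot ?B ?q" unfolding B' q' by (rule quot_transport[OF injB fB q])
  note injBq = inj_on_quot_map[OF injB fB q]
  note d = linear_on_in[OF delta_quot_rel_linear[OF X] v]
  note vs = vec_space_P finite_quot finite_imageI fB X(1)
  note flq = flatten_quot[OF X] and flq' = flatten_quot[OF tX]
  have lq: "linear_on (PQ ?B ?q) (PQ ?B' ?q') (act (quot ?B ?q) (quot_map ?s))"
    unfolding Bq' by (rule act_linear[OF finite_quot[OF fB] injBq])
  have lB: "linear_on (P ?B) (P ?B') (act ?B ?s)" unfolding B' by (rule act_linear[OF fB injB])
  have lR: "linear_on (PQ X r) (P ?R') (act (quot X r) ?s)" by (rule act_quot_linear[OF X(1) s X(2)])
  have swap: "act (quot ?B' ?q') flatten (act (quot ?B ?q) (quot_map ?s) u) = act (quot X r) ?s (act (quot ?B ?q) flatten u)"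
    if u: "u \<in> vcarrier (PQ ?B ?q)" for u
  proof -
    have "act (quot ?B' ?q') flatten (act (quot ?B ?q) (quot_map ?s) u) = act (quot ?B ?q) (flatten \<circ> quot_map ?s) u"
      using act_comp[OF finite_quot[OF fB] injBq flq'(2)[unfolded Bq'] u] unfolding Bq' by simp
    also have "flatten \<circ> quot_map ?s = ?s \<circ> flatten" by (simp add: fun_eq_iff flatten_quot_map)
    also have "act (quot ?B ?q) (?s \<circ> flatten) u = act (quot X r) ?s (act (quot ?B ?q) flatten u)"
      using act_comp[OF finite_quot[OF fB] flq(2) _ u, of ?s] injR by (simp add: flq(1))
    finally show ?thesis .
  qed
  have "delta ?B' ?q' (act ?B ?s v) = tmap (PQ ?B ?q) (P ?B) (PQ ?B' ?q') (P ?B')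
      (act (quot ?B ?q) (quot_map ?s)) (act ?B ?s) (delta ?B ?q v)"
    unfolding B' q' by (rule delta_natural[OF fB q injB v])
  then have "dq (s ` X) (transport s r') (transport s r) (act ?B ?s v) =
    tmap (PQ ?B' ?q') (P ?B') (P ?R') (P ?B') (act (quot ?B' ?q') flatten) id
      (tmap (PQ ?B ?q) (P ?B) (PQ ?B' ?q') (P ?B') (act (quot ?B ?q) (quot_map ?s)) (act ?B ?s) (delta ?B ?q v))"
    by (simp only: delta_quot_def)
  also have "\<dots> = tmap (PQ ?B ?q) (P ?B) (P ?R') (P ?B') (\<lambda>u. act (quot ?B' ?q') flatten (act (quot ?B ?q) (quot_map ?s) u))
      (\<lambda>u. id (act ?B ?s u)) (delta ?B ?q v)"
    by (rule tmap_tmap) (intro vs lq lB act_flatten_linear tX linear_on_id[folded id_def] d)+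
  also have "\<dots> = tmap (PQ ?B ?q) (P ?B) (P ?R') (P ?B') (\<lambda>u. act (quot X r) ?s (act (quot ?B ?q) flatten u))
      (\<lambda>u. act ?B ?s (id u)) (delta ?B ?q v)"
    by (rule arg_cong[where f = "\<lambda>h. h (delta ?B ?q v)"], rule tmap_cong) (simp_all add: swap)
  also have "\<dots> = tmap (PQ X r) (P ?B) (P ?R') (P ?B') (act (quot X r) ?s) (act ?B ?s)
      (tmap (PQ ?B ?q) (P ?B) (PQ X r) (P ?B) (act (quot ?B ?q) flatten) id (delta ?B ?q v))"
    by (rule tmap_tmap[symmetric]) (intro vs lR lB act_flatten_linear X linear_on_id[folded id_def] d)+
  finally show ?thesis by (simp only: delta_quot_def)
qed

text \<open>Collects all flattenings at the front, leaving the right-hand side of axiom (ii) for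
  X/r'' in its original form. Nothing is assumed between \<open>r\<close> and \<open>r'\<close>, so
  it serves \<open>dq_zero\<close> and \<open>dq_coassoc\<close> alike.\<close>

lemma dq_dq:
  assumes X: "finite X" "r \<in> equivs X" "r' \<in> equivs X" "r'' \<in> equivs X" "r'' \<subseteq> r'" "r'' \<subseteq> r"
    and v: "v \<in> vcarrier (PQ X r'')"
  shows "tmap (PQ X r) (PQ X r'') (PQ X r) (PQ X r' \<otimes> PQ X r'') id (dq X r'' r') (dq X r'' r v) =
    tmap (P (iq X r'' r)) (P (iq X r'' r') \<otimes> PQ X r'')
      (PQ X r) (PQ X r' \<otimes> PQ X r'')
      (fl X r'' r)
      (tmap (P (iq X r'' r')) (PQ X r'') (PQ X r') (PQ X r'')
        (fl X r'' r') id)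
      (tmap (P (iq X r'' r)) (PQ X r'') (P (iq X r'' r))
        (P (iq X r'' r') \<otimes> PQ X r'') id (delta (quot X r'') (quot_rel r'' r'))
        (delta (quot X r'') (quot_rel r'' r) v))"
proof -
  let ?B = "quot X r''" and ?q = "quot_rel r'' r" and ?q' = "quot_rel r'' r'"
  note vs = vec_space_P finite_quot X(1) vec_space_tensor
  note lid = linear_on_id[folded id_def]
  note d = linear_on_in[OF delta_quot_rel_linear[OF X(1,2,4,6)] v]
  note lf = act_flatten_linear[OF X(1,2,4,6)] act_flatten_linear[OF X(1,3,4,5)]
  let ?fl = "act (quot ?B ?q) flatten" and ?fl' = "act (quot ?B ?q') flatten"
  have 1: "tmap (PQ X r) (P ?B) (PQ X r) (PQ X r' \<otimes> P ?B) id (dq X r'' r')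
      (tmap (PQ ?B ?q) (P ?B) (PQ X r) (P ?B) ?fl id (delta ?B ?q v)) =
    tmap (PQ ?B ?q) (P ?B) (PQ X r) (PQ X r' \<otimes> P ?B) (\<lambda>x. id (?fl x)) (\<lambda>x. dq X r'' r' (id x)) (delta ?B ?q v)"
    by (rule tmap_tmap) (intro vs lid lf dq_linear X d)+
  have 2: "tmap (PQ ?B ?q) (PQ ?B ?q' \<otimes> P ?B) (PQ X r) (PQ X r' \<otimes> P ?B) ?fl
      (tmap (PQ ?B ?q') (P ?B) (PQ X r') (P ?B) ?fl' id)
      (tmap (PQ ?B ?q) (P ?B) (PQ ?B ?q) (PQ ?B ?q' \<otimes> P ?B) id (delta ?B ?q') (delta ?B ?q v)) =
    tmap (PQ ?B ?q) (P ?B) (PQ X r) (PQ X r' \<otimes> P ?B) (\<lambda>x. ?fl (id x))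
      (\<lambda>x. tmap (PQ ?B ?q') (P ?B) (PQ X r') (P ?B) ?fl' id (delta ?B ?q' x)) (delta ?B ?q v)"
    by (rule tmap_tmap) (intro vs lid lf delta_quot_rel_linear tmap_linear X d)+
  show ?thesis
    unfolding 2 delta_quot_def[of P act delta X r'' r v] 1 by (simp add: delta_quot_def[abs_def])
qed

lemma dq_zero:
  assumes X: "finite X" "r \<in> equivs X" "r' \<in> equivs X" "r'' \<in> equivs X" "r'' \<subseteq> r'" "r'' \<subseteq> r" and n: "\<not> r' \<subseteq> r"
    and v: "v \<in> vcarrier (PQ X r'')"
  shows "tmap (PQ X r) (PQ X r'') (PQ X r) (PQ X r' \<otimes> PQ X r'') id (dq X r'' r') (dq X r'' r v) = 0"
proof -
  let ?B = "quot X r''" and ?q = "quot_rel r'' r" and ?q' = "quot_rel r'' r'"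
  have z: "tmap (PQ ?B ?q) (P ?B) (PQ ?B ?q) (PQ ?B ?q' \<otimes> P ?B) id (delta ?B ?q') (delta ?B ?q v) = 0"
    using n by (intro delta_zero finite_quot X quot_rel_equivs v) (simp add: quot_rel_subset_iff[OF X])
  have l: "linear_on (PQ ?B ?q \<otimes> (PQ ?B ?q' \<otimes> P ?B)) (PQ X r \<otimes> (PQ X r' \<otimes> P ?B))
      (tmap (PQ ?B ?q) (PQ ?B ?q' \<otimes> P ?B) (PQ X r) (PQ X r' \<otimes> P ?B) (act (quot ?B ?q) flatten)
      (tmap (PQ ?B ?q') (P ?B) (PQ X r') (P ?B) (act (quot ?B ?q') flatten) id))"
    by (intro tmap_linear vec_space_tensor vec_space_P finite_quot X act_flatten_linear linear_on_id[folded id_def])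
  show ?thesis unfolding dq_dq[OF X v] z
    by (rule linear_on_zero[OF _ l]) (intro vec_space_tensor vec_space_P finite_quot X)
qed

text \<open>\<open>flatten\<close> is a bijection from (X/r'')/r' onto X/r', and
  \<open>delta\<close> is natural for it; \<open>flatten_flatten\<close> then reconciles the two
  ways to X/r. In effect, contracting X/r' may be replaced by contracting the iterated quotient over
  X/r'', where axiom (ii) is available.\<close>

lemma dq_flatten:
  assumes X: "finite X" "r \<in> equivs X" "r' \<in> equivs X" "r'' \<in> equivs X" "r'' \<subseteq> r'" "r' \<subseteq> r"
    and u: "u \<in> vcarrier (P (iq X r'' r'))"
  shows "dq X r' r (fl X r'' r' u) =
    tmap (P (iq X r'' r)) (P (iq X r'' r')) (PQ X r) (PQ X r')
      (fl X r'' r) (fl X r'' r')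
      (dq (quot X r'') (quot_rel r'' r') (quot_rel r'' r) u)"
proof -
  have sub: "r'' \<subseteq> r" using X by auto
  let ?B = "quot X r''" and ?q = "quot_rel r'' r" and ?q' = "quot_rel r'' r'"
  let ?C = "quot ?B ?q'" and ?p = "quot_rel ?q' ?q"
  have fB: "finite ?B" by (rule finite_quot[OF X(1)])
  have fC: "finite ?C" by (rule finite_quot[OF fB])
  note q = quot_rel_equivs[OF X(1,2,4) sub] quot_rel_equivs[OF X(1,3,4,5)]
  have qs: "?q' \<subseteq> ?q" using X(6) quot_rel_subset_iff[OF X(1-5) sub] by simp
  note Q = fB q qs
  note p = quot_rel_equivs[OF Q]
  note flq = flatten_quot[OF X(1,3,4,5)] and flp = flatten_quot[OF Q] and flr = flatten_quot[OF X(1,2,4) sub]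
  have tp: "transport flatten ?p = quot_rel r' r" by (rule transport_flatten_quot_rel[OF X])
  note injp = inj_on_quot_map[OF flq(2) fC p]
  have im: "iq X r' r = quot_map flatten ` quot ?C ?p"
    using quot_transport[OF flq(2) fC p] by (simp add: flq(1) tp)
  note d = linear_on_in[OF delta_linear[OF fC p] u]
  note vs = vec_space_P finite_quot X(1)
  note lid = linear_on_id[folded id_def]
  have lqm: "linear_on (PQ ?C ?p) (P (iq X r' r)) (act (quot ?C ?p) (quot_map flatten))"
    unfolding im by (rule act_linear[OF finite_quot[OF fC] injp])
  \<comment> \<open>The two paths from the triple quotient to X/r, compared through functoriality of
    the action.\<close>
  have swap: "fl X r' r (act (quot ?C ?p) (quot_map flatten) w) =
      act (quot ?B ?q) flatten (act (quot ?C ?p) flatten w)" if w: "w \<in> vcarrier (PQ ?C ?p)" for w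
  proof -
    have "fl X r' r (act (quot ?C ?p) (quot_map flatten) w) =
        act (quot ?C ?p) (flatten \<circ> quot_map flatten) w"
      using act_comp[OF finite_quot[OF fC] injp _ w, of flatten] flatten_quot(2)[OF X(1,2,3,6)] by (simp add: im)
    also have "flatten \<circ> quot_map flatten = flatten \<circ> flatten" by (simp add: fun_eq_iff flatten_flatten)
    also have "act (quot ?C ?p) (flatten \<circ> flatten) w = act (quot ?B ?q) flatten (act (quot ?C ?p) flatten w)"
      using act_comp[OF finite_quot[OF fC] flp(2) _ w, of flatten] flr(2) by (simp add: flp(1))
    finally show ?thesis .
  qed
  have nat: "delta (quot X r') (quot_rel r' r) (act ?C flatten u) =
      tmap (PQ ?C ?p) (P ?C) (P (iq X r' r)) (PQ X r')
        (act (quot ?C ?p) (quot_map flatten)) (act ?C flatten) (delta ?C ?p u)"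
    using delta_natural[OF fC p flq(2) u] by (simp add: flq(1) tp)
  have 1: "dq X r' r (act ?C flatten u) = tmap (PQ ?C ?p) (P ?C) (PQ X r) (PQ X r')
      (\<lambda>w. fl X r' r (act (quot ?C ?p) (quot_map flatten) w)) (\<lambda>w. id (act ?C flatten w)) (delta ?C ?p u)"
    unfolding delta_quot_def nat
    by (rule tmap_tmap) (intro vs lqm lid act_flatten_linear X d)+
  have 2: "tmap (PQ ?B ?q) (P ?C) (PQ X r) (PQ X r') (act (quot ?B ?q) flatten) (act ?C flatten)
      (tmap (PQ ?C ?p) (P ?C) (PQ ?B ?q) (P ?C) (act (quot ?C ?p) flatten) id (delta ?C ?p u)) =
    tmap (PQ ?C ?p) (P ?C) (PQ X r) (PQ X r')
      (\<lambda>w. act (quot ?B ?q) flatten (act (quot ?C ?p) flatten w)) (\<lambda>w. act ?C flatten (id w)) (delta ?C ?p u)"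
    by (rule tmap_tmap) (intro vs lid act_flatten_linear Q X sub d)+
  have 3: "tmap (PQ ?C ?p) (P ?C) (PQ X r) (PQ X r')
      (\<lambda>w. fl X r' r (act (quot ?C ?p) (quot_map flatten) w)) (\<lambda>w. id (act ?C flatten w)) =
    tmap (PQ ?C ?p) (P ?C) (PQ X r) (PQ X r')
      (\<lambda>w. act (quot ?B ?q) flatten (act (quot ?C ?p) flatten w)) (\<lambda>w. act ?C flatten (id w))"
    by (rule tmap_cong) (simp_all add: swap)
  show ?thesis unfolding 1 3 delta_quot_def[of P act delta ?B] 2 by (rule refl)
qed

text \<open>Axiom (ii) holds for the finite set X/r''. Its left side is carried to X by
  \<open>dq_flatten\<close> and naturality of the associator, its right side by
  \<open>dq_dq\<close>, with the same flattenings in front.\<close>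

lemma dq_coassoc:
  assumes X: "finite X" "r \<in> equivs X" "r' \<in> equivs X" "r'' \<in> equivs X" "r'' \<subseteq> r'" "r' \<subseteq> r"
    and v: "v \<in> vcarrier (PQ X r'')"
  shows "tassoc (PQ X r) (PQ X r') (PQ X r'')
      (tmap (PQ X r') (PQ X r'') (PQ X r \<otimes> PQ X r') (PQ X r'') (dq X r' r) id (dq X r'' r' v)) =
    tmap (PQ X r) (PQ X r'') (PQ X r) (PQ X r' \<otimes> PQ X r'') id (dq X r'' r') (dq X r'' r v)"
proof -
  have sub: "r'' \<subseteq> r" using X by auto
  let ?B = "quot X r''" and ?q = "quot_rel r'' r" and ?q' = "quot_rel r'' r'"
  have fB: "finite ?B" by (rule finite_quot[OF X(1)])
  note q = quot_rel_equivs[OF X(1,2,4) sub] quot_rel_equivs[OF X(1,3,4,5)]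
  have qs: "?q' \<subseteq> ?q" using X(6) quot_rel_subset_iff[OF X(1-5) sub] by simp
  note Q = fB q qs
  note vs = vec_space_P finite_quot X(1) vec_space_tensor
  note lid = linear_on_id[folded id_def]
  note d = linear_on_in[OF delta_quot_rel_linear[OF X(1,3,4,5)] v]
  let ?Pq = "PQ ?B ?q" and ?Pq' = "PQ ?B ?q'" and ?PB = "P ?B" and ?R = "PQ X r" and ?R' = "PQ X r'"
  let ?fl = "act (quot ?B ?q) flatten" and ?fl' = "act (quot ?B ?q') flatten"
  have 1: "tmap ?R' ?PB (?R \<otimes> ?R') ?PB (dq X r' r) id (tmap ?Pq' ?PB ?R' ?PB ?fl' id (delta ?B ?q' v)) =
      tmap ?Pq' ?PB (?R \<otimes> ?R') ?PB (\<lambda>u. dq X r' r (?fl' u)) (\<lambda>u. id (id u)) (delta ?B ?q' v)"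
    by (rule tmap_tmap) (intro vs lid act_flatten_linear dq_linear X d)+
  have 2: "tmap ?Pq' ?PB (?R \<otimes> ?R') ?PB (\<lambda>u. dq X r' r (?fl' u)) (\<lambda>u. id (id u)) =
      tmap ?Pq' ?PB (?R \<otimes> ?R') ?PB (\<lambda>u. tmap ?Pq ?Pq' ?R ?R' ?fl ?fl' (dq ?B ?q' ?q u)) (\<lambda>u. id (id u))"
    by (rule tmap_cong) (simp_all add: dq_flatten[OF X])
  have lB: "linear_on ?Pq' (?Pq \<otimes> ?Pq') (dq ?B ?q' ?q)" by (rule dq_linear[OF Q])
  have 3: "tmap (?Pq \<otimes> ?Pq') ?PB (?R \<otimes> ?R') ?PB (tmap ?Pq ?Pq' ?R ?R' ?fl ?fl') id
        (tmap ?Pq' ?PB (?Pq \<otimes> ?Pq') ?PB (dq ?B ?q' ?q) id (delta ?B ?q' v)) =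
      tmap ?Pq' ?PB (?R \<otimes> ?R') ?PB (\<lambda>u. tmap ?Pq ?Pq' ?R ?R' ?fl ?fl' (dq ?B ?q' ?q u)) (\<lambda>u. id (id u)) (delta ?B ?q' v)"
    by (rule tmap_tmap) (intro vs lid act_flatten_linear lB tmap_linear X sub d)+
  have "linear_on (?Pq' \<otimes> ?PB) (?Pq \<otimes> ?Pq' \<otimes> ?PB) (tmap ?Pq' ?PB (?Pq \<otimes> ?Pq') ?PB (dq ?B ?q' ?q) id)"
    by (intro tmap_linear vs lid lB)
  note c = linear_on_in[OF this d]
  have 4: "tassoc ?R ?R' ?PB (tmap (?Pq \<otimes> ?Pq') ?PB (?R \<otimes> ?R') ?PB (tmap ?Pq ?Pq' ?R ?R' ?fl ?fl') id
        (tmap ?Pq' ?PB (?Pq \<otimes> ?Pq') ?PB (dq ?B ?q' ?q) id (delta ?B ?q' v))) =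
      tmap ?Pq (?Pq' \<otimes> ?PB) ?R (?R' \<otimes> ?PB) ?fl (tmap ?Pq' ?PB ?R' ?PB ?fl' id)
       (tassoc ?Pq ?Pq' ?PB (tmap ?Pq' ?PB (?Pq \<otimes> ?Pq') ?PB (dq ?B ?q' ?q) id (delta ?B ?q' v)))"
    by (rule tassoc_tmap) (intro vs lid act_flatten_linear X sub c)+
  show ?thesis
    unfolding dq_dq[OF X(1-5) sub v] delta_quot_def[of P act delta X r'' r' v] 1 2 3[symmetric] 4
      delta_coassoc[OF Q v] by (rule refl)
qed

text \<open>A form of the counit axiom for \<open>delta\<close> in which no identification \<open>P[X/=] = P[X]\<close> occurs.\<close>

lemma dq_counit:
  "\<exists>e. \<forall>X. finite X \<longrightarrow>
     linear_on (P X) scalars (e X) \<and>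
     (\<forall>s. inj_on s X \<longrightarrow> (\<forall>v \<in> vcarrier (P X). e (s ` X) (act X s v) = e X v)) \<and>
     (\<forall>r' \<in> equivs X. \<forall>v \<in> vcarrier (PQ X r').
        (\<forall>r \<in> equivs X. r' \<subseteq> r \<longrightarrow> contract_right (PQ X r) (PQ X r') (e (quot X r')) (dq X r' r v) =
           (if r = r' then v else 0)) \<and>
        (\<Sum>r | r \<in> equivs X \<and> r' \<subseteq> r. contract_left (PQ X r) (PQ X r') (e (quot X r)) (dq X r' r v)) = v)"
proof -
  from delta_counit obtain e where H: "\<forall>X. finite X \<longrightarrow>
        linear_on (P X) scalars (e X) \<and>
        (\<forall>s. inj_on s X \<longrightarrow> (\<forall>v \<in> vcarrier (P X). e (s ` X) (act X s v) = e X v)) \<and>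
        (\<forall>v \<in> vcarrier (P X).
           (\<forall>r \<in> equivs X. contract_right (PQ X r) (P X) (e X) (delta X r v) =
              (if r = Id_on X then act X (\<lambda>x. Cls {|x|}) v else 0)) \<and>
           (\<Sum>r \<in> equivs X. contract_left (PQ X r) (P X) (e (quot X r)) (delta X r v)) = v)" ..
  note e = H[THEN spec, THEN mp, THEN conjunct1]
    and enat = H[THEN spec, THEN mp, THEN conjunct2, THEN conjunct1, rule_format]
    and eright = H[THEN spec, THEN mp, THEN conjunct2, THEN conjunct2, THEN bspec, THEN conjunct1, THEN bspec]
    and eleft = H[THEN spec, THEN mp, THEN conjunct2, THEN conjunct2, THEN bspec, THEN conjunct2]
  have right: "contract_right (PQ X r) (PQ X r') (e (quot X r')) (dq X r' r v) = (if r = r' then v else 0)"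
    if X: "finite X" "r \<in> equivs X" "r' \<in> equivs X" "r' \<subseteq> r" and v: "v \<in> vcarrier (PQ X r')" for X r r' v
  proof -
    let ?B = "quot X r'" and ?q = "quot_rel r' r"
    have fB: "finite ?B" by (rule finite_quot[OF X(1)])
    note vs = vec_space_P finite_quot X(1)
    note lf = act_flatten_linear[OF X]
    have "contract_right (PQ X r) (P ?B) (e ?B) (dq X r' r v) =
        act (quot ?B ?q) flatten (contract_right (PQ ?B ?q) (P ?B) (\<lambda>w. e ?B (id w)) (delta ?B ?q v))"
      unfolding delta_quot_def
      by (rule contract_right_tmap) (intro vs lf linear_on_id[folded id_def] e fB linear_on_in[OF delta_quot_rel_linear[OF X] v])+
    also have "\<dots> = act (quot ?B ?q) flatten (if r = r' then act ?B (\<lambda>x. Cls {|x|}) v else 0)"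
      using eright[OF fB v quot_rel_equivs[OF X]] quot_rel_eq_Id_iff[OF X] by simp
    also have "\<dots> = (if r = r' then v else 0)"
    proof (cases "r = r'")
      case True
      have q: "quot ?B ?q = (\<lambda>x. Cls {|x|}) ` ?B"
        unfolding True quot_rel_self[OF X(1,3)] by (rule quot_Id_on)
      have i: "inj_on (\<lambda>x. Cls {|x|}) ?B" by (rule inj_onI) simp
      \<comment> \<open>The identification with singletons prescribed by the counit axiom is
        followed by the flattening in the definition of \<open>dq\<close>; the two cancel.\<close>
      have "act (quot ?B ?q) flatten (act ?B (\<lambda>x. Cls {|x|}) v) = act ?B (flatten \<circ> (\<lambda>x. Cls {|x|})) v"
        using act_comp[OF fB i _ v, of flatten] flatten_quot(2)[OF X] by (simp add: q)
      also have "\<dots> = act ?B id v"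
        using flatten_quot(2)[OF X] unfolding q
        by (intro act_cong[OF fB comp_inj_on[OF i]] v) (simp_all add: flatten_singleton)
      finally show ?thesis using True by (simp add: act_id fB v)
    next
      case False
      then show ?thesis using linear_on_zero[OF _ lf] by (simp add: vs)
    qed
    finally show ?thesis .
  qed
  have left: "(\<Sum>r | r \<in> equivs X \<and> r' \<subseteq> r. contract_left (PQ X r) (PQ X r') (e (quot X r)) (dq X r' r v)) = v"
    if X: "finite X" "r' \<in> equivs X" and v: "v \<in> vcarrier (PQ X r')" for X r' v
  proof -
    let ?B = "quot X r'"
    have fB: "finite ?B" by (rule finite_quot[OF X(1)])
    have "contract_left (PQ X r) (P ?B) (e (quot X r)) (dq X r' r v) =
        contract_left (PQ ?B (quot_rel r' r)) (P ?B) (e (quot ?B (quot_rel r' r))) (delta ?B (quot_rel r' r) v)"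
      if r: "r \<in> equivs X" "r' \<subseteq> r" for r
    proof -
      note R = X(1) r(1) X(2) r(2)
      let ?q = "quot_rel r' r"
      have "contract_left (PQ X r) (P ?B) (e (quot X r)) (dq X r' r v) =
          id (contract_left (PQ ?B ?q) (P ?B) (\<lambda>u. e (quot X r) (act (quot ?B ?q) flatten u)) (delta ?B ?q v))"
        unfolding delta_quot_def
        by (rule contract_left_tmap)
          (intro vec_space_P finite_quot X(1) act_flatten_linear R linear_on_id[folded id_def] e linear_on_in[OF delta_quot_rel_linear[OF R] v])+
      \<comment> \<open>The counit is invariant under bijections, in particular under
        \<open>flatten\<close>.\<close>
      also have "contract_left (PQ ?B ?q) (P ?B) (\<lambda>u. e (quot X r) (act (quot ?B ?q) flatten u)) =
          contract_left (PQ ?B ?q) (P ?B) (e (quot ?B ?q))"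
        by (rule contract_cong(1)) (use enat[OF finite_quot[OF fB] flatten_quot(2)[OF R]] in \<open>simp add: flatten_quot(1)[OF R]\<close>)
      finally show ?thesis by simp
    qed
    then have "(\<Sum>r | r \<in> equivs X \<and> r' \<subseteq> r. contract_left (PQ X r) (P ?B) (e (quot X r)) (dq X r' r v)) =
        (\<Sum>r | r \<in> equivs X \<and> r' \<subseteq> r. contract_left (PQ ?B (quot_rel r' r)) (P ?B) (e (quot ?B (quot_rel r' r))) (delta ?B (quot_rel r' r) v))"
      by (intro sum.cong) auto
    \<comment> \<open>The relations on X coarser than \<open>r'\<close> are reindexed as the
      equivalences on X/r', to which the counit axiom refers.\<close>
    also have "\<dots> = (\<Sum>q \<in> equivs ?B. contract_left (PQ ?B q) (P ?B) (e (quot ?B q)) (delta ?B q v))"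
      by (rule sum.reindex_bij_betw[OF quot_rel_bij[OF X]])
    also have "\<dots> = v" by (rule eleft[OF fB v])
    finally show ?thesis .
  qed
  show ?thesis
    by (rule exI[of _ e]) (auto simp: e enat right left)
qed

text \<open>On the empty set every function agrees with the identity, so the flattening acts
  trivially.\<close>

lemma dq_empty:
  assumes v: "v \<in> vcarrier (P {})"
  shows "dq {} {} {} v = delta {} {} v"
proof -
  have E: "finite {}" "{} \<in> equivs {}" by (simp_all add: equivs_empty)
  have q: "quot_rel {} {} = {}" by (simp add: quot_rel_def)
  have d: "delta {} {} v \<in> vcarrier (P {} \<otimes> P {})"
    using linear_on_in[OF delta_linear[OF E] v] by (simp add: quot_empty)
  have "tmap (P {}) (P {}) (P {}) (P {}) (act {} flatten) id = tmap (P {}) (P {}) (P {}) (P {}) (\<lambda>v. v) (\<lambda>v. v)"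
    using act_cong[OF E(1), of flatten id] act_id[OF E(1)] by (intro tmap_cong) auto
  then show ?thesis using tmap_id[OF vec_space_P vec_space_P d] E(1) by (simp add: delta_quot_def q quot_empty)
qed

end

section \<open>The coproduct on \<open>P \<circ> Com\<close> induced by \<open>delta\<close>\<close>

context hf_contraction_extraction
begin

abbreviation delta' where "delta' \<equiv> com_delta P act delta"
text \<open>In the order on equivalences these are the r \<le> r', which as sets of pairs contain
  \<open>r'\<close>: the index set of the sum defining \<open>delta'\<close> on P[X/r'].\<close>

abbreviation coarser :: "'a hf set \<Rightarrow> ('a hf \<times> 'a hf) set \<Rightarrow> ('a hf \<times> 'a hf) set set" where
  "coarser X r' \<equiv> {r. r \<in> equivs X \<and> r' \<subseteq> r}"

lemma finite_coarser: "finite X \<Longrightarrow> finite (coarser X r')"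
  using finite_equivs[of X] by (rule finite_subset[rotated]) auto

lemma com_delta_summand_linear:
  assumes X: "finite X" "r' \<in> equivs X"
  shows "linear_on (PQ X r') (P' X \<otimes> P' X) (\<lambda>v. \<Sum>r\<in>coarser X r'.
    in2 X r X r' (dq X r' r v))"
  by (rule linear_on_sum[OF vec_space_tensor[OF vec_space_com[OF X(1)] vec_space_com[OF X(1)]]])
    (rule linear_on_comp[OF dq_linear tmap_linear], auto intro: vec_space_P_quot vec_space_com com_in_linear X)

lemma com_delta_linear:
  assumes X: "finite X"
  shows "linear_on (P' X) (P' X \<otimes> P' X) (delta' X)"
  unfolding com_delta_def
  by (rule com_family_linear[OF vec_space_tensor[OF vec_space_com[OF X] vec_space_com[OF X]] com_delta_summand_linear[OF X]])

lemma com_delta_in: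
  assumes X: "finite X" "r' \<in> equivs X"
  shows "delta' X (com_in r' v) = (\<Sum>r\<in>coarser X r'.
    in2 X r X r' (dq X r' r v))"
  unfolding com_delta_def by (rule com_family_in[OF X(1) com_delta_summand_linear[OF X(1)] X(2)])

lemma dq_closed:
  "finite X \<Longrightarrow> r' \<in> equivs X \<Longrightarrow> r \<in> coarser X r' \<Longrightarrow> v \<in> vcarrier (PQ X r') \<Longrightarrow>
    dq X r' r v \<in> vcarrier (PQ X r \<otimes> PQ X r')"
  by (rule linear_on_in[OF dq_linear]) auto

text \<open>The counterpart of \<open>com_comult_tmap\<close> for a second application of
  \<open>delta'\<close>, again with \<open>g\<close> as the inclusion of the factor left
  alone.\<close>

lemma com_delta_tmap:
  fixes W :: "('k, 'w::ab_group_add) kspace" and W' :: "('k, 'w2::ab_group_add) kspace"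
  assumes X: "finite X" "r' \<in> equivs X" and W: "vec_space W" "vec_space W'" "linear_on W W' g"
  shows "t \<in> vcarrier (PQ X r' \<otimes> W) \<Longrightarrow>
    tmap (PQ X r') W (P' X \<otimes> P' X) W' (\<lambda>v. delta' X (com_in r' v)) g t =
    (\<Sum>r\<in>coarser X r'. tmap (PQ X r \<otimes> PQ X r') W (P' X \<otimes> P' X) W'
      (in2 X r X r') g
      (tmap (PQ X r') W (PQ X r \<otimes> PQ X r') W (dq X r' r) id t))" (is "_ \<Longrightarrow> ?left")
   and "t' \<in> vcarrier (W \<otimes> PQ X r') \<Longrightarrow>
    tmap W (PQ X r') W' (P' X \<otimes> P' X) g (\<lambda>v. delta' X (com_in r' v)) t' =
    (\<Sum>r\<in>coarser X r'. tmap W (PQ X r \<otimes> PQ X r') W' (P' X \<otimes> P' X) g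
      (in2 X r X r')
      (tmap W (PQ X r') W (PQ X r \<otimes> PQ X r') id (dq X r' r) t'))" (is "_ \<Longrightarrow> ?right")
proof -
  note vs = vec_space_P_quot vec_space_com X vec_space_tensor W
  note lid = linear_on_id[folded id_def]
  let ?Q = "P' X"
  let ?in = "\<lambda>r. tmap (PQ X r) (PQ X r') ?Q ?Q (com_in r) (com_in r')"
  have l: "linear_on (PQ X r') (PQ X r \<otimes> PQ X r') (dq X r' r)" if "r \<in> coarser X r'" for r
    using that by (intro dq_linear X) auto
  have li: "linear_on (PQ X r \<otimes> PQ X r') (?Q \<otimes> ?Q) (?in r)" if "r \<in> coarser X r'" for r
    using that by (intro tmap_linear com_in_linear vs) auto
  show ?left if t: "t \<in> vcarrier (PQ X r' \<otimes> W)"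
  proof -
    have "tmap (PQ X r') W (?Q \<otimes> ?Q) W' (\<lambda>v. delta' X (com_in r' v)) g t =
        (\<Sum>r\<in>coarser X r'. tmap (PQ X r') W (?Q \<otimes> ?Q) W' (\<lambda>v. ?in r (dq X r' r v)) g t)"
      unfolding com_delta_in[OF X]
      by (rule tmap_sum_left) (intro vs linear_on_comp[OF l li] t | assumption)+
    then show ?thesis
      unfolding id_def
      by (rule trans, intro sum.cong[OF refl] tmap_tmap[symmetric]) (intro vs l li linear_on_id t | assumption)+
  qed
  show ?right if t: "t' \<in> vcarrier (W \<otimes> PQ X r')"
  proof -
    have "tmap W (PQ X r') W' (?Q \<otimes> ?Q) g (\<lambda>v. delta' X (com_in r' v)) t' =
        (\<Sum>r\<in>coarser X r'. tmap W (PQ X r') W' (?Q \<otimes> ?Q) g (\<lambda>v. ?in r (dq X r' r v)) t')"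
      unfolding com_delta_in[OF X]
      by (rule tmap_sum_right) (intro vs linear_on_comp[OF l li] t | assumption)+
    then show ?thesis
      unfolding id_def
      by (rule trans, intro sum.cong[OF refl] tmap_tmap[symmetric]) (intro vs l li linear_on_id t | assumption)+
  qed
qed

lemma com_delta_natural:
  assumes X: "finite X" and s: "inj_on s X" and v: "v \<in> vcarrier (P' X)"
  shows "delta' (s ` X) (act' X s v) =
    tmap (P' X) (P' X) (P' (s ` X)) (P' (s ` X)) (act' X s) (act' X s)
      (delta' X v)"
proof -
  let ?Q = "P' X" and ?Q' = "P' (s ` X)"
  have X': "finite (s ` X)" using X by simp
  note vs = vec_space_P_quot vec_space_com X X' vec_space_tensor
  have lt: "linear_on (?Q \<otimes> ?Q) (?Q' \<otimes> ?Q') (tmap ?Q ?Q ?Q' ?Q' (act' X s) (act' X s))"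
    by (intro tmap_linear vs com_act_linear s)
  show ?thesis
  proof (rule com_ext[OF X _ _ _ v])
    show "linear_on ?Q (?Q' \<otimes> ?Q') (\<lambda>v. delta' (s ` X) (act' X s v))"
      by (rule linear_on_comp[OF com_act_linear[OF X s] com_delta_linear[OF X']])
    show "linear_on ?Q (?Q' \<otimes> ?Q') (\<lambda>v. tmap ?Q ?Q ?Q' ?Q' (act' X s) (act' X s) (delta' X v))"
      by (rule linear_on_comp[OF com_delta_linear[OF X] lt])
  next
    fix r' v assume r': "r' \<in> equivs X" and v: "v \<in> vcarrier (PQ X r')"
    note tr' = transport_equivs[OF s r']
    let ?a' = "act (quot X r') (quot_map s)"
    \<comment> \<open>Transport matches the index sets of the two sums, since it preserves and
      reflects inclusion.\<close>
    have bij: "bij_betw (transport s) (coarser X r') {r \<in> equivs (s ` X). transport s r' \<subseteq> r}"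
    proof (rule bij_betw_subset[OF transport_bij[OF s]])
      show "transport s ` coarser X r' = {r \<in> equivs (s ` X). transport s r' \<subseteq> r}"
      proof (intro equalityI subsetI)
        fix q assume q: "q \<in> {r \<in> equivs (s ` X). transport s r' \<subseteq> r}"
        then have "q \<in> transport s ` equivs X" using transport_bij[OF s] by (simp add: bij_betw_def)
        then obtain r where r: "r \<in> equivs X" "q = transport s r" by blast
        then show "q \<in> transport s ` coarser X r'" using q transport_subset_iff[OF s r(1) r'] by auto
      qed (use transport_equivs[OF s] transport_mono[of r'] in blast)
    qed auto
    have "delta' (s ` X) (act' X s (com_in r' v)) =
        (\<Sum>r\<in>coarser X r'. tmap (PQ (s ` X) (transport s r)) (PQ (s ` X) (transport s r')) ?Q' ?Q'
          (com_in (transport s r)) (com_in (transport s r')) (dq (s ` X) (transport s r') (transport s r) (?a' v)))"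
      unfolding com_act_in[OF X s r'] com_delta_in[OF X' tr'] by (rule sum.reindex_bij_betw[OF bij, symmetric])
    also have "\<dots> = (\<Sum>r\<in>coarser X r'. tmap ?Q ?Q ?Q' ?Q' (act' X s) (act' X s)
        (tmap (PQ X r) (PQ X r') ?Q ?Q (com_in r) (com_in r') (dq X r' r v)))"
    proof (rule sum.cong[OF refl])
      fix r assume rc: "r \<in> coarser X r'"
      then have r: "r \<in> equivs X" "r' \<subseteq> r" by auto
      note tr = transport_equivs[OF s r(1)] and d = dq_closed[OF X r' rc v]
      let ?a = "act (quot X r) (quot_map s)"
      let ?A = "PQ X r" and ?B = "PQ X r'" and ?A' = "PQ (s ` X) (transport s r)" and ?B' = "PQ (s ` X) (transport s r')"
      have 1: "tmap ?A' ?B' ?Q' ?Q' (com_in (transport s r)) (com_in (transport s r')) (tmap ?A ?B ?A' ?B' ?a ?a' (dq X r' r v)) =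
          tmap ?A ?B ?Q' ?Q' (\<lambda>x. com_in (transport s r) (?a x)) (\<lambda>x. com_in (transport s r') (?a' x)) (dq X r' r v)"
        by (rule tmap_tmap) (intro vs com_in_linear act_quot_linear s r r' tr tr' d)+
      have 2: "tmap ?Q ?Q ?Q' ?Q' (act' X s) (act' X s) (tmap ?A ?B ?Q ?Q (com_in r) (com_in r') (dq X r' r v)) =
          tmap ?A ?B ?Q' ?Q' (\<lambda>x. act' X s (com_in r x)) (\<lambda>x. act' X s (com_in r' x)) (dq X r' r v)"
        by (rule tmap_tmap) (intro vs com_in_linear com_act_linear s r r' d)+
      show "tmap ?A' ?B' ?Q' ?Q' (com_in (transport s r)) (com_in (transport s r')) (dq (s ` X) (transport s r') (transport s r) (?a' v)) =
          tmap ?Q ?Q ?Q' ?Q' (act' X s) (act' X s) (tmap ?A ?B ?Q ?Q (com_in r) (com_in r') (dq X r' r v))"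
        unfolding dq_natural[OF X r(1) r' r(2) s v] 1 2 com_act_in[OF X s r(1)] com_act_in[OF X s r'] by (rule refl)
    qed
    also have "\<dots> = tmap ?Q ?Q ?Q' ?Q' (act' X s) (act' X s) (delta' X (com_in r' v))"
      unfolding com_delta_in[OF X r']
      by (rule linear_on_map_sum[OF _ lt, symmetric], intro vs,
          rule linear_on_in[OF tmap_linear dq_closed]) (auto intro: vs com_in_linear r' v X)
    finally show "delta' (s ` X) (act' X s (com_in r' v)) =
      tmap ?Q ?Q ?Q' ?Q' (act' X s) (act' X s) (delta' X (com_in r' v))" .
  qed
qed

lemma com_delta_coassoc:
  assumes X: "finite X" and v: "v \<in> vcarrier (P' X)"
  shows "tassoc (P' X) (P' X) (P' X)
      (tmap (P' X) (P' X) (P' X \<otimes> P' X) (P' X) (delta' X) id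
        (delta' X v)) =
    tmap (P' X) (P' X) (P' X) (P' X \<otimes> P' X) id (delta' X)
      (delta' X v)"
proof -
  let ?Q = "P' X" and ?d = "delta' X"
  note vs = vec_space_P_quot vec_space_com X vec_space_tensor
  note lid = linear_on_id[folded id_def]
  note ld = com_delta_linear[OF X]
  have lta: "linear_on (?Q \<otimes> ?Q \<otimes> ?Q) (?Q \<otimes> (?Q \<otimes> ?Q)) (tassoc ?Q ?Q ?Q)" by (intro tassoc_linear vs)
  have ll: "linear_on (?Q \<otimes> ?Q) (?Q \<otimes> (?Q \<otimes> ?Q)) (\<lambda>t. tassoc ?Q ?Q ?Q (tmap ?Q ?Q (?Q \<otimes> ?Q) ?Q ?d id t))"
    by (intro linear_on_comp[OF tmap_linear lta] vs ld lid)
  have lr: "linear_on (?Q \<otimes> ?Q) (?Q \<otimes> (?Q \<otimes> ?Q)) (tmap ?Q ?Q ?Q (?Q \<otimes> ?Q) id ?d)"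
    by (intro tmap_linear vs ld lid)
  show ?thesis
  proof (rule com_ext[OF X linear_on_comp[OF ld ll] linear_on_comp[OF ld lr] _ v])
    fix r'' v assume r'': "r'' \<in> equivs X" and v: "v \<in> vcarrier (PQ X r'')"
    let ?P = "\<lambda>r. PQ X r"
    let ?in2 = "\<lambda>r r'. tmap (?P r) (?P r') ?Q ?Q (com_in r) (com_in r')"
    \<comment> \<open>The common term of both sides: the right-hand side of axiom (ii), carried to X
      and included into the triple tensor product. Only the ranges of \<open>r\<close> and
      \<open>r'\<close> differ between the sides.\<close>
    define T where "T r r' = tmap (?P r) (?P r' \<otimes> ?P r'') ?Q (?Q \<otimes> ?Q) (com_in r) (?in2 r' r'')
        (tmap (?P r) (?P r'') (?P r) (?P r' \<otimes> ?P r'') id (dq X r'' r') (dq X r'' r v))" for r r'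
    have in2_closed: "?in2 r r'' (dq X r'' r v) \<in> vcarrier (?Q \<otimes> ?Q)" if "r \<in> coarser X r''" for r
      using that by (intro linear_on_in[OF tmap_linear dq_closed] vs com_in_linear r'' v) auto
    have vQ: "vec_space (?Q \<otimes> ?Q)" "vec_space (?Q \<otimes> ?Q \<otimes> ?Q)" by (intro vs)+
    have L: "tassoc ?Q ?Q ?Q (tmap ?Q ?Q (?Q \<otimes> ?Q) ?Q ?d id (?d (com_in r'' v))) = (\<Sum>r'\<in>coarser X r''. \<Sum>r\<in>coarser X r'. T r r')"
    proof -
      have "tassoc ?Q ?Q ?Q (tmap ?Q ?Q (?Q \<otimes> ?Q) ?Q ?d id (?d (com_in r'' v))) =
          (\<Sum>r'\<in>coarser X r''. tassoc ?Q ?Q ?Q (tmap ?Q ?Q (?Q \<otimes> ?Q) ?Q ?d id (?in2 r' r'' (dq X r'' r' v))))"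
        unfolding com_delta_in[OF X r''] by (rule linear_on_map_sum[OF vQ(1) ll in2_closed])
      also have "\<dots> = (\<Sum>r'\<in>coarser X r''. \<Sum>r\<in>coarser X r'. T r r')"
      proof (rule sum.cong[OF refl])
        fix r' assume rc': "r' \<in> coarser X r''"
        then have r': "r' \<in> equivs X" "r'' \<subseteq> r'" by auto
        note d = dq_closed[OF X r'' rc' v]
        let ?t = "\<lambda>r. tmap (?P r') (?P r'') (?P r \<otimes> ?P r') (?P r'') (dq X r' r) id (dq X r'' r' v)"
        let ?in3 = "\<lambda>r. tmap (?P r \<otimes> ?P r') (?P r'') (?Q \<otimes> ?Q) ?Q (?in2 r r') (com_in r'')"
        have "tmap ?Q ?Q (?Q \<otimes> ?Q) ?Q ?d id (?in2 r' r'' (dq X r'' r' v)) =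
            tmap (?P r') (?P r'') (?Q \<otimes> ?Q) ?Q (\<lambda>x. ?d (com_in r' x)) (\<lambda>x. com_in r'' x) (dq X r'' r' v)"
          unfolding id_def by (rule tmap_tmap) (intro vs ld linear_on_id com_in_linear r' r'' d)+
        from trans[OF this com_delta_tmap(1)[OF X r'(1) vec_space_P_quot[OF X] vec_space_com[OF X] com_in_linear[OF X r''] d]]
        have 1: "tmap ?Q ?Q (?Q \<otimes> ?Q) ?Q ?d id (?in2 r' r'' (dq X r'' r' v)) = (\<Sum>r\<in>coarser X r'. ?in3 r (?t r))" .
        have tc: "?t r \<in> vcarrier (?P r \<otimes> ?P r' \<otimes> ?P r'')" if "r \<in> coarser X r'" for r
          using that by (intro linear_on_in[OF tmap_linear d] vs lid dq_linear r') auto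
        have "tassoc ?Q ?Q ?Q (tmap ?Q ?Q (?Q \<otimes> ?Q) ?Q ?d id (?in2 r' r'' (dq X r'' r' v))) =
            (\<Sum>r\<in>coarser X r'. tassoc ?Q ?Q ?Q (?in3 r (?t r)))"
          unfolding 1
          by (rule linear_on_map_sum[OF vQ(2) lta], rule linear_on_in[OF tmap_linear tc])
            (auto intro: vs tmap_linear com_in_linear r' r'')
        also have "\<dots> = (\<Sum>r\<in>coarser X r'. T r r')"
        proof (rule sum.cong[OF refl])
          fix r assume rc: "r \<in> coarser X r'"
          then have r: "r \<in> equivs X" "r' \<subseteq> r" by auto
          have 2: "tassoc ?Q ?Q ?Q (?in3 r (?t r)) = tmap (?P r) (?P r' \<otimes> ?P r'') ?Q (?Q \<otimes> ?Q) (com_in r) (?in2 r' r'')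
              (tassoc (?P r) (?P r') (?P r'') (?t r))"
            by (rule tassoc_tmap) (intro vs com_in_linear r r' r'' tc rc)+
          show "tassoc ?Q ?Q ?Q (?in3 r (?t r)) = T r r'"
            unfolding 2 T_def dq_coassoc[OF X r(1) r'(1) r'' r'(2) r(2) v] by (rule refl)
        qed
        finally show "tassoc ?Q ?Q ?Q (tmap ?Q ?Q (?Q \<otimes> ?Q) ?Q ?d id (?in2 r' r'' (dq X r'' r' v))) = (\<Sum>r\<in>coarser X r'. T r r')" .
      qed
      finally show ?thesis .
    qed
    have R: "tmap ?Q ?Q ?Q (?Q \<otimes> ?Q) id ?d (?d (com_in r'' v)) = (\<Sum>r\<in>coarser X r''. \<Sum>r'\<in>coarser X r''. T r r')"
    proof -
      have "tmap ?Q ?Q ?Q (?Q \<otimes> ?Q) id ?d (?d (com_in r'' v)) =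
          (\<Sum>r\<in>coarser X r''. tmap ?Q ?Q ?Q (?Q \<otimes> ?Q) id ?d (?in2 r r'' (dq X r'' r v)))"
        unfolding com_delta_in[OF X r''] by (rule linear_on_map_sum[OF vQ(1) lr in2_closed])
      also have "\<dots> = (\<Sum>r\<in>coarser X r''. \<Sum>r'\<in>coarser X r''. T r r')"
      proof (rule sum.cong[OF refl])
        fix r assume rc: "r \<in> coarser X r''"
        then have r: "r \<in> equivs X" "r'' \<subseteq> r" by auto
        note d = dq_closed[OF X r'' rc v]
        have "tmap ?Q ?Q ?Q (?Q \<otimes> ?Q) id ?d (?in2 r r'' (dq X r'' r v)) =
            tmap (?P r) (?P r'') ?Q (?Q \<otimes> ?Q) (\<lambda>x. com_in r x) (\<lambda>x. ?d (com_in r'' x)) (dq X r'' r v)"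
          unfolding id_def by (rule tmap_tmap) (intro vs ld linear_on_id com_in_linear r r'' d)+
        from trans[OF this com_delta_tmap(2)[OF X r'' vec_space_P_quot[OF X] vec_space_com[OF X] com_in_linear[OF X r(1)] d]]
        show "tmap ?Q ?Q ?Q (?Q \<otimes> ?Q) id ?d (?in2 r r'' (dq X r'' r v)) = (\<Sum>r'\<in>coarser X r''. T r r')"
          unfolding T_def .
      qed
      finally show ?thesis .
    qed
    have T0: "T r r' = 0" if rc: "r \<in> coarser X r''" "r' \<in> coarser X r''" "\<not> r' \<subseteq> r" for r r'
    proof -
      have l: "linear_on (?P r \<otimes> (?P r' \<otimes> ?P r'')) (?Q \<otimes> (?Q \<otimes> ?Q)) (tmap (?P r) (?P r' \<otimes> ?P r'') ?Q (?Q \<otimes> ?Q) (com_in r) (?in2 r' r''))"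
        using rc by (intro tmap_linear vs com_in_linear r'') auto
      have z: "tmap (?P r) (?P r'') (?P r) (?P r' \<otimes> ?P r'') id (dq X r'' r') (dq X r'' r v) = 0"
        using rc by (intro dq_zero X r'' v) auto
      show ?thesis unfolding T_def z by (rule linear_on_zero[OF _ l]) (intro vs)
    qed
    \<comment> \<open>The inner range grows from the relations coarser than \<open>r'\<close> to
      those coarser than \<open>r''\<close>. The terms added are zero by \<open>T0\<close>, and the
      two indices become independent.\<close>
    have "(\<Sum>r'\<in>coarser X r''. \<Sum>r\<in>coarser X r'. T r r') = (\<Sum>r'\<in>coarser X r''. \<Sum>r\<in>coarser X r''. T r r')"
      by (intro sum.cong refl sum.mono_neutral_left finite_coarser X) (auto intro!: T0)
    also have "\<dots> = (\<Sum>r\<in>coarser X r''. \<Sum>r'\<in>coarser X r''. T r r')" by (rule sum.swap)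
    finally show "tassoc ?Q ?Q ?Q (tmap ?Q ?Q (?Q \<otimes> ?Q) ?Q ?d id (?d (com_in r'' v))) = tmap ?Q ?Q ?Q (?Q \<otimes> ?Q) id ?d (?d (com_in r'' v))"
      unfolding L R .
  qed
qed

lemma com_delta_counit:
  "\<exists>e. \<forall>X. finite X \<longrightarrow>
     linear_on (P' X) scalars (e X) \<and>
     (\<forall>s. inj_on s X \<longrightarrow> (\<forall>v \<in> vcarrier (P' X). e (s ` X) (act' X s v) = e X v)) \<and>
     (\<forall>v \<in> vcarrier (P' X).
        contract_left (P' X) (P' X) (e X) (delta' X v) = v \<and>
        contract_right (P' X) (P' X) (e X) (delta' X v) = v)"
proof -
  from dq_counit obtain e where H: "\<forall>X. finite X \<longrightarrow>
     linear_on (P X) scalars (e X) \<and>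
     (\<forall>s. inj_on s X \<longrightarrow> (\<forall>v \<in> vcarrier (P X). e (s ` X) (act X s v) = e X v)) \<and>
     (\<forall>r' \<in> equivs X. \<forall>v \<in> vcarrier (PQ X r').
        (\<forall>r \<in> equivs X. r' \<subseteq> r \<longrightarrow> contract_right (PQ X r) (PQ X r') (e (quot X r')) (dq X r' r v) =
           (if r = r' then v else 0)) \<and>
        (\<Sum>r | r \<in> equivs X \<and> r' \<subseteq> r. contract_left (PQ X r) (PQ X r') (e (quot X r)) (dq X r' r v)) = v)" ..
  note e = H[THEN spec, THEN mp, THEN conjunct1]
    and enat = H[THEN spec, THEN mp, THEN conjunct2, THEN conjunct1, rule_format]
    and eright = H[THEN spec, THEN mp, THEN conjunct2, THEN conjunct2, THEN bspec, THEN bspec, THEN conjunct1, rule_format]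
    and eleft = H[THEN spec, THEN mp, THEN conjunct2, THEN conjunct2, THEN bspec, THEN bspec, THEN conjunct2]
  define e' where "e' X f = (\<Sum>r\<in>equivs X. e (quot X r) (f r))" for X and f :: "('a, 'v) com"
  have lin: "linear_on (P' X) scalars (e' X)" if X: "finite X" for X
    unfolding e'_def by (rule com_family_linear[OF vec_space_scalars e[OF finite_quot[OF X]]])
  have ein: "e' X (com_in r v) = e (quot X r) v" if X: "finite X" "r \<in> equivs X" for X r v
    unfolding e'_def by (rule com_family_in[OF X(1) e[OF finite_quot[OF X(1)]] X(2)])
  have nat: "e' (s ` X) (act' X s v) = e' X v"
    if X: "finite X" and s: "inj_on s X" and v: "v \<in> vcarrier (P' X)" for X s v
  proof (rule com_ext[OF X linear_on_comp[OF com_act_linear[OF X s] lin[OF finite_imageI[OF X]]] lin[OF X] _ v])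
    fix r v assume r: "r \<in> equivs X" and v: "v \<in> vcarrier (PQ X r)"
    show "e' (s ` X) (act' X s (com_in r v)) = e' X (com_in r v)"
      using enat[OF finite_quot[OF X] inj_on_quot_map[OF s X r] v]
      by (simp add: com_act_in X s r ein transport_equivs quot_transport)
  qed
  have main: "contract_left (P' X) (P' X) (e' X) (delta' X v) = v"
    "contract_right (P' X) (P' X) (e' X) (delta' X v) = v"
    if X: "finite X" and v: "v \<in> vcarrier (P' X)" for X v
  proof -
    let ?Q = "P' X" and ?d = "delta' X" and ?P = "\<lambda>r. PQ X r"
    note vs = vec_space_P_quot vec_space_com X vec_space_tensor
    note vQ = vec_space_com[OF X]
    note ld = com_delta_linear[OF X]
    note ll = contract_left_linear[OF vQ vQ lin[OF X]] and lr = contract_right_linear[OF vQ vQ lin[OF X]]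
    have cl: "tmap (?P r) (?P r') ?Q ?Q (com_in r) (com_in r') (dq X r' r v) \<in> vcarrier (?Q \<otimes> ?Q)"
      if "r' \<in> equivs X" "r \<in> coarser X r'" "v \<in> vcarrier (?P r')" for r r' v
      using that by (intro linear_on_in[OF tmap_linear dq_closed] vs com_in_linear) auto
    show "contract_left ?Q ?Q (e' X) (?d v) = v"
    proof (rule com_ext[OF X linear_on_comp[OF ld ll] linear_on_id _ v])
      fix r' v assume r': "r' \<in> equivs X" and v: "v \<in> vcarrier (?P r')"
      have "contract_left ?Q ?Q (e' X) (?d (com_in r' v)) =
          (\<Sum>r\<in>coarser X r'. contract_left ?Q ?Q (e' X) (tmap (?P r) (?P r') ?Q ?Q (com_in r) (com_in r') (dq X r' r v)))"
        unfolding com_delta_in[OF X r'] by (rule linear_on_map_sum[OF vec_space_tensor[OF vQ vQ] ll cl[OF r' _ v]])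
      \<comment> \<open>Every term stays in the summand of index \<open>r'\<close>, because
        \<open>dq\<close> keeps the extracted factor on X/r'; the sum is thus the one in the counit
        law of \<open>P\<close>.\<close>
      also have "\<dots> = (\<Sum>r\<in>coarser X r'. com_in r' (contract_left (?P r) (?P r') (e (quot X r)) (dq X r' r v)))"
      proof (rule sum.cong[OF refl])
        fix r assume rc: "r \<in> coarser X r'"
        then have r: "r \<in> equivs X" by simp
        show "contract_left ?Q ?Q (e' X) (tmap (?P r) (?P r') ?Q ?Q (com_in r) (com_in r') (dq X r' r v)) =
            com_in r' (contract_left (?P r) (?P r') (e (quot X r)) (dq X r' r v))"
          using contract_left_tmap[OF vec_space_P_quot[OF X] vec_space_P_quot[OF X] vQ vQ com_in_linear[OF X r] com_in_linear[OF X r']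
              lin[OF X] dq_closed[OF X r' rc v]] by (simp add: ein[OF X r])
      qed
      also have "\<dots> = com_in r' (\<Sum>r\<in>coarser X r'. contract_left (?P r) (?P r') (e (quot X r)) (dq X r' r v))"
        by (rule linear_on_map_sum[OF vec_space_P_quot[OF X] com_in_linear[OF X r'], symmetric])
          (rule linear_on_in[OF contract_left_linear dq_closed], auto intro: vs e finite_quot r' v)
      also have "\<dots> = com_in r' v" by (simp only: eleft[OF X r' v])
      finally show "contract_left ?Q ?Q (e' X) (?d (com_in r' v)) = com_in r' v" .
    qed
    show "contract_right ?Q ?Q (e' X) (?d v) = v"
    proof (rule com_ext[OF X linear_on_comp[OF ld lr] linear_on_id _ v])
      fix r' v assume r': "r' \<in> equivs X" and v: "v \<in> vcarrier (?P r')"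
      have "contract_right ?Q ?Q (e' X) (?d (com_in r' v)) =
          (\<Sum>r\<in>coarser X r'. contract_right ?Q ?Q (e' X) (tmap (?P r) (?P r') ?Q ?Q (com_in r) (com_in r') (dq X r' r v)))"
        unfolding com_delta_in[OF X r'] by (rule linear_on_map_sum[OF vec_space_tensor[OF vQ vQ] lr cl[OF r' _ v]])
      \<comment> \<open>Here the term of index \<open>r\<close> lands in the summand of index
        \<open>r\<close>, and the counit leaves only the diagonal one.\<close>
      also have "\<dots> = (\<Sum>r\<in>coarser X r'. if r = r' then com_in r' v else 0)"
      proof (rule sum.cong[OF refl])
        fix r assume rc: "r \<in> coarser X r'"
        then have r: "r \<in> equivs X" "r' \<subseteq> r" by simp_all
        show "contract_right ?Q ?Q (e' X) (tmap (?P r) (?P r') ?Q ?Q (com_in r) (com_in r') (dq X r' r v)) =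
            (if r = r' then com_in r' v else 0)"
          using contract_right_tmap[OF vec_space_P_quot[OF X] vec_space_P_quot[OF X] vQ vQ com_in_linear[OF X r(1)] com_in_linear[OF X r']
              lin[OF X] dq_closed[OF X r' rc v]] eright[OF X r' v r] linear_on_zero[OF vec_space_P_quot[OF X] com_in_linear[OF X r(1)]]
          by (simp add: ein[OF X r'])
      qed
      also have "\<dots> = com_in r' v" using r' finite_coarser[OF X] by simp
      finally show "contract_right ?Q ?Q (e' X) (?d (com_in r' v)) = com_in r' v" .
    qed
  qed
  show ?thesis by (rule exI[of _ e']) (simp add: lin nat main)
qed

end

section \<open>Compatibility of the internal coproduct with product and coproduct\<close>

locale hf_double_bialgebra = hf_twisted_bialgebra P act m one D counit + contraction_extraction P act delta
  for P :: "'a hf set \<Rightarrow> ('k::field, 'v::ab_group_add) kspace" and act m one D counit delta +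
  assumes delta_m: "finite X \<Longrightarrow> finite Y \<Longrightarrow> X \<inter> Y = {} \<Longrightarrow> r \<in> equivs (X \<union> Y) \<Longrightarrow>
      t \<in> vcarrier (P X \<otimes> P Y) \<Longrightarrow>
      delta (X \<union> Y) r (m X Y t) =
        (let rX = r \<inter> X \<times> X; rY = r \<inter> Y \<times> Y in
         if r = rX \<union> rY
         then tmap (P (quot X rX) \<otimes> P (quot Y rY)) (P X \<otimes> P Y) (P (quot (X \<union> Y) r)) (P (X \<union> Y))
                (m (quot X rX) (quot Y rY)) (m X Y)
                (tswap_mid (P (quot X rX)) (P X) (P (quot Y rY)) (P Y)
                  (tmap (P X) (P Y) (P (quot X rX) \<otimes> P X) (P (quot Y rY) \<otimes> P Y)
                    (delta X rX) (delta Y rY) t))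
         else 0)"
    and delta_D: "finite X \<Longrightarrow> finite Y \<Longrightarrow> X \<inter> Y = {} \<Longrightarrow> r \<in> equivs (X \<union> Y) \<Longrightarrow>
      rX = r \<inter> X \<times> X \<Longrightarrow> rY = r \<inter> Y \<times> Y \<Longrightarrow> r = rX \<union> rY \<Longrightarrow> v \<in> vcarrier (P (X \<union> Y)) \<Longrightarrow>
      tmap (P (quot (X \<union> Y) r)) (P (X \<union> Y)) (P (quot X rX) \<otimes> P (quot Y rY)) (P (X \<union> Y))
        (D (quot X rX) (quot Y rY)) id (delta (X \<union> Y) r v) =
      m1324 (P (quot X rX)) (P X) (P (quot Y rY)) (P Y) (P (X \<union> Y)) (m X Y)
        (tmap (P X) (P Y) (P (quot X rX) \<otimes> P X) (P (quot Y rY) \<otimes> P Y)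
          (delta X rX) (delta Y rY) (D X Y v))"
    and delta_one: "delta {} {} one = ten (P {}) (P {}) one one"
    and delta_D_counit: "v \<in> vcarrier (P {}) \<Longrightarrow>
      contract_left (P {}) (P {}) counit (delta {} {} v) = vscale (P {}) (counit v) one"

sublocale hf_double_bialgebra \<subseteq> hf_contraction_extraction P act delta
  by (simp add: hf_contraction_extraction_def hf_species_axioms contraction_extraction_axioms)

context hf_double_bialgebra
begin

text \<open>Takes the flattenings out of both factors at once, so that the hypotheses on
  \<open>delta\<close> can be applied to the pair of quotients.\<close>

lemma tmap_dq:
  assumes X: "finite X" "finite Y" "rX \<in> equivs X" "rX' \<in> equivs X" "rX' \<subseteq> rX" "rY \<in> equivs Y" "rY' \<in> equivs Y" "rY' \<subseteq> rY"
    and t: "t \<in> vcarrier (PQ X rX' \<otimes> PQ Y rY')"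
  shows "tmap (PQ X rX') (PQ Y rY') (PQ X rX \<otimes> PQ X rX') (PQ Y rY \<otimes> PQ Y rY') (dq X rX' rX) (dq Y rY' rY) t =
    tmap (P (iq X rX' rX) \<otimes> PQ X rX') (P (iq Y rY' rY) \<otimes> PQ Y rY')
      (PQ X rX \<otimes> PQ X rX') (PQ Y rY \<otimes> PQ Y rY')
      (tmap (P (iq X rX' rX)) (PQ X rX') (PQ X rX) (PQ X rX')
        (fl X rX' rX) (\<lambda>x. x))
      (tmap (P (iq Y rY' rY)) (PQ Y rY') (PQ Y rY) (PQ Y rY')
        (fl Y rY' rY) (\<lambda>x. x))
      (tmap (PQ X rX') (PQ Y rY') (P (iq X rX' rX) \<otimes> PQ X rX') (P (iq Y rY' rY) \<otimes> PQ Y rY')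
        (delta (quot X rX') (quot_rel rX' rX)) (delta (quot Y rY') (quot_rel rY' rY)) t)"
  unfolding delta_quot_def[abs_def] id_def
  by (rule tmap_tmap[symmetric])
    (intro vec_space_tensor vec_space_P finite_quot tmap_linear act_flatten_linear linear_on_id delta_quot_rel_linear X t)+

text \<open>The hypotheses on \<open>delta\<close> are used for the disjoint sets X/rX' and Y/rY'.
  What remains is to remove the flattenings: the one on the quotient of the union is given by the
  same function as those on the two pieces, so naturality of \<open>m\<close> and of
  \<open>D\<close> exchanges it for the pair.\<close>

lemma
  assumes X: "finite X" "finite Y" "X \<inter> Y = {}" and r': "rX' \<in> equivs X" "rY' \<in> equivs Y"
    and r: "rX \<in> equivs X" "rX' \<subseteq> rX" "rY \<in> equivs Y" "rY' \<subseteq> rY"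
  shows dq_m: "t \<in> vcarrier (PQ X rX' \<otimes> PQ Y rY') \<Longrightarrow>
    dq (X \<union> Y) (rX' \<union> rY') (rX \<union> rY) (m (quot X rX') (quot Y rY') t) =
    tmap (PQ X rX \<otimes> PQ Y rY) (PQ X rX' \<otimes> PQ Y rY')
      (PQ (X \<union> Y) (rX \<union> rY)) (PQ (X \<union> Y) (rX' \<union> rY'))
      (m (quot X rX) (quot Y rY)) (m (quot X rX') (quot Y rY'))
      (tswap_mid (PQ X rX) (PQ X rX') (PQ Y rY) (PQ Y rY')
        (tmap (PQ X rX') (PQ Y rY') (PQ X rX \<otimes> PQ X rX') (PQ Y rY \<otimes> PQ Y rY')
          (dq X rX' rX) (dq Y rY' rY) t))" (is "_ \<Longrightarrow> ?m")
    and dq_D: "v \<in> vcarrier (PQ (X \<union> Y) (rX' \<union> rY')) \<Longrightarrow>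
    tmap (PQ (X \<union> Y) (rX \<union> rY)) (PQ (X \<union> Y) (rX' \<union> rY')) (PQ X rX \<otimes> PQ Y rY) (PQ (X \<union> Y) (rX' \<union> rY'))
      (D (quot X rX) (quot Y rY)) id (dq (X \<union> Y) (rX' \<union> rY') (rX \<union> rY) v) =
    m1324 (PQ X rX) (PQ X rX') (PQ Y rY) (PQ Y rY') (PQ (X \<union> Y) (rX' \<union> rY')) (m (quot X rX') (quot Y rY'))
      (tmap (PQ X rX') (PQ Y rY') (PQ X rX \<otimes> PQ X rX') (PQ Y rY \<otimes> PQ Y rY')
        (dq X rX' rX) (dq Y rY' rY) (D (quot X rX') (quot Y rY') v))" (is "_ \<Longrightarrow> ?D")
proof -
  let ?B = "quot X rX'" and ?C = "quot Y rY'" and ?p = "quot_rel rX' rX" and ?q = "quot_rel rY' rY"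
  have fin: "finite ?B" "finite ?C" "finite (X \<union> Y)" using X by (auto intro: finite_quot)
  note RX = X(1) r(1) r'(1) r(2) and RY = X(2) r(3) r'(2) r(4)
  note e = equivs_Un[OF r(1,3) X(3)] equivs_Un[OF r' X(3)]
  have sub: "rX' \<union> rY' \<subseteq> rX \<union> rY" using r by auto
  note pq = quot_rel_equivs[OF RX] quot_rel_equivs[OF RY]
  have BC: "quot (X \<union> Y) (rX' \<union> rY') = ?B \<union> ?C" by (rule quot_Un[OF r' X(3)])
  have qr: "quot_rel (rX' \<union> rY') (rX \<union> rY) = ?p \<union> ?q" by (rule quot_rel_Un[OF X r' r(1,3)])
  have disj: "?B \<inter> ?C = {}" by (rule quot_disjoint[OF X(1,2) r' X(3)])
  note epq = equivs_Un[OF pq disj]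
  have Bp: "quot (?B \<union> ?C) (?p \<union> ?q) = quot ?B ?p \<union> quot ?C ?q" by (rule quot_Un[OF pq disj])
  have disj2: "quot ?B ?p \<inter> quot ?C ?q = {}" by (rule quot_disjoint[OF fin(1,2) pq disj])
  note R = fin(3) e sub
  note flX = flatten_quot[OF RX] and flY = flatten_quot[OF RY] and flq = flatten_quot[OF R, unfolded BC qr Bp]
  let ?PB = "P ?B" and ?PC = "P ?C" and ?PBp = "PQ ?B ?p" and ?PCq = "PQ ?C ?q"
  let ?RX = "PQ X rX" and ?RY = "PQ Y rY"
  let ?fX = "act (quot ?B ?p) flatten" and ?fY = "act (quot ?C ?q) flatten"
  let ?f = "act (quot ?B ?p \<union> quot ?C ?q) flatten"
  let ?PBC = "P (?B \<union> ?C)" and ?RXY = "PQ (X \<union> Y) (rX \<union> rY)" and ?Ppq = "P (quot ?B ?p \<union> quot ?C ?q)"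
  have RXY: "quot (X \<union> Y) (rX \<union> rY) = quot X rX \<union> quot Y rY" by (rule quot_Un[OF r(1,3) X(3)])
  have disjR: "quot X rX \<inter> quot Y rY = {}" by (rule quot_disjoint[OF X(1,2) r(1,3) X(3)])
  have fp: "finite (quot ?B ?p)" "finite (quot ?C ?q)" using fin by (auto intro: finite_quot)
  note vs = vec_space_P finite_quot X(1,2) fin finite_UnI vec_space_tensor
  note l = act_flatten_linear[OF RX] act_flatten_linear[OF RY] act_flatten_linear[OF R, unfolded BC qr Bp]
  note dl = delta_quot_rel_linear[OF RX] delta_quot_rel_linear[OF RY] delta_quot_rel_linear[OF R, unfolded BC qr Bp]
  show ?m if t: "t \<in> vcarrier (PQ X rX' \<otimes> PQ Y rY')"
  proof -
    note ml = m_linear[OF fp disj2] m_linear[OF fin(1,2) disj] m_quot_linear[OF X r(1,3)]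
    let ?dd = "tmap ?PB ?PC (?PBp \<otimes> ?PB) (?PCq \<otimes> ?PC) (delta ?B ?p) (delta ?C ?q) t"
    have ddl: "linear_on (?PB \<otimes> ?PC) ((?PBp \<otimes> ?PB) \<otimes> (?PCq \<otimes> ?PC)) (tmap ?PB ?PC (?PBp \<otimes> ?PB) (?PCq \<otimes> ?PC) (delta ?B ?p) (delta ?C ?q))"
      by (intro tmap_linear dl vs)
    note dd = linear_on_in[OF ddl t]
    let ?sw = "tswap_mid ?PBp ?PB ?PCq ?PC ?dd"
    have swl: "linear_on ((?PBp \<otimes> ?PB) \<otimes> (?PCq \<otimes> ?PC)) ((?PBp \<otimes> ?PCq) \<otimes> (?PB \<otimes> ?PC)) (tswap_mid ?PBp ?PB ?PCq ?PC)"
      by (intro tswap_mid_linear vs)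
    note sw = linear_on_in[OF swl dd]
    have base: "delta (?B \<union> ?C) (?p \<union> ?q) (m ?B ?C t) = tmap (?PBp \<otimes> ?PCq) (?PB \<otimes> ?PC) ?Ppq ?PBC (m (quot ?B ?p) (quot ?C ?q)) (m ?B ?C) ?sw"
      using delta_m[OF fin(1,2) disj epq t] by (simp add: equivs_restrict_Un[OF pq disj] Bp Let_def)
    have 1: "tmap ?Ppq ?PBC ?RXY ?PBC ?f (\<lambda>x. x) (tmap (?PBp \<otimes> ?PCq) (?PB \<otimes> ?PC) ?Ppq ?PBC (m (quot ?B ?p) (quot ?C ?q)) (m ?B ?C) ?sw) =
        tmap (?PBp \<otimes> ?PCq) (?PB \<otimes> ?PC) ?RXY ?PBC (\<lambda>x. ?f (m (quot ?B ?p) (quot ?C ?q) x)) (\<lambda>x. m ?B ?C x) ?sw"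
      by (rule tmap_tmap) (intro vs l ml linear_on_id sw)+
    \<comment> \<open>Naturality of the product for \<open>flatten\<close>, which is injective on
      the union of the two iterated quotients.\<close>
    have swap: "?f (m (quot ?B ?p) (quot ?C ?q) x) = m (quot X rX) (quot Y rY) (tmap ?PBp ?PCq ?RX ?RY ?fX ?fY x)"
      if x: "x \<in> vcarrier (?PBp \<otimes> ?PCq)" for x
      using m_natural[OF fp disj2 flq(2) x] by (simp add: flX(1) flY(1))
    \<comment> \<open>The second component is padded with a tensor product of identities, so that
      both components have the form in which \<open>tswap_mid_tmap\<close> delivers them.\<close>
    have 2: "tmap (?PBp \<otimes> ?PCq) (?PB \<otimes> ?PC) ?RXY ?PBC (\<lambda>x. ?f (m (quot ?B ?p) (quot ?C ?q) x)) (\<lambda>x. m ?B ?C x) =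
        tmap (?PBp \<otimes> ?PCq) (?PB \<otimes> ?PC) ?RXY ?PBC (\<lambda>x. m (quot X rX) (quot Y rY) (tmap ?PBp ?PCq ?RX ?RY ?fX ?fY x))
         (\<lambda>x. m ?B ?C (tmap ?PB ?PC ?PB ?PC (\<lambda>x. x) (\<lambda>x. x) x))"
      by (rule tmap_cong) (simp_all add: swap tmap_id vec_space_P fin)
    have 3: "tmap (?RX \<otimes> ?RY) (?PB \<otimes> ?PC) ?RXY ?PBC (m (quot X rX) (quot Y rY)) (m ?B ?C)
         (tmap (?PBp \<otimes> ?PCq) (?PB \<otimes> ?PC) (?RX \<otimes> ?RY) (?PB \<otimes> ?PC) (tmap ?PBp ?PCq ?RX ?RY ?fX ?fY) (tmap ?PB ?PC ?PB ?PC (\<lambda>x. x) (\<lambda>x. x)) ?sw) =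
        tmap (?PBp \<otimes> ?PCq) (?PB \<otimes> ?PC) ?RXY ?PBC (\<lambda>x. m (quot X rX) (quot Y rY) (tmap ?PBp ?PCq ?RX ?RY ?fX ?fY x))
         (\<lambda>x. m ?B ?C (tmap ?PB ?PC ?PB ?PC (\<lambda>x. x) (\<lambda>x. x) x)) ?sw"
      by (rule tmap_tmap) (intro vs l ml tmap_linear linear_on_id sw)+
    have 4: "tswap_mid ?RX ?PB ?RY ?PC (tmap (?PBp \<otimes> ?PB) (?PCq \<otimes> ?PC) (?RX \<otimes> ?PB) (?RY \<otimes> ?PC)
           (tmap ?PBp ?PB ?RX ?PB ?fX (\<lambda>x. x)) (tmap ?PCq ?PC ?RY ?PC ?fY (\<lambda>x. x)) ?dd) =
         tmap (?PBp \<otimes> ?PCq) (?PB \<otimes> ?PC) (?RX \<otimes> ?RY) (?PB \<otimes> ?PC) (tmap ?PBp ?PCq ?RX ?RY ?fX ?fY) (tmap ?PB ?PC ?PB ?PC (\<lambda>x. x) (\<lambda>x. x)) ?sw"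
      by (rule tswap_mid_tmap) (intro vs l linear_on_id dd)+
    have lhs: "dq (X \<union> Y) (rX' \<union> rY') (rX \<union> rY) (m ?B ?C t) = tmap ?Ppq ?PBC ?RXY ?PBC ?f (\<lambda>x. x) (delta (?B \<union> ?C) (?p \<union> ?q) (m ?B ?C t))"
      unfolding delta_quot_def BC qr Bp id_def by (rule refl)
    show ?thesis
      unfolding lhs base 1 2 3[symmetric] 4[symmetric] tmap_dq[OF X(1,2) r(1) r'(1) r(2,3) r'(2) r(4) t] BC by (rule refl)
  qed
  show ?D if v: "v \<in> vcarrier (PQ (X \<union> Y) (rX' \<union> rY'))"
  proof -
    note v' = v[unfolded BC]
    note d = linear_on_in[OF dl(3) v']
    have Dl: "linear_on ?RXY (?RX \<otimes> ?RY) (D (quot X rX) (quot Y rY))"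
      unfolding RXY by (rule D_linear[OF finite_quot[OF X(1)] finite_quot[OF X(2)] disjR])
    note Dl' = D_linear[OF fp disj2] D_linear[OF fin(1,2) disj] and ml = m_linear[OF fin(1,2) disj]
    note Dv = linear_on_in[OF Dl'(2) v']
    let ?dd = "tmap ?PB ?PC (?PBp \<otimes> ?PB) (?PCq \<otimes> ?PC) (delta ?B ?p) (delta ?C ?q) (D ?B ?C v)"
    have ddl: "linear_on (?PB \<otimes> ?PC) ((?PBp \<otimes> ?PB) \<otimes> (?PCq \<otimes> ?PC)) (tmap ?PB ?PC (?PBp \<otimes> ?PB) (?PCq \<otimes> ?PC) (delta ?B ?p) (delta ?C ?q))"
      by (intro tmap_linear dl vs)
    note dd = linear_on_in[OF ddl Dv]
    have base: "tmap ?Ppq ?PBC (?PBp \<otimes> ?PCq) ?PBC (D (quot ?B ?p) (quot ?C ?q)) (\<lambda>x. x) (delta (?B \<union> ?C) (?p \<union> ?q) v) =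
        m1324 ?PBp ?PB ?PCq ?PC ?PBC (m ?B ?C) ?dd"
      using delta_D[OF fin(1,2) disj epq _ _ _ v', of ?p ?q] by (simp add: equivs_restrict_Un[OF pq disj] Bp id_def)
    have 1: "tmap ?RXY ?PBC (?RX \<otimes> ?RY) ?PBC (D (quot X rX) (quot Y rY)) (\<lambda>x. x) (tmap ?Ppq ?PBC ?RXY ?PBC ?f (\<lambda>x. x) (delta (?B \<union> ?C) (?p \<union> ?q) v)) =
        tmap ?Ppq ?PBC (?RX \<otimes> ?RY) ?PBC (\<lambda>x. D (quot X rX) (quot Y rY) (?f x)) (\<lambda>x. x) (delta (?B \<union> ?C) (?p \<union> ?q) v)"
      by (rule tmap_tmap) (intro vs l Dl linear_on_id d)+
    \<comment> \<open>The dual square: naturality of the coproduct for \<open>flatten\<close> on the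
      union of the iterated quotients.\<close>
    have swap: "D (quot X rX) (quot Y rY) (?f x) = tmap ?PBp ?PCq ?RX ?RY ?fX ?fY (D (quot ?B ?p) (quot ?C ?q) x)"
      if x: "x \<in> vcarrier ?Ppq" for x
      using D_natural[OF fp disj2 flq(2) x] by (simp add: flX(1) flY(1))
    have 2: "tmap ?Ppq ?PBC (?RX \<otimes> ?RY) ?PBC (\<lambda>x. D (quot X rX) (quot Y rY) (?f x)) (\<lambda>x. x) =
        tmap ?Ppq ?PBC (?RX \<otimes> ?RY) ?PBC (\<lambda>x. tmap ?PBp ?PCq ?RX ?RY ?fX ?fY (D (quot ?B ?p) (quot ?C ?q) x)) (\<lambda>x. x)"
      by (rule tmap_cong) (simp_all add: swap)
    have 3: "tmap (?PBp \<otimes> ?PCq) ?PBC (?RX \<otimes> ?RY) ?PBC (tmap ?PBp ?PCq ?RX ?RY ?fX ?fY) (\<lambda>x. x)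
          (tmap ?Ppq ?PBC (?PBp \<otimes> ?PCq) ?PBC (D (quot ?B ?p) (quot ?C ?q)) (\<lambda>x. x) (delta (?B \<union> ?C) (?p \<union> ?q) v)) =
        tmap ?Ppq ?PBC (?RX \<otimes> ?RY) ?PBC (\<lambda>x. tmap ?PBp ?PCq ?RX ?RY ?fX ?fY (D (quot ?B ?p) (quot ?C ?q) x)) (\<lambda>x. x) (delta (?B \<union> ?C) (?p \<union> ?q) v)"
      by (rule tmap_tmap) (intro vs l Dl' tmap_linear linear_on_id d)+
    have 4: "m1324 ?RX ?PB ?RY ?PC ?PBC (m ?B ?C) (tmap (?PBp \<otimes> ?PB) (?PCq \<otimes> ?PC) (?RX \<otimes> ?PB) (?RY \<otimes> ?PC)
           (tmap ?PBp ?PB ?RX ?PB ?fX (\<lambda>x. x)) (tmap ?PCq ?PC ?RY ?PC ?fY (\<lambda>x. x)) ?dd) =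
         tmap (?PBp \<otimes> ?PCq) ?PBC (?RX \<otimes> ?RY) ?PBC (tmap ?PBp ?PCq ?RX ?RY ?fX ?fY) (\<lambda>x. x) (m1324 ?PBp ?PB ?PCq ?PC ?PBC (m ?B ?C) ?dd)"
      by (rule m1324_tmap) (intro vs l ml linear_on_id dd | simp add: tmap_id vec_space_P fin)+
    have lhs: "dq (X \<union> Y) (rX' \<union> rY') (rX \<union> rY) v = tmap ?Ppq ?PBC ?RXY ?PBC ?f (\<lambda>x. x) (delta (?B \<union> ?C) (?p \<union> ?q) v)"
      unfolding delta_quot_def BC qr Bp id_def by (rule refl)
    show ?thesis
      unfolding tmap_dq[OF X(1,2) r(1) r'(1) r(2,3) r'(2) r(4) Dv] lhs BC id_def 1 2 3[symmetric] base 4 by (rule refl)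
  qed
qed

text \<open>By \<open>quot_rel_splits\<close>, a relation joining X to Y still joins X/rX' to Y/rY',
  so the vanishing case of the hypothesis on \<open>delta\<close> applies to these
  quotients.\<close>

lemma dq_m_zero:
  assumes X: "finite X" "finite Y" "X \<inter> Y = {}" and r': "rX' \<in> equivs X" "rY' \<in> equivs Y"
    and r: "r \<in> equivs (X \<union> Y)" "rX' \<union> rY' \<subseteq> r" "\<not> splits r X Y"
    and t: "t \<in> vcarrier (PQ X rX' \<otimes> PQ Y rY')"
  shows "dq (X \<union> Y) (rX' \<union> rY') r (m (quot X rX') (quot Y rY') t) = 0"
proof -
  let ?B = "quot X rX'" and ?C = "quot Y rY'" and ?q = "quot_rel (rX' \<union> rY') r"
  have fin: "finite ?B" "finite ?C" "finite (X \<union> Y)" using X by (auto intro: finite_quot)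
  note e = equivs_Un[OF r' X(3)]
  note R = fin(3) r(1) e r(2)
  have BC: "quot (X \<union> Y) (rX' \<union> rY') = ?B \<union> ?C" by (rule quot_Un[OF r' X(3)])
  note q = quot_rel_equivs[OF R, unfolded BC]
  have disj: "?B \<inter> ?C = {}" by (rule quot_disjoint[OF X(1,2) r' X(3)])
  have "?q \<noteq> ?q \<inter> ?B \<times> ?B \<union> ?q \<inter> ?C \<times> ?C"
    using quot_rel_splits[OF X r' r(1,2)] r(3) by (simp only: splits_def simp_thms)
  then have z: "delta (?B \<union> ?C) ?q (m ?B ?C t) = 0" using delta_m[OF fin(1,2) disj q t] by (simp only: Let_def if_False)
  note l = act_flatten_linear[OF R, unfolded BC]
  have tl: "linear_on (PQ (?B \<union> ?C) ?q \<otimes> P (?B \<union> ?C)) (PQ (X \<union> Y) r \<otimes> P (?B \<union> ?C))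
      (tmap (PQ (?B \<union> ?C) ?q) (P (?B \<union> ?C)) (PQ (X \<union> Y) r) (P (?B \<union> ?C)) (act (quot (?B \<union> ?C) ?q) flatten) id)"
    by (intro tmap_linear l linear_on_id[folded id_def] vec_space_P finite_quot finite_UnI fin X)
  show ?thesis unfolding delta_quot_def BC z
    by (rule linear_on_zero[OF _ tl]) (intro vec_space_tensor vec_space_P finite_quot finite_UnI fin X)
qed

text \<open>After the product, \<open>delta'\<close> runs over all relations coarser than
  \<open>r' \<union> s'\<close>. Those that do not split contribute nothing, and the others are
  pairs of coarser relations, as in the double sum obtained from the two factors.\<close>

lemma com_delta_m:
  assumes X: "finite X" "finite Y" "X \<inter> Y = {}" and t: "t \<in> vcarrier (P' X \<otimes> P' Y)"
  shows "delta' (X \<union> Y) (m' X Y t) =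
    tmap (P' X \<otimes> P' Y) (P' X \<otimes> P' Y) (P' (X \<union> Y)) (P' (X \<union> Y))
      (m' X Y) (m' X Y)
      (tswap_mid (P' X) (P' X) (P' Y) (P' Y)
        (tmap (P' X) (P' Y) (P' X \<otimes> P' X) (P' Y \<otimes> P' Y)
          (delta' X) (delta' Y) t))"
proof -
  let ?QX = "P' X" and ?QY = "P' Y" and ?QXY = "P' (X \<union> Y)"
  have XY: "finite (X \<union> Y)" using X by simp
  note vs = vec_space_P_quot vec_space_com X(1,2) XY vec_space_tensor
  let ?M = "\<lambda>t. tmap (?QX \<otimes> ?QY) (?QX \<otimes> ?QY) ?QXY ?QXY (m' X Y) (m' X Y) (tswap_mid ?QX ?QX ?QY ?QY t)"
  have lM: "linear_on ((?QX \<otimes> ?QX) \<otimes> (?QY \<otimes> ?QY)) (?QXY \<otimes> ?QXY) ?M"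
    by (intro linear_on_comp[OF tswap_mid_linear tmap_linear] vs com_mult_linear X)
  show ?thesis
  proof (rule com_ext2[OF X(1,2) _ _ _ t, where U = "?QXY \<otimes> ?QXY"
        and F = "\<lambda>t. delta' (X \<union> Y) (m' X Y t)"
        and G = "\<lambda>t. ?M (tmap ?QX ?QY (?QX \<otimes> ?QX) (?QY \<otimes> ?QY) (delta' X) (delta' Y) t)"])
    show "linear_on (?QX \<otimes> ?QY) (?QXY \<otimes> ?QXY) (\<lambda>t. delta' (X \<union> Y) (m' X Y t))"
      by (rule linear_on_comp[OF com_mult_linear[OF X] com_delta_linear[OF XY]])
    show "linear_on (?QX \<otimes> ?QY) (?QXY \<otimes> ?QXY)
        (\<lambda>t. ?M (tmap ?QX ?QY (?QX \<otimes> ?QX) (?QY \<otimes> ?QY) (delta' X) (delta' Y) t))"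
      by (intro linear_on_comp[OF tmap_linear lM] vs com_delta_linear X)
  next
    fix r' s' v w assume r': "r' \<in> equivs X" "s' \<in> equivs Y" and v: "v \<in> vcarrier (PQ X r')" "w \<in> vcarrier (PQ Y s')"
    note e = equivs_Un[OF r' X(3)]
    let ?A = "PQ X r'" and ?B = "PQ Y s'"
    let ?PX = "\<lambda>r. PQ X r" and ?PY = "\<lambda>s. PQ Y s" and ?PXY = "\<lambda>r. PQ (X \<union> Y) r"
    let ?vw = "ten ?A ?B v w"
    let ?inX = "\<lambda>r. tmap (?PX r) ?A ?QX ?QX (com_in r) (com_in r')" and ?inY = "\<lambda>s. tmap (?PY s) ?B ?QY ?QY (com_in s) (com_in s')"
    have inX: "linear_on (?PX r \<otimes> ?A) (?QX \<otimes> ?QX) (?inX r)" if "r \<in> coarser X r'" for r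
      using that by (intro tmap_linear vs com_in_linear r') auto
    have inY: "linear_on (?PY s \<otimes> ?B) (?QY \<otimes> ?QY) (?inY s)" if "s \<in> coarser Y s'" for s
      using that by (intro tmap_linear vs com_in_linear r') auto
    note dX = dq_closed[OF X(1) r'(1) _ v(1)] and dY = dq_closed[OF X(2) r'(2) _ v(2)]
    note iX = linear_on_in[OF inX dX] and iY = linear_on_in[OF inY dY]
    \<comment> \<open>The term of a pair of relations once the inclusions are outside. The left side
      reaches it through \<open>dq_m\<close>, the right side through
      \<open>com_mult_swap\<close>.\<close>
    define T where "T r s = tmap (?PXY (r \<union> s)) (?PXY (r' \<union> s')) ?QXY ?QXY (com_in (r \<union> s)) (com_in (r' \<union> s'))
        (tmap (?PX r \<otimes> ?PY s) (?A \<otimes> ?B) (?PXY (r \<union> s)) (?PXY (r' \<union> s')) (m (quot X r) (quot Y s)) (m (quot X r') (quot Y s'))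
          (tswap_mid (?PX r) ?A (?PY s) ?B (ten (?PX r \<otimes> ?A) (?PY s \<otimes> ?B) (dq X r' r v) (dq Y s' s w))))" for r s
    let ?L = "\<lambda>r. tmap (?PXY r) (?PXY (r' \<union> s')) ?QXY ?QXY (com_in r) (com_in (r' \<union> s')) (dq (X \<union> Y) (r' \<union> s') r (m (quot X r') (quot Y s') ?vw))"
    have "delta' (X \<union> Y) (m' X Y (ten ?QX ?QY (com_in r' v) (com_in s' w))) = (\<Sum>r\<in>coarser (X \<union> Y) (r' \<union> s'). ?L r)"
      unfolding com_mult_ten[OF X r' v] com_delta_in[OF XY e] by (rule refl)
    also have "\<dots> = (\<Sum>r\<in>coarser (X \<union> Y) (r' \<union> s'). if splits r X Y then ?L r else 0)"
    proof (rule sum.cong[OF refl])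
      fix r assume rc: "r \<in> coarser (X \<union> Y) (r' \<union> s')"
      show "?L r = (if splits r X Y then ?L r else 0)"
      proof (cases "splits r X Y")
        case False
        have z: "dq (X \<union> Y) (r' \<union> s') r (m (quot X r') (quot Y s') ?vw) = 0"
          using rc False by (intro dq_m_zero X r' ten_in v) auto
        have "linear_on (?PXY r \<otimes> ?PXY (r' \<union> s')) (?QXY \<otimes> ?QXY) (tmap (?PXY r) (?PXY (r' \<union> s')) ?QXY ?QXY (com_in r) (com_in (r' \<union> s')))"
          using rc by (intro tmap_linear vs com_in_linear e) auto
        then have "?L r = 0" unfolding z by (rule linear_on_zero[rotated]) (intro vs)
        then show ?thesis by (simp only: if_cancel)
      qed (simp only: if_True)
    qed
    also have "\<dots> = (\<Sum>r\<in>coarser X r'. \<Sum>s\<in>coarser Y s'. ?L (r \<union> s))" by (rule sum_splits[OF X r'])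
    also have "\<dots> = (\<Sum>r\<in>coarser X r'. \<Sum>s\<in>coarser Y s'. T r s)"
    proof (intro sum.cong refl)
      fix r s assume rc: "r \<in> coarser X r'" and sc: "s \<in> coarser Y s'"
      then have r: "r \<in> equivs X" "r' \<subseteq> r" "s \<in> equivs Y" "s' \<subseteq> s" by auto
      have 1: "tmap ?A ?B (?PX r \<otimes> ?A) (?PY s \<otimes> ?B) (dq X r' r) (dq Y s' s) ?vw = ten (?PX r \<otimes> ?A) (?PY s \<otimes> ?B) (dq X r' r v) (dq Y s' s w)"
        by (rule tmap_ten) (intro vs dq_linear r r' v)+
      show "?L (r \<union> s) = T r s" unfolding dq_m[OF X r' r ten_in[OF v]] 1 T_def by (rule refl)
    qed
    finally have L: "delta' (X \<union> Y) (m' X Y (ten ?QX ?QY (com_in r' v) (com_in s' w))) =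
      (\<Sum>r\<in>coarser X r'. \<Sum>s\<in>coarser Y s'. T r s)" .
    have vQ: "vec_space (?QX \<otimes> ?QX)" "vec_space (?QY \<otimes> ?QY)" "vec_space ((?QX \<otimes> ?QX) \<otimes> (?QY \<otimes> ?QY))" by (intro vs)+
    have sY: "(\<Sum>s\<in>coarser Y s'. ?inY s (dq Y s' s w)) \<in> vcarrier (?QY \<otimes> ?QY)" by (rule vec_space_sum[OF vQ(2) iY])
    have "tmap ?QX ?QY (?QX \<otimes> ?QX) (?QY \<otimes> ?QY) (delta' X) (delta' Y) (ten ?QX ?QY (com_in r' v) (com_in s' w)) =
        ten (?QX \<otimes> ?QX) (?QY \<otimes> ?QY) (delta' X (com_in r' v)) (delta' Y (com_in s' w))"
      by (rule tmap_ten) (intro vs com_delta_linear X com_in_closed r' v)+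
    also have "\<dots> = (\<Sum>r\<in>coarser X r'. ten (?QX \<otimes> ?QX) (?QY \<otimes> ?QY) (?inX r (dq X r' r v)) (\<Sum>s\<in>coarser Y s'. ?inY s (dq Y s' s w)))"
      unfolding com_delta_in[OF X(1) r'(1)] com_delta_in[OF X(2) r'(2)]
      by (rule linear_on_map_sum[OF vQ(1) linear_on_ten(1)[OF sY] iX])
    also have "\<dots> = (\<Sum>r\<in>coarser X r'. \<Sum>s\<in>coarser Y s'. ten (?QX \<otimes> ?QX) (?QY \<otimes> ?QY) (?inX r (dq X r' r v)) (?inY s (dq Y s' s w)))"
      by (rule sum.cong[OF refl], rule linear_on_map_sum[OF vQ(2) linear_on_ten(2)[OF iX] iY])
    finally have R: "tmap ?QX ?QY (?QX \<otimes> ?QX) (?QY \<otimes> ?QY) (delta' X) (delta' Y) (ten ?QX ?QY (com_in r' v) (com_in s' w)) =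
        (\<Sum>r\<in>coarser X r'. \<Sum>s\<in>coarser Y s'. ten (?QX \<otimes> ?QX) (?QY \<otimes> ?QY) (?inX r (dq X r' r v)) (?inY s (dq Y s' s w)))" .
    have "?M (\<Sum>r\<in>coarser X r'. \<Sum>s\<in>coarser Y s'. ten (?QX \<otimes> ?QX) (?QY \<otimes> ?QY) (?inX r (dq X r' r v)) (?inY s (dq Y s' s w))) =
        (\<Sum>r\<in>coarser X r'. ?M (\<Sum>s\<in>coarser Y s'. ten (?QX \<otimes> ?QX) (?QY \<otimes> ?QY) (?inX r (dq X r' r v)) (?inY s (dq Y s' s w))))"
      by (rule linear_on_map_sum[OF vQ(3) lM]) (intro vec_space_sum[OF vQ(3)] ten_in iX iY)
    also have "\<dots> = (\<Sum>r\<in>coarser X r'. \<Sum>s\<in>coarser Y s'. ?M (ten (?QX \<otimes> ?QX) (?QY \<otimes> ?QY) (?inX r (dq X r' r v)) (?inY s (dq Y s' s w))))"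
      by (rule sum.cong[OF refl], rule linear_on_map_sum[OF vQ(3) lM]) (intro ten_in iX iY)
    also have "\<dots> = (\<Sum>r\<in>coarser X r'. \<Sum>s\<in>coarser Y s'. T r s)"
    proof (intro sum.cong refl)
      fix r s assume rc: "r \<in> coarser X r'" and sc: "s \<in> coarser Y s'"
      then have r: "r \<in> equivs X" "s \<in> equivs Y" by auto
      have 1: "tmap (?PX r \<otimes> ?A) (?PY s \<otimes> ?B) (?QX \<otimes> ?QX) (?QY \<otimes> ?QY) (?inX r) (?inY s) (ten (?PX r \<otimes> ?A) (?PY s \<otimes> ?B) (dq X r' r v) (dq Y s' s w)) =
          ten (?QX \<otimes> ?QX) (?QY \<otimes> ?QY) (?inX r (dq X r' r v)) (?inY s (dq Y s' s w))"
        by (rule tmap_ten) (intro vs inX inY rc sc dX dY)+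
      show "?M (ten (?QX \<otimes> ?QX) (?QY \<otimes> ?QY) (?inX r (dq X r' r v)) (?inY s (dq Y s' s w))) = T r s"
        unfolding 1[symmetric] T_def
        by (rule com_mult_swap[OF X(1,1,2,2,3,3) r(1) r'(1) r(2) r'(2) ten_in[OF dX[OF rc] dY[OF sc]]])
    qed
    finally show "delta' (X \<union> Y) (m' X Y (ten ?QX ?QY (com_in r' v) (com_in s' w))) =
        ?M (tmap ?QX ?QY (?QX \<otimes> ?QX) (?QY \<otimes> ?QY) (delta' X) (delta' Y) (ten ?QX ?QY (com_in r' v) (com_in s' w)))"
      unfolding L R by (rule sym)
  qed
qed

text \<open>Of the relations \<open>r\<close> coarser than \<open>r'\<close>, the coproduct
  \<open>D'\<close> keeps the split ones. If \<open>r'\<close> splits, these are pairs and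
  \<open>dq_D\<close> compares the terms. If it does not, \<open>D'\<close> kills the summand on the
  left, and on the right no coarser relation splits.\<close>

lemma com_delta_D:
  assumes X: "finite X" "finite Y" "X \<inter> Y = {}" and v: "v \<in> vcarrier (P' (X \<union> Y))"
  shows "m1324 (P' X) (P' X) (P' Y) (P' Y) (P' (X \<union> Y)) (m' X Y)
      (tmap (P' X) (P' Y) (P' X \<otimes> P' X) (P' Y \<otimes> P' Y)
        (delta' X) (delta' Y) (D' X Y v)) =
    tmap (P' (X \<union> Y)) (P' (X \<union> Y)) (P' X \<otimes> P' Y) (P' (X \<union> Y))
      (D' X Y) id (delta' (X \<union> Y) v)"
proof -
  let ?QX = "P' X" and ?QY = "P' Y" and ?QXY = "P' (X \<union> Y)"
  have XY: "finite (X \<union> Y)" using X by simp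
  note vs = vec_space_P_quot vec_space_com X(1,2) XY vec_space_tensor
  note lid = linear_on_id[folded id_def]
  let ?M = "m1324 ?QX ?QX ?QY ?QY ?QXY (m' X Y)"
  let ?dd = "tmap ?QX ?QY (?QX \<otimes> ?QX) (?QY \<otimes> ?QY) (delta' X) (delta' Y)"
  let ?R = "tmap ?QXY ?QXY (?QX \<otimes> ?QY) ?QXY (D' X Y) id"
  have lM: "linear_on ((?QX \<otimes> ?QX) \<otimes> (?QY \<otimes> ?QY)) ((?QX \<otimes> ?QY) \<otimes> ?QXY) ?M"
    by (intro m1324_linear vs com_mult_linear X)
  have ldd: "linear_on (?QX \<otimes> ?QY) ((?QX \<otimes> ?QX) \<otimes> (?QY \<otimes> ?QY)) ?dd"
    by (intro tmap_linear vs com_delta_linear X)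
  have lMd: "linear_on (?QX \<otimes> ?QY) ((?QX \<otimes> ?QY) \<otimes> ?QXY) (\<lambda>t. ?M (?dd t))" by (rule linear_on_comp[OF ldd lM])
  have lR: "linear_on (?QXY \<otimes> ?QXY) ((?QX \<otimes> ?QY) \<otimes> ?QXY) ?R"
    by (intro tmap_linear vs com_comult_linear X lid)
  show ?thesis
  proof (rule com_ext[OF XY linear_on_comp[OF com_comult_linear[OF X] lMd] linear_on_comp[OF com_delta_linear[OF XY] lR] _ v])
    fix r' v assume r': "r' \<in> equivs (X \<union> Y)" and v: "v \<in> vcarrier (PQ (X \<union> Y) r')"
    let ?PX = "\<lambda>r. PQ X r" and ?PY = "\<lambda>s. PQ Y s" and ?PXY = "\<lambda>r. PQ (X \<union> Y) r"
    let ?res = "\<lambda>r. tmap (?PX (r \<inter> X \<times> X) \<otimes> ?PY (r \<inter> Y \<times> Y)) (?PXY r') (?QX \<otimes> ?QY) ?QXY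
        (tmap (?PX (r \<inter> X \<times> X)) (?PY (r \<inter> Y \<times> Y)) ?QX ?QY (com_in (r \<inter> X \<times> X)) (com_in (r \<inter> Y \<times> Y))) (com_in r')
        (tmap (?PXY r) (?PXY r') (?PX (r \<inter> X \<times> X) \<otimes> ?PY (r \<inter> Y \<times> Y)) (?PXY r')
          (D (quot X (r \<inter> X \<times> X)) (quot Y (r \<inter> Y \<times> Y))) id (dq (X \<union> Y) r' r v))"
    have vQ: "vec_space (?QXY \<otimes> ?QXY)" by (intro vs)
    have "?R (delta' (X \<union> Y) (com_in r' v)) =
        (\<Sum>r\<in>coarser (X \<union> Y) r'. ?R (tmap (?PXY r) (?PXY r') ?QXY ?QXY (com_in r) (com_in r') (dq (X \<union> Y) r' r v)))"
      unfolding com_delta_in[OF XY r']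
      by (rule linear_on_map_sum[OF vQ lR], rule linear_on_in[OF tmap_linear dq_closed])
        (auto intro: vs com_in_linear r' v)
    also have "\<dots> = (\<Sum>r\<in>coarser (X \<union> Y) r'. if splits r X Y then ?res r else 0)"
    proof (rule sum.cong[OF refl])
      fix r assume rc: "r \<in> coarser (X \<union> Y) r'"
      then have r: "r \<in> equivs (X \<union> Y)" by simp
      note d = dq_closed[OF XY r' rc v]
      have "?R (tmap (?PXY r) (?PXY r') ?QXY ?QXY (com_in r) (com_in r') (dq (X \<union> Y) r' r v)) =
          tmap (?PXY r) (?PXY r') (?QX \<otimes> ?QY) ?QXY (\<lambda>x. D' X Y (com_in r x)) (\<lambda>x. com_in r' x) (dq (X \<union> Y) r' r v)"
        unfolding id_def by (rule tmap_tmap) (intro vs com_in_linear r r' com_comult_linear X linear_on_id d)+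
      from trans[OF this com_comult_tmap(1)[OF X r vec_space_P_quot[OF XY] vec_space_com[OF XY] com_in_linear[OF XY r'] d]]
      show "?R (tmap (?PXY r) (?PXY r') ?QXY ?QXY (com_in r) (com_in r') (dq (X \<union> Y) r' r v)) = (if splits r X Y then ?res r else 0)" .
    qed
    finally have R: "?R (delta' (X \<union> Y) (com_in r' v)) = (\<Sum>r\<in>coarser (X \<union> Y) r'. if splits r X Y then ?res r else 0)" .
    show "?M (?dd (D' X Y (com_in r' v))) = ?R (delta' (X \<union> Y) (com_in r' v))"
    proof (cases "splits r' X Y")
      case False
      then have "(\<Sum>r\<in>coarser (X \<union> Y) r'. if splits r X Y then ?res r else 0) = 0"
        by (intro sum.neutral ballI if_not_P) (use splits_mono in blast)
      moreover have "?M (?dd 0) = 0" by (rule linear_on_zero[OF _ lMd]) (intro vs)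
      ultimately show ?thesis unfolding R com_comult_in[OF X r'] if_not_P[OF False] by (simp only:)
    next
      case sp: True
      let ?rX = "r' \<inter> X \<times> X" and ?rY = "r' \<inter> Y \<times> Y"
      have e: "?rX \<in> equivs X" "?rY \<in> equivs Y" by (rule equivs_restrict[OF r'], blast)+
      have r'eq: "r' = ?rX \<union> ?rY" using sp by (simp only: splits_def)
      let ?A = "?PX ?rX" and ?B = "?PY ?rY"
      let ?Dv = "D (quot X ?rX) (quot Y ?rY) v"
      have Dv: "?Dv \<in> vcarrier (?A \<otimes> ?B)" by (rule linear_on_in[OF D_quot_linear[OF X r' sp] v])
      let ?inX = "\<lambda>r. tmap (?PX r) ?A ?QX ?QX (com_in r) (com_in ?rX)" and ?inY = "\<lambda>s. tmap (?PY s) ?B ?QY ?QY (com_in s) (com_in ?rY)"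
      have inX: "linear_on (?PX r \<otimes> ?A) (?QX \<otimes> ?QX) (?inX r)" if "r \<in> coarser X ?rX" for r
        using that by (intro tmap_linear vs com_in_linear e) auto
      have inY: "linear_on (?PY s \<otimes> ?B) (?QY \<otimes> ?QY) (?inY s)" if "s \<in> coarser Y ?rY" for s
        using that by (intro tmap_linear vs com_in_linear e) auto
      have dX: "linear_on ?A (?PX r \<otimes> ?A) (dq X ?rX r)" if "r \<in> coarser X ?rX" for r
        using that by (intro dq_linear X e) auto
      have dY: "linear_on ?B (?PY s \<otimes> ?B) (dq Y ?rY s)" if "s \<in> coarser Y ?rY" for s
        using that by (intro dq_linear X e) auto
      \<comment> \<open>One term of the double sum that results from extracting in both factors of
        the coproduct, before the inclusion into \<open>P'\<close>.\<close>
      define N where "N r s = tmap ?A ?B (?PX r \<otimes> ?A) (?PY s \<otimes> ?B) (dq X ?rX r) (dq Y ?rY s) ?Dv" for r s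
      have N: "N r s \<in> vcarrier ((?PX r \<otimes> ?A) \<otimes> (?PY s \<otimes> ?B))" if "r \<in> coarser X ?rX" "s \<in> coarser Y ?rY" for r s
        unfolding N_def by (intro linear_on_in[OF tmap_linear Dv] vs dX dY that)
      define T where "T r s = tmap (?PX r \<otimes> ?PY s) (?PXY r') (?QX \<otimes> ?QY) ?QXY (tmap (?PX r) (?PY s) ?QX ?QY (com_in r) (com_in s)) (com_in r')
          (m1324 (?PX r) ?A (?PY s) ?B (?PXY r') (m (quot X ?rX) (quot Y ?rY)) (N r s))" for r s
      let ?J = "\<lambda>r s. tmap (?PX r \<otimes> ?A) (?PY s \<otimes> ?B) (?QX \<otimes> ?QX) (?QY \<otimes> ?QY) (?inX r) (?inY s) (N r s)"
      have J: "?J r s \<in> vcarrier ((?QX \<otimes> ?QX) \<otimes> (?QY \<otimes> ?QY))" if "r \<in> coarser X ?rX" "s \<in> coarser Y ?rY" for r s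
        by (intro linear_on_in[OF tmap_linear N] vs inX inY that)
      have 1: "?dd (tmap ?A ?B ?QX ?QY (com_in ?rX) (com_in ?rY) ?Dv) =
          tmap ?A ?B (?QX \<otimes> ?QX) (?QY \<otimes> ?QY) (\<lambda>x. delta' X (com_in ?rX x)) (\<lambda>y. delta' Y (com_in ?rY y)) ?Dv"
        by (rule tmap_tmap) (intro vs com_in_linear e com_delta_linear X Dv)+
      have lY: "linear_on ?B (?QY \<otimes> ?QY) (\<lambda>y. delta' Y (com_in ?rY y))"
        by (rule linear_on_comp[OF com_in_linear[OF X(2) e(2)] com_delta_linear[OF X(2)]])
      have 2: "tmap ?A ?B (?QX \<otimes> ?QX) (?QY \<otimes> ?QY) (\<lambda>x. delta' X (com_in ?rX x)) (\<lambda>y. delta' Y (com_in ?rY y)) ?Dv =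
          (\<Sum>r\<in>coarser X ?rX. tmap ?A ?B (?QX \<otimes> ?QX) (?QY \<otimes> ?QY) (\<lambda>x. ?inX r (dq X ?rX r x)) (\<lambda>y. delta' Y (com_in ?rY y)) ?Dv)"
        unfolding com_delta_in[OF X(1) e(1)]
        by (rule tmap_sum_left) (intro vs linear_on_comp[OF dX inX] lY Dv | assumption)+
      have 3: "tmap ?A ?B (?QX \<otimes> ?QX) (?QY \<otimes> ?QY) (\<lambda>x. ?inX r (dq X ?rX r x)) (\<lambda>y. delta' Y (com_in ?rY y)) ?Dv =
          (\<Sum>s\<in>coarser Y ?rY. ?J r s)" if rc: "r \<in> coarser X ?rX" for r
      proof -
        have "tmap ?A ?B (?QX \<otimes> ?QX) (?QY \<otimes> ?QY) (\<lambda>x. ?inX r (dq X ?rX r x)) (\<lambda>y. delta' Y (com_in ?rY y)) ?Dv =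
          (\<Sum>s\<in>coarser Y ?rY. tmap ?A ?B (?QX \<otimes> ?QX) (?QY \<otimes> ?QY) (\<lambda>x. ?inX r (dq X ?rX r x)) (\<lambda>y. ?inY s (dq Y ?rY s y)) ?Dv)"
          unfolding com_delta_in[OF X(2) e(2)]
          by (rule tmap_sum_right) (intro vs linear_on_comp[OF dX inX] linear_on_comp[OF dY inY] rc Dv | assumption)+
        also have "\<dots> = (\<Sum>s\<in>coarser Y ?rY. ?J r s)"
          unfolding N_def
          by (rule sum.cong[OF refl], rule tmap_tmap[symmetric]) (intro vs dX inX dY inY rc Dv | assumption)+
        finally show ?thesis .
      qed
      have dd: "?dd (tmap ?A ?B ?QX ?QY (com_in ?rX) (com_in ?rY) ?Dv) = (\<Sum>r\<in>coarser X ?rX. \<Sum>s\<in>coarser Y ?rY. ?J r s)"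
        unfolding 1 2 by (intro sum.cong refl 3)
      have vM: "vec_space ((?QX \<otimes> ?QX) \<otimes> (?QY \<otimes> ?QY))" by (intro vs)
      have "?M (\<Sum>r\<in>coarser X ?rX. \<Sum>s\<in>coarser Y ?rY. ?J r s) = (\<Sum>r\<in>coarser X ?rX. ?M (\<Sum>s\<in>coarser Y ?rY. ?J r s))"
        by (rule linear_on_map_sum[OF vM lM]) (intro vec_space_sum[OF vM] J)
      also have "\<dots> = (\<Sum>r\<in>coarser X ?rX. \<Sum>s\<in>coarser Y ?rY. ?M (?J r s))"
        by (rule sum.cong[OF refl], rule linear_on_map_sum[OF vM lM]) (intro J)
      also have "\<dots> = (\<Sum>r\<in>coarser X ?rX. \<Sum>s\<in>coarser Y ?rY. T r s)"
      proof (intro sum.cong refl)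
        fix r s assume rc: "r \<in> coarser X ?rX" and sc: "s \<in> coarser Y ?rY"
        then have r: "r \<in> equivs X" "s \<in> equivs Y" by auto
        have ml: "linear_on (?A \<otimes> ?B) (?PXY r') (m (quot X ?rX) (quot Y ?rY))"
          using m_quot_linear[OF X e] by (simp only: r'eq[symmetric])
        have mn: "m' X Y (tmap ?A ?B ?QX ?QY (com_in ?rX) (com_in ?rY) t) = com_in r' (m (quot X ?rX) (quot Y ?rY) t)"
          if "t \<in> vcarrier (?A \<otimes> ?B)" for t
          using com_mult_tmap[OF X e that] by (simp only: r'eq[symmetric])
        show "?M (?J r s) = T r s"
          unfolding T_def by (rule m1324_tmap) (intro vs com_in_linear r e r' ml com_mult_linear X N rc sc mn | assumption)+
      qed
      finally have L: "?M (?dd (D' X Y (com_in r' v))) = (\<Sum>r\<in>coarser X ?rX. \<Sum>s\<in>coarser Y ?rY. T r s)"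
        unfolding com_comult_in[OF X r'] if_P[OF sp] dd .
      \<comment> \<open>Since \<open>r'\<close> is the union of its two restrictions, the split
        coarser relations are pairs of relations coarser than these restrictions.\<close>
      have "(\<Sum>r\<in>coarser (X \<union> Y) (?rX \<union> ?rY). if splits r X Y then ?res r else 0) =
          (\<Sum>r\<in>coarser X ?rX. \<Sum>s\<in>coarser Y ?rY. ?res (r \<union> s))"
        by (rule sum_splits[OF X e])
      then have R2: "(\<Sum>r\<in>coarser (X \<union> Y) r'. if splits r X Y then ?res r else 0) =
          (\<Sum>r\<in>coarser X ?rX. \<Sum>s\<in>coarser Y ?rY. ?res (r \<union> s))"
        by (simp only: r'eq[symmetric])
      show ?thesis
        unfolding L R R2
      proof (intro sum.cong refl)
        fix r s assume rc: "r \<in> coarser X ?rX" and sc: "s \<in> coarser Y ?rY"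
        then have r: "r \<in> equivs X" "?rX \<subseteq> r" "s \<in> equivs Y" "?rY \<subseteq> s" by auto
        note rr = equivs_restrict_Un[OF r(1,3) X(3)]
        have "v \<in> vcarrier (?PXY (?rX \<union> ?rY))" using v by (simp only: r'eq[symmetric])
        note dqD = dq_D[OF X e r this, unfolded r'eq[symmetric]]
        show "T r s = ?res (r \<union> s)"
          unfolding rr T_def N_def dqD by (rule refl)
      qed
    qed
  qed
qed

lemma com_delta_one: "delta' {} (com_one one) = ten (P' {}) (P' {}) (com_one one) (com_one one)"
proof -
  have E: "finite {}" "{} \<in> equivs {}" by (simp_all add: equivs_empty)
  have o: "one \<in> vcarrier (PQ {} {})" using one_closed by (simp add: quot_empty)
  have "coarser {} {} = {{}}" by (auto simp: equivs_empty)
  then have "delta' {} (com_one one) = in2 {} {} {} {}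
      (ten (PQ {} {}) (PQ {} {}) one one)"
    unfolding com_one_def com_delta_in[OF E] by (simp add: dq_empty one_closed delta_one quot_empty)
  also have "\<dots> = ten (P' {}) (P' {}) (com_one one) (com_one one)"
    unfolding com_one_def by (rule tmap_ten) (intro vec_space_P_quot vec_space_com E com_in_linear o)+
  finally show ?thesis .
qed

lemma com_delta_D_counit:
  assumes v: "v \<in> vcarrier (P' {})"
  shows "contract_left (P' {}) (P' {}) counit' (delta' {} v) =
    vscale (P' {}) (counit' v) (com_one one)"
proof -
  have E: "finite {}" "{} \<in> equivs {}" by (simp_all add: equivs_empty)
  let ?Q = "P' {}" and ?P = "PQ {} {}"
  let ?u = "v {}"
  have u: "?u \<in> vcarrier (P {})" "v = com_in {} ?u"
    using com_component[OF v E(2)] com_decompose[OF E(1) v] by (simp_all add: equivs_empty quot_empty)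
  have d: "delta {} {} ?u \<in> vcarrier (?P \<otimes> ?P)"
    using linear_on_in[OF delta_linear[OF E] u(1)] by (simp add: quot_empty)
  have cc: "(\<lambda>v. counit' (com_in {} v :: ('a, 'v) com)) = counit" by (simp add: com_counit_def com_in_def)
  have "coarser {} {} = {{}}" by (auto simp: equivs_empty)
  then have 1: "delta' {} v = tmap ?P ?P ?Q ?Q (com_in {}) (com_in {}) (delta {} {} ?u)"
    by (subst u(2)) (simp add: com_delta_in[OF E] dq_empty u(1))
  have "contract_left ?Q ?Q counit' (delta' {} v) =
      com_in {} (contract_left ?P ?P (\<lambda>v. counit' (com_in {} v :: ('a, 'v) com)) (delta {} {} ?u))"
    unfolding 1
    by (rule contract_left_tmap[OF vec_space_P_quot[OF E(1)] vec_space_P_quot[OF E(1)] vec_space_com[OF E(1)]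
          vec_space_com[OF E(1)] com_in_linear[OF E] com_in_linear[OF E] com_counit_linear d])
  also have "\<dots> = com_in {} (vscale ?P (counit ?u) one)"
    using delta_D_counit[OF u(1)] by (simp add: cc quot_empty)
  also have "\<dots> = vscale ?Q (counit ?u) (com_in {} one)"
    by (rule linear_on_scale[OF com_in_linear[OF E]]) (simp add: quot_empty one_closed)
  finally show ?thesis by (simp add: com_counit_def com_one_def)
qed

lemma double_twisted_bialgebra_com:
  "double_twisted_bialgebra P' act' m' (com_one one)
     D' counit' delta'"
  by (intro double_twisted_bialgebra.intro double_twisted_bialgebra_axioms.intro twisted_bialgebra_com com_delta_linear
      com_delta_natural com_delta_coassoc com_delta_counit com_delta_m com_delta_one com_delta_D com_delta_D_counit)

end

theorem proposition2p5:
  fixes P :: "'a hf set \<Rightarrow> ('k::field, 'v::ab_group_add) kspace"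
    and act :: "'a hf set \<Rightarrow> ('a hf \<Rightarrow> 'a hf) \<Rightarrow> 'v \<Rightarrow> 'v"
    and m :: "'a hf set \<Rightarrow> 'a hf set \<Rightarrow> ('k, 'v, 'v) tensor \<Rightarrow> 'v"
    and one :: 'v
    and D :: "'a hf set \<Rightarrow> 'a hf set \<Rightarrow> 'v \<Rightarrow> ('k, 'v, 'v) tensor"
    and counit :: "'v \<Rightarrow> 'k"
    and delta :: "'a hf set \<Rightarrow> ('a hf \<times> 'a hf) set \<Rightarrow> 'v \<Rightarrow> ('k, 'v, 'v) tensor"
  assumes "twisted_bialgebra P act m one D counit"
    and "contraction_extraction P act delta"
    and "\<And>X Y r t. finite X \<Longrightarrow> finite Y \<Longrightarrow> X \<inter> Y = {} \<Longrightarrow> r \<in> equivs (X \<union> Y) \<Longrightarrow>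
      t \<in> vcarrier (P X \<otimes> P Y) \<Longrightarrow>
      delta (X \<union> Y) r (m X Y t) =
        (let rX = r \<inter> X \<times> X; rY = r \<inter> Y \<times> Y in
         if r = rX \<union> rY
         then tmap (P (quot X rX) \<otimes> P (quot Y rY)) (P X \<otimes> P Y) (P (quot (X \<union> Y) r)) (P (X \<union> Y))
                (m (quot X rX) (quot Y rY)) (m X Y)
                (tswap_mid (P (quot X rX)) (P X) (P (quot Y rY)) (P Y)
                  (tmap (P X) (P Y) (P (quot X rX) \<otimes> P X) (P (quot Y rY) \<otimes> P Y)
                    (delta X rX) (delta Y rY) t))
         else 0)"
    and "\<And>X Y r rX rY v. finite X \<Longrightarrow> finite Y \<Longrightarrow> X \<inter> Y = {} \<Longrightarrow> r \<in> equivs (X \<union> Y) \<Longrightarrow>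
      rX = r \<inter> X \<times> X \<Longrightarrow> rY = r \<inter> Y \<times> Y \<Longrightarrow> r = rX \<union> rY \<Longrightarrow> v \<in> vcarrier (P (X \<union> Y)) \<Longrightarrow>
      tmap (P (quot (X \<union> Y) r)) (P (X \<union> Y)) (P (quot X rX) \<otimes> P (quot Y rY)) (P (X \<union> Y))
        (D (quot X rX) (quot Y rY)) id (delta (X \<union> Y) r v) =
      m1324 (P (quot X rX)) (P X) (P (quot Y rY)) (P Y) (P (X \<union> Y)) (m X Y)
        (tmap (P X) (P Y) (P (quot X rX) \<otimes> P X) (P (quot Y rY) \<otimes> P Y)
          (delta X rX) (delta Y rY) (D X Y v))"
    and "delta {} {} one = ten (P {}) (P {}) one one"
    and "\<And>v. v \<in> vcarrier (P {}) \<Longrightarrow>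
      contract_left (P {}) (P {}) counit (delta {} {} v) = vscale (P {}) (counit v) one"
  shows "double_twisted_bialgebra (com_space P) (com_act act) (com_mult P m) (com_one one)
           (com_comult P D) (com_counit counit) (com_delta P act delta)"
proof -
  have "hf_double_bialgebra P act m one D counit delta"
    using assms(1,2)
    by (intro hf_double_bialgebra.intro hf_twisted_bialgebra.intro hf_double_bialgebra_axioms.intro assms(3-6))
  then show ?thesis by (rule hf_double_bialgebra.double_twisted_bialgebra_com)
qed

end
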